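(* Suppose that: (1) $\sup_{\theta\in\Theta}|l(X,\theta)|$ is $P_*$-essentially bounded; (2) (i) for some $\bar\theta\in\Theta$ the expectation $\mathbb{E}_{P_*}[l(X,\bar\theta)^2]$ is finite, and (ii) there is a measurable function $\psi:\mathcal{S}\to\mathbb{R}_+$ with $\mathbb{E}_{P_*}[\psi(X)^2]<\infty$ such that $|l(X,\theta)-l(X,\theta')|\le\psi(X)\|\theta-\theta'\|$ for all $\theta,\theta'\in\Theta$ and $P_*$-a.e. $X\in\mathcal{S}$; (3) $\phi$ is two times continuously differentiable in a neighborhood of $t=1$ with $\kappa:=2/\phi''(1)>0$; (4) $\sigma^2(\theta)>0$ for all $\theta\in\Theta^*$. Then, as $n\to\infty$: (a-phi) If $\delta_n=o(n^{-1})$, then $n^{1/2}(\bar\vartheta_n-\vartheta)\rightsquigarrow\inf_{\theta\in\Theta^*}\mathfrak{g}(\theta)$. (b-phi) If $\delta_n=\beta n^{-1}$ for a constant $\beta>0$, then $n^{1/2}(\bar\vartheta_n-\vartheta)\rightsquigarrow\inf_{\theta\in\Theta^*}\{\mathfrak{g}(\theta)+\kappa^{1/2}\beta^{1/2}\sigma(\theta)\}$. (c-phi) If $n^{-1}=o(\delta_n)$, then $\delta_n^{-1/2}(\bar\vartheta_n-\vartheta)\rightsquigarrow\kappa^{1/2}\inf_{\theta\in\Theta^*}\sigma(\theta)$.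
   Context: $\mathcal{S}\subset\mathbb{R}^d$ is a nonempty closed set, $\mathfrak{P}(\mathcal{S})$ is the set of Borel probability measures on $\mathcal{S}$, and $X,X_1,X_2,\dots$ are i.i.d. with distribution $P_*\in\mathfrak{P}(\mathcal{S})$. $P_n=n^{-1}\sum_{i=1}^n\delta_{X_i}$ is the empirical measure. $\Theta\subset\mathbb{R}^m$ is compact and $l:\mathbb{R}^d\times\Theta\to\mathbb{R}$ is continuous on $\mathcal{S}\times\Theta$. $f(\theta):=\mathbb{E}_{P_*}[l(X,\theta)]$, $\vartheta:=\inf_{\theta\in\Theta}f(\theta)$, $\Theta^*:=\arg\min_{\theta\in\Theta}f(\theta)$, $\sigma^2(\theta):=\mathrm{Var}_{P_*}(l(X,\theta))$, $\sigma(\theta):=\sqrt{\sigma^2(\theta)}$. $\phi:\mathbb{R}\to\mathbb{R}_+\cup\{+\infty\}$ is a convex lower semicontinuous function with $\phi(1)=0$ and $\phi(t)=+\infty$ for $t<0$. For $Q\ll P$, $D_\phi(Q\|P):=\mathbb{E}_P[\phi(dQ/dP)]$. The ambiguity set is $\mathfrak{M}_\delta(P):=\{Q\ll P:D_\phi(Q\|P)\le\delta\}$. $(\delta_n)$ is a monotonically decreasing sequence of positive numbers tending to $0$, $\mathcal{F}_n(\theta,\delta_n):=\sup_{Q\in\mathfrak{M}_{\delta_n}(P_n)}\mathbb{E}_Q[l(X,\theta)]$, and $\bar\vartheta_n:=\inf_{\theta\in\Theta}\mathcal{F}_n(\theta,\delta_n)$. $\mathfrak{g}(\theta)$, $\theta\in\Theta$,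 is a mean zero Gaussian random field with continuous sample paths and covariance function $\mathrm{Cov}(\mathfrak{g}(\theta),\mathfrak{g}(\theta'))=\mathrm{Cov}_{P_*}(l(X,\theta),l(X,\theta'))$. The symbol $\rightsquigarrow$ denotes convergence in distribution. *)

theory Defs
  imports "HOL-Probability.Probability" "HOL-Library.Landau_Symbols"
begin

section \<open>Probability notions\<close>

text \<open>Borel probability measures on a closed set \<open>S\<close> are measures on the trace
  sigma-algebra, so that functions continuous on \<open>S\<close> only are measurable.\<close>

abbreviation borel_on :: "'a::topological_space set \<Rightarrow> 'a measure" where
  "borel_on S \<equiv> restrict_space borel S"

definition Prob :: "'a::topological_space set \<Rightarrow> 'a measure set" where
  "Prob S = {P. sets P = sets (borel_on S) \<and> prob_space P}"

text \<open>\<open>n\<inverse> (\<delta>\<^bsub>X 1\<^esub> + \<dots> + \<delta>\<^bsub>X n\<^esub>)\<close> is the image of the uniform distribution on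
  \<open>{1..n}\<close> under \<open>i \<mapsto> X i\<close>; see the lemma below.\<close>

definition empirical :: "'a measure \<Rightarrow> (nat \<Rightarrow> 'w \<Rightarrow> 'a) \<Rightarrow> nat \<Rightarrow> 'w \<Rightarrow> 'a measure" where
  "empirical N X n \<omega> = distr (uniform_count_measure {1..n}) N (\<lambda>i. X i \<omega>)"

lemma emeasure_empirical:
  assumes "n \<ge> 1" "\<And>i. i \<in> {1..n} \<Longrightarrow> X i \<omega> \<in> space N" "A \<in> sets N"
  shows "emeasure (empirical N X n \<omega>) A
    = (\<Sum>i=1..n. emeasure (return N (X i \<omega>)) A) / of_nat n"
proof -
  let ?B = "{i\<in>{1..n}. X i \<omega> \<in> A}"
  have m: "(\<lambda>i. X i \<omega>) \<in> measurable (uniform_count_measure {1..n}) N"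
    using assms(2) by (auto simp: measurable_def space_uniform_count_measure sets_uniform_count_measure)
  have "emeasure (empirical N X n \<omega>) A = emeasure (uniform_count_measure {1..n}) ?B"
    unfolding empirical_def using assms(3) m
    by (subst emeasure_distr) (auto simp: space_uniform_count_measure intro!: arg_cong2[where f = emeasure])
  also have "\<dots> = ennreal (real (card ?B) / real (card {1..n}))"
    by (rule emeasure_uniform_count_measure) auto
  also have "\<dots> = of_nat (card ?B) / of_nat n"
    using assms(1) by (simp add: divide_ennreal[symmetric] ennreal_of_nat_eq_real_of_nat)
  also have "of_nat (card ?B) = (\<Sum>i=1..n. indicator A (X i \<omega>) :: ennreal)"
    by (simp add: indicator_def sum.If_cases Int_def)
  also have "\<dots> = (\<Sum>i=1..n. emeasure (return N (X i \<omega>)) A)"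
    using assms(3) by simp
  finally show ?thesis .
qed

definition covar :: "'w measure \<Rightarrow> ('w \<Rightarrow> real) \<Rightarrow> ('w \<Rightarrow> real) \<Rightarrow> real" where
  "covar M X Y = (\<integral>\<omega>. (X \<omega> - (\<integral>\<omega>'. X \<omega>' \<partial>M)) * (Y \<omega> - (\<integral>\<omega>'. Y \<omega>' \<partial>M)) \<partial>M)"

text \<open>The random variables of the sequence and the limit may live on different probability
  spaces. Measurability is part of the notion since \<open>distr\<close> is meaningless without it; it is
  only asked eventually because the terms for small indices are irrelevant.\<close>

definition converges_in_distribution ::
  "'w measure \<Rightarrow> (nat \<Rightarrow> 'w \<Rightarrow> real) \<Rightarrow> 'v measure \<Rightarrow> ('v \<Rightarrow> real) \<Rightarrow> bool" where
  "converges_in_distribution M Z N Y \<longleftrightarrow>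
     (\<forall>\<^sub>F n in sequentially. Z n \<in> borel_measurable M) \<and> Y \<in> borel_measurable N \<and>
     weak_conv_m (\<lambda>n. distr M borel (Z n)) (distr N borel Y)"

text \<open>Normal random variables, the degenerate case (variance zero) included.\<close>

definition gaussian_rv :: "'w measure \<Rightarrow> ('w \<Rightarrow> real) \<Rightarrow> bool" where
  "gaussian_rv M X \<longleftrightarrow> X \<in> borel_measurable M \<and>
     ((\<exists>\<mu> \<sigma>. \<sigma> > 0 \<and> distributed M lborel X (normal_density \<mu> \<sigma>)) \<or>
      (\<exists>\<mu>. distr M borel X = return borel \<mu>))"

text \<open>Joint normality of the finite-dimensional marginals is expressed as normality of all
  finite linear combinations.\<close>

definition mean_zero_gaussian_field ::
  "'w measure \<Rightarrow> 't::topological_space set \<Rightarrow> ('t \<Rightarrow> 'w \<Rightarrow> real) \<Rightarrow> ('t \<Rightarrow> 't \<Rightarrow> real) \<Rightarrow> bool" where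
  "mean_zero_gaussian_field G T g K \<longleftrightarrow>
     prob_space G \<and>
     (\<forall>F c. finite F \<and> F \<subseteq> T \<longrightarrow> gaussian_rv G (\<lambda>\<omega>. \<Sum>t\<in>F. c t * g t \<omega>)) \<and>
     (\<forall>t\<in>T. (\<integral>\<omega>. g t \<omega> \<partial>G) = 0) \<and>
     (\<forall>s\<in>T. \<forall>t\<in>T. covar G (g s) (g t) = K s t) \<and>
     (\<forall>\<omega>\<in>space G. continuous_on T (\<lambda>t. g t \<omega>))"

section \<open>Divergence functions and ambiguity sets\<close>

definition convex_lsc_divergence :: "(real \<Rightarrow> ennreal) \<Rightarrow> bool" where
  "convex_lsc_divergence \<phi> \<longleftrightarrow>
     (\<forall>x y. \<forall>u\<ge>0. \<forall>v\<ge>0. u + v = 1 \<longrightarrow>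
        \<phi> (u * x + v * y) \<le> ennreal u * \<phi> x + ennreal v * \<phi> y) \<and>
     (\<forall>x. \<phi> x \<le> Liminf (at x) \<phi>) \<and>
     \<phi> 1 = 0 \<and> (\<forall>t<0. \<phi> t = \<infinity>)"

text \<open>\<open>enn2real\<close> is harmless in the next two definitions: \<open>RN_deriv P Q\<close> is finite almost
  everywhere for a probability measure \<open>Q\<close>, and \<open>\<phi>\<close> is required to be finite near 1.\<close>

definition phi_divergence :: "(real \<Rightarrow> ennreal) \<Rightarrow> 'a measure \<Rightarrow> 'a measure \<Rightarrow> ennreal" where
  "phi_divergence \<phi> Q P = (\<integral>\<^sup>+ x. \<phi> (enn2real (RN_deriv P Q x)) \<partial>P)"

definition C2_near :: "(real \<Rightarrow> ennreal) \<Rightarrow> real \<Rightarrow> bool" where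
  "C2_near \<phi> a \<longleftrightarrow> (let h = (\<lambda>t. enn2real (\<phi> t)) in
     \<exists>U. open U \<and> a \<in> U \<and>
       (\<forall>t\<in>U. \<phi> t < \<infinity> \<and> h differentiable at t \<and> deriv h differentiable at t) \<and>
       continuous_on U (deriv (deriv h)))"

definition second_deriv :: "(real \<Rightarrow> ennreal) \<Rightarrow> real \<Rightarrow> real" where
  "second_deriv \<phi> = deriv (deriv (\<lambda>t. enn2real (\<phi> t)))"

definition ambiguity_set :: "(real \<Rightarrow> ennreal) \<Rightarrow> real \<Rightarrow> 'a measure \<Rightarrow> 'a measure set" where
  "ambiguity_set \<phi> \<delta> P = {Q. prob_space Q \<and> sets Q = sets P \<and> absolutely_continuous P Q \<and>
     phi_divergence \<phi> Q P \<le> ennreal \<delta>}"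

section \<open>The stochastic program and its distributionally robust counterpart\<close>

definition objective :: "'x measure \<Rightarrow> ('x \<Rightarrow> 't \<Rightarrow> real) \<Rightarrow> 't \<Rightarrow> real" where
  "objective P l \<theta> = (\<integral>x. l x \<theta> \<partial>P)"

definition optval :: "'x measure \<Rightarrow> ('x \<Rightarrow> 't \<Rightarrow> real) \<Rightarrow> 't set \<Rightarrow> real" where
  "optval P l \<Theta> = (INF \<theta>\<in>\<Theta>. objective P l \<theta>)"

definition optset :: "'x measure \<Rightarrow> ('x \<Rightarrow> 't \<Rightarrow> real) \<Rightarrow> 't set \<Rightarrow> 't set" where
  "optset P l \<Theta> = {\<theta>. is_arg_min (objective P l) (\<lambda>\<theta>. \<theta> \<in> \<Theta>) \<theta>}"

definition loss_var :: "'x measure \<Rightarrow> ('x \<Rightarrow> 't \<Rightarrow> real) \<Rightarrow> 't \<Rightarrow> real" where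
  "loss_var P l \<theta> = prob_space.variance P (\<lambda>x. l x \<theta>)"

definition loss_sd :: "'x measure \<Rightarrow> ('x \<Rightarrow> 't \<Rightarrow> real) \<Rightarrow> 't \<Rightarrow> real" where
  "loss_sd P l \<theta> = sqrt (loss_var P l \<theta>)"

definition robust_objective ::
  "(real \<Rightarrow> ennreal) \<Rightarrow> ('x \<Rightarrow> 't \<Rightarrow> real) \<Rightarrow> 'x measure \<Rightarrow> 't \<Rightarrow> real \<Rightarrow> real" where
  "robust_objective \<phi> l P \<theta> \<delta> = (SUP Q\<in>ambiguity_set \<phi> \<delta> P. objective Q l \<theta>)"

definition robust_optval ::
  "(real \<Rightarrow> ennreal) \<Rightarrow> ('x \<Rightarrow> 't \<Rightarrow> real) \<Rightarrow> 't set \<Rightarrow> 'x measure \<Rightarrow> real \<Rightarrow> real" where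
  "robust_optval \<phi> l \<Theta> P \<delta> = (INF \<theta>\<in>\<Theta>. robust_objective \<phi> l P \<theta> \<delta>)"

end

theory Submission
  imports Defs
begin

text \<open>A second-order expansion of \<open>\<phi>\<close> at \<open>1\<close> and Fenchel duality give, uniformly over all probability
  measures \<open>P\<^sub>n\<close> and all loss functions with a given bound, the expansion
  \<open>sup E\<^sub>Q l = E l + (\<kappa> \<delta>)\<^sup>1\<^sup>/\<^sup>2 sd l + o(\<delta>\<^sup>1\<^sup>/\<^sup>2)\<close>
  with moments under \<open>P\<^sub>n\<close>, so that up to a negligible error the robust value is the infimum over \<open>\<theta>\<close>
  of a function of the empirical process \<open>n\<^sup>1\<^sup>/\<^sup>2 (P\<^sub>n - P) l(\<cdot>, \<theta>)\<close>. Chaining along dyadic nets of \<open>\<Theta>\<close>, with maximal inequalities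
  from the 2-smoothness of the \<open>\<ell>\<^sup>2\<^sup>k\<close> norm for \<open>k > 2 m\<close>, approximates this process uniformly in \<open>n\<close>
  by finitely many of its values. Near the minimizers of \<open>f\<close> the infimum is thus a minimum over a finite set,
  to which the finite-dimensional central limit theorem applies; elsewhere the drift
  \<open>n\<^sup>1\<^sup>/\<^sup>2 (f \<theta> - min f)\<close> diverges.\<close>

section \<open>Expansion of the robust objective\<close>

text \<open>The Lipschitz constant \<open>\<psi>\<close> is only square integrable, so increments of
  the empirical process have two moments and no exponential tails. A union bound with Chebyshev's
  inequality would charge the full number of links, up to order 4^(j m) at level j, against
  variances of order 4^(-j). The norm of exponent 2 k charges only the k-th root of this number,
  which for k > 2 m is at most of order 2^j, so the levels become summable. Boundedness of the loss
  makes the expansion uniform: densities that are nearly extremal have the form 1 + O(sqrt \<delta>)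
  and stay where \<phi> is close to a parabola. Weak convergence in a function space and
  differentiability of the infimum are avoided. Monotone test functions \<open>cts_step\<close>
  allow the rescaled value to be squeezed between minima over finite nets. The robust objective is a
  supremum over an uncountable set of measures, so its measurability needs a separate argument,
  which rests on the finitely many patterns of coinciding sample points.\<close>

lemma phi_quadratic_near_1:
  assumes phi: "convex_lsc_divergence \<phi>" and C2: "C2_near \<phi> 1"
    and kappa: "\<kappa> = 2 / second_deriv \<phi> 1" "\<kappa> > 0" and e: "0 < e"
  obtains \<eta> where "\<eta> > 0"
    "\<And>t. \<bar>t - 1\<bar> \<le> \<eta> \<Longrightarrow> ennreal ((1 - e) * (t - 1)\<^sup>2 / \<kappa>) \<le> \<phi> t"
    "\<And>t. \<bar>t - 1\<bar> \<le> \<eta> \<Longrightarrow> \<phi> t \<le> ennreal ((1 + e) * (t - 1)\<^sup>2 / \<kappa>)"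
proof -
  define h where "h = (\<lambda>t. enn2real (\<phi> t))"
  obtain U where U: "open U" "1 \<in> U" "\<And>t. t \<in> U \<Longrightarrow> \<phi> t < \<infinity>"
      "\<And>t. t \<in> U \<Longrightarrow> h differentiable at t" "\<And>t. t \<in> U \<Longrightarrow> deriv h differentiable at t"
      "continuous_on U (deriv (deriv h))"
    using C2 unfolding C2_near_def h_def Let_def by blast
  have h2: "deriv (deriv h) 1 = 2 / \<kappa>"
    using kappa unfolding second_deriv_def h_def[symmetric] by simp
  have h1: "h 1 = 0" using phi by (simp add: h_def convex_lsc_divergence_def)
  have hge: "h t \<ge> 0" for t by (simp add: h_def)
  have "isCont (deriv (deriv h)) 1"
    using U continuous_on_eq_continuous_at by blast
  then have "\<forall>\<^sub>F x in at 1. dist (deriv (deriv h) x) (deriv (deriv h) 1) < 2 * e / \<kappa>"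
    unfolding isCont_def using e kappa(2) by (intro tendstoD) auto
  then obtain d1 where d1: "d1 > 0" "\<And>x. x \<noteq> 1 \<Longrightarrow> dist x 1 < d1 \<Longrightarrow> dist (deriv (deriv h) x) (deriv (deriv h) 1) < 2 * e / \<kappa>"
    unfolding eventually_at by auto
  obtain d2 where d2: "d2 > 0" "ball 1 d2 \<subseteq> U" using U openE by blast
  \<comment> \<open>Half of the minimum, because Taylor's formula is applied on the closed interval
    [1 - \<eta>, 1 + \<eta>] while \<open>d1\<close> and \<open>d2\<close> are radii of open
    neighbourhoods.\<close>
  define \<eta> where "\<eta> = min d1 d2 / 2"
  have eta: "\<eta> > 0" "\<eta> < d1" "\<eta> < d2" using d1(1) d2(1) by (auto simp: \<eta>_def)
  have inU: "t \<in> U" if "\<bar>t - 1\<bar> \<le> \<eta>" for t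
    using that d2 eta by (auto simp: subset_iff dist_real_def)
  have D1: "(h has_real_derivative deriv h t) (at t)" "(deriv h has_real_derivative deriv (deriv h) t) (at t)" if "t \<in> U" for t
    using U(4,5)[OF that] by (simp_all add: DERIV_deriv_iff_real_differentiable)
  \<comment> \<open>\<open>h\<close> is nonnegative and vanishes at 1, so 1 is a minimum and the
    linear term of the expansion disappears.\<close>
  have h'1: "deriv h 1 = 0"
    by (rule DERIV_local_min[OF D1(1)[OF U(2)], of 1]) (auto simp: h1 hge)
  have tay: "\<bar>h t - (t-1)\<^sup>2 / \<kappa>\<bar> \<le> e * (t-1)\<^sup>2 / \<kappa>" if t: "\<bar>t - 1\<bar> \<le> \<eta>" for t
  proof (cases "t = 1")
    case False
    define diff where "diff = (\<lambda>m::nat. if m = 0 then h else if m = 1 then deriv h else deriv (deriv h))"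
    have "\<forall>m x. m < 2 \<and> 1 - \<eta> \<le> x \<and> x \<le> 1 + \<eta> \<longrightarrow> (diff m has_real_derivative diff (Suc m) x) (at x)"
    proof (intro allI impI)
      fix m :: nat and x assume a: "m < 2 \<and> 1 - \<eta> \<le> x \<and> x \<le> 1 + \<eta>"
      then have "x \<in> U" by (intro inU) auto
      with a show "(diff m has_real_derivative diff (Suc m) x) (at x)"
        using D1 by (cases "m = 0") (auto simp: diff_def)
    qed
    then have "\<exists>s. (if t < 1 then t < s \<and> s < 1 else 1 < s \<and> s < t) \<and>
        h t = (\<Sum>m<2. diff m 1 / fact m * (t - 1) ^ m) + diff 2 s / fact 2 * (t - 1)^2"
      using t False by (intro Taylor[where a = "1 - \<eta>" and b = "1 + \<eta>"]) (auto simp: diff_def)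
    then obtain s where s': "if t < 1 then t < s \<and> s < 1 else 1 < s \<and> s < t"
      and ht': "h t = (\<Sum>m<2. diff m 1 / fact m * (t - 1) ^ m) + diff 2 s / fact 2 * (t - 1)^2" by blast
    have s: "s \<noteq> 1" "\<bar>s - 1\<bar> \<le> \<bar>t - 1\<bar>" using s' by (auto split: if_splits)
    have ht: "h t = deriv (deriv h) s / 2 * (t - 1)^2"
      using ht' by (simp add: diff_def h1 h'1 lessThan_Suc numeral_2_eq_2)
    have "\<bar>deriv (deriv h) s - 2 / \<kappa>\<bar> \<le> 2 * e / \<kappa>"
      using d1(2)[OF s(1)] s t eta by (auto simp: dist_real_def h2)
    then have "\<bar>deriv (deriv h) s - 2 / \<kappa>\<bar> * ((t-1)\<^sup>2/2) \<le> 2 * e / \<kappa> * ((t-1)\<^sup>2/2)"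
      by (intro mult_right_mono) auto
    also have "\<bar>deriv (deriv h) s - 2 / \<kappa>\<bar> * ((t-1)\<^sup>2/2) = \<bar>(deriv (deriv h) s - 2 / \<kappa>) * ((t-1)\<^sup>2/2)\<bar>"
      by (simp add: abs_mult)
    also have "(deriv (deriv h) s - 2 / \<kappa>) * ((t-1)\<^sup>2/2) = h t - (t-1)\<^sup>2 / \<kappa>"
      unfolding ht by (simp add: field_simps)
    finally show ?thesis by (simp add: field_simps)
  qed (simp add: h1)
  have phih: "\<phi> t = ennreal (h t)" if "\<bar>t - 1\<bar> \<le> \<eta>" for t
    using U(3)[OF inU[OF that]] by (simp add: h_def less_top)
  show ?thesis
  proof
    fix t assume t: "\<bar>t - 1\<bar> \<le> \<eta>"
    show "ennreal ((1 - e) * (t - 1)\<^sup>2 / \<kappa>) \<le> \<phi> t" "\<phi> t \<le> ennreal ((1 + e) * (t - 1)\<^sup>2 / \<kappa>)"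
      using tay[OF t] unfolding phih[OF t] by (auto intro!: ennreal_leI simp: abs_le_iff left_diff_distrib distrib_right diff_divide_distrib add_divide_distrib)
  qed (use eta in auto)
qed

text \<open>The point 1 + \<eta> or 1 - \<eta> on the side of \<open>t\<close> is a convex
  combination of \<open>t\<close> and 1. Since \<phi> vanishes at 1, convexity forces at least
  linear growth beyond that point. This covers the range where the Taylor expansion gives no
  information.\<close>

lemma phi_linear_growth:
  assumes phi: "convex_lsc_divergence \<phi>" and c: "0 < \<eta>" "0 \<le> c"
    and sides: "ennreal c \<le> \<phi> (1 + \<eta>)" "ennreal c \<le> \<phi> (1 - \<eta>)"
    and t: "\<eta> < \<bar>t - 1\<bar>"
  shows "ennreal (c / \<eta> * \<bar>t - 1\<bar>) \<le> \<phi> t"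
proof -
  define u where "u = \<eta> / \<bar>t - 1\<bar>"
  have u: "0 < u" "u < 1" using c t by (auto simp: u_def)
  have eq: "u * t + (1 - u) * 1 = 1 + u * (t - 1)" by algebra
  have "u * (t - 1) = \<eta> \<or> u * (t - 1) = - \<eta>"
    using t c by (cases "t < 1") (auto simp: u_def abs_if divide_simps algebra_simps)
  then have "u * t + (1 - u) * 1 = 1 + \<eta> \<or> u * t + (1 - u) * 1 = 1 - \<eta>" unfolding eq by auto
  then have "ennreal c \<le> \<phi> (u * t + (1 - u) * 1)" using sides by metis
  also have "\<dots> \<le> ennreal u * \<phi> t + ennreal (1 - u) * \<phi> 1"
    using phi u unfolding convex_lsc_divergence_def by (metis less_eq_real_def add.commute diff_add_cancel diff_ge_0_iff_ge)
  also have "\<dots> = ennreal u * \<phi> t" using phi by (simp add: convex_lsc_divergence_def)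
  finally have "ennreal (1/u) * ennreal c \<le> ennreal (1/u) * (ennreal u * \<phi> t)"
    by (rule mult_left_mono) simp
  also have "\<dots> = \<phi> t"
    using u by (simp add: mult.assoc[symmetric] ennreal_mult[symmetric])
  finally show ?thesis using u c by (simp add: ennreal_mult[symmetric] u_def mult.commute)
qed

text \<open>The first bound is the Fenchel-Young inequality for \<open>\<phi>\<close>, whose conjugate is
  asymptotically quadratic at \<open>0\<close>.\<close>

lemma phi_Young:
  assumes phi: "convex_lsc_divergence \<phi>" and C2: "C2_near \<phi> 1"
    and kappa: "\<kappa> = 2 / second_deriv \<phi> 1" "\<kappa> > 0" and e: "0 < e" "e < 1"
  obtains \<eta> where "\<eta> > 0"
    "\<And>t u. \<bar>u\<bar> \<le> \<eta> \<Longrightarrow> ennreal (u * (t - 1) - \<kappa> * u\<^sup>2 / (4 * (1 - e))) \<le> \<phi> t"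
    "\<And>t. \<bar>t - 1\<bar> \<le> \<eta> \<Longrightarrow> \<phi> t \<le> ennreal ((1 + e) * (t - 1)\<^sup>2 / \<kappa>)"
proof -
  obtain \<eta> where eta: "\<eta> > 0"
    and lo: "\<And>t. \<bar>t - 1\<bar> \<le> \<eta> \<Longrightarrow> ennreal ((1 - e) * (t - 1)\<^sup>2 / \<kappa>) \<le> \<phi> t"
    and up: "\<And>t. \<bar>t - 1\<bar> \<le> \<eta> \<Longrightarrow> \<phi> t \<le> ennreal ((1 + e) * (t - 1)\<^sup>2 / \<kappa>)"
    using phi_quadratic_near_1[OF phi C2 kappa e(1)] by blast
  \<comment> \<open>\<open>c\<close> is the height of the lower parabola at distance \<eta> from 1,
    hence c / \<eta> is the slope of the linear growth farther out. Multipliers \<open>u\<close> up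
    to this slope cannot overtake \<phi> there.\<close>
  define c where "c = (1 - e) * \<eta>\<^sup>2 / \<kappa>"
  have c: "c > 0" using e eta kappa by (auto simp: c_def)
  show ?thesis
  proof (rule that[of "min \<eta> (c / \<eta>)"])
    show "min \<eta> (c / \<eta>) > 0" using c eta by auto
    fix t u assume u: "\<bar>u\<bar> \<le> min \<eta> (c / \<eta>)"
    show "ennreal (u * (t - 1) - \<kappa> * u\<^sup>2 / (4 * (1 - e))) \<le> \<phi> t"
    proof (cases "\<bar>t - 1\<bar> \<le> \<eta>")
      case True
      \<comment> \<open>Completing the square: \<kappa> u^2 / (4 a) is the maximum over
        \<open>x\<close> of u x - a x^2 / \<kappa>. It is used with a = 1 - e.\<close>
      have sq: "a / \<kappa> * (x - \<kappa> * u / (2 * a))\<^sup>2 = a * x\<^sup>2 / \<kappa> - u * x + \<kappa> * u\<^sup>2 / (4 * a)"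
        if "a > 0" for a x :: real
        using that kappa(2) by (simp add: power2_diff power_divide power_mult_distrib field_simps power2_eq_square)
      have "0 \<le> (1 - e) / \<kappa> * ((t - 1) - \<kappa> * u / (2 * (1 - e)))\<^sup>2" using e kappa by auto
      also have "\<dots> = (1 - e) * (t - 1)\<^sup>2 / \<kappa> - u * (t - 1) + \<kappa> * u\<^sup>2 / (4 * (1 - e))"
        using e by (intro sq) auto
      finally show ?thesis by (intro order_trans[OF _ lo[OF True]] ennreal_leI) simp
    next
      case False
      have "u * (t - 1) \<le> \<bar>u\<bar> * \<bar>t - 1\<bar>" by (metis abs_ge_self abs_mult)
      also have "\<dots> \<le> c / \<eta> * \<bar>t - 1\<bar>" using u by (intro mult_right_mono) auto
      finally have "u * (t - 1) - \<kappa> * u\<^sup>2 / (4 * (1 - e)) \<le> c / \<eta> * \<bar>t - 1\<bar>"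
        using e kappa by (smt (verit) divide_nonneg_nonneg mult_nonneg_nonneg zero_le_power2)
      moreover have "ennreal (c / \<eta> * \<bar>t - 1\<bar>) \<le> \<phi> t"
        using lo[of "1 + \<eta>"] lo[of "1 - \<eta>"] eta c False by (intro phi_linear_growth[OF phi]) (auto simp: c_def)
      ultimately show ?thesis by (meson ennreal_leI order_trans)
    qed
  qed (use up in auto)
qed

section \<open>The two halves of the expansion for a fixed reference measure\<close>

lemma square_le_of_abs_le: "\<bar>a\<bar> \<le> b \<Longrightarrow> a\<^sup>2 \<le> b\<^sup>2" for a b :: real
  by (metis abs_ge_zero power2_abs power_mono)

lemma (in prob_space) abs_expectation_le:
  fixes y :: "'a \<Rightarrow> real"
  assumes "y \<in> borel_measurable M" "AE x in M. \<bar>y x\<bar> \<le> C"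
  shows "\<bar>expectation y\<bar> \<le> C"
proof -
  have i: "integrable M y" by (rule integrable_const_bound[of _ C]) (use assms in auto)
  have "\<bar>expectation y\<bar> \<le> (\<integral>x. \<bar>y x\<bar> \<partial>M)" by (rule integral_abs_bound)
  also have "\<dots> \<le> (\<integral>x. C \<partial>M)" by (rule integral_mono_AE) (use assms i in auto)
  finally show ?thesis by (simp add: prob_space)
qed

text \<open>A density with real values is easier to handle than \<open>RN_deriv\<close>. Replacing
  infinite values by 0 changes it only on a null set, and the constraint carries over literally
  because \<open>phi_divergence\<close> is already defined through \<open>enn2real\<close>.\<close>

lemma ambiguity_set_density:
  assumes P: "prob_space P" and Q: "Q \<in> ambiguity_set \<phi> \<delta> P"
  obtains w where "w \<in> borel_measurable P" "\<And>x. 0 \<le> w x" "Q = density P (\<lambda>x. ennreal (w x))"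
    "(\<integral>\<^sup>+x. \<phi> (w x) \<partial>P) \<le> ennreal \<delta>"
proof -
  interpret P: prob_space P by fact
  have Q: "prob_space Q" "sets Q = sets P" "absolutely_continuous P Q" "phi_divergence \<phi> Q P \<le> ennreal \<delta>"
    using Q by (auto simp: ambiguity_set_def)
  interpret Q: prob_space Q by fact
  define w where "w = (\<lambda>x. enn2real (RN_deriv P Q x))"
  have "AE x in P. RN_deriv P Q x \<noteq> \<infinity>"
    by (rule P.RN_deriv_finite[OF Q.sigma_finite_measure_axioms Q(3,2)])
  then have "density P (RN_deriv P Q) = density P (\<lambda>x. ennreal (w x))"
    by (intro density_cong) (auto simp: w_def less_top elim!: eventually_mono)
  then have Qw: "Q = density P (\<lambda>x. ennreal (w x))" using P.density_RN_deriv[OF Q(3,2)] by simp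
  show ?thesis by (rule that[OF _ _ Qw]) (use Q(4) in \<open>auto simp: w_def phi_divergence_def\<close>)
qed

text \<open>Uniqueness of the Radon-Nikodym derivative: the one chosen by
  \<open>phi_divergence\<close> agrees with \<open>w\<close> almost everywhere, so the two integrals
  of \<phi> coincide.\<close>

lemma density_in_ambiguity_set:
  assumes P: "prob_space P" and w: "w \<in> borel_measurable P" "AE x in P. 0 \<le> w x"
    and prob: "(\<integral>\<^sup>+x. ennreal (w x) \<partial>P) = 1" and phi: "(\<integral>\<^sup>+x. \<phi> (w x) \<partial>P) \<le> ennreal \<delta>"
  shows "density P (\<lambda>x. ennreal (w x)) \<in> ambiguity_set \<phi> \<delta> P"
proof -
  interpret P: prob_space P by fact
  let ?Q = "density P (\<lambda>x. ennreal (w x))"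
  have "prob_space ?Q"
    using prob w by (intro prob_spaceI) (simp add: emeasure_density cong: nn_integral_cong)
  moreover have "AE x in P. ennreal (w x) = RN_deriv P ?Q x" by (rule P.RN_deriv_unique) (use w in auto)
  then have RN: "AE x in P. enn2real (RN_deriv P ?Q x) = w x"
    using w(2) by eventually_elim (metis enn2real_ennreal)
  have "phi_divergence \<phi> ?Q P = (\<integral>\<^sup>+x. \<phi> (w x) \<partial>P)"
    unfolding phi_divergence_def by (rule nn_integral_cong_AE) (use RN in \<open>auto elim!: eventually_mono\<close>)
  ultimately show ?thesis using phi w by (simp add: ambiguity_set_def absolutely_continuousI_density)
qed

text \<open>Weak duality. For a density \<open>w\<close> the Young inequality with u = v /
  \<Lambda>, where \<open>v\<close> is the centred loss, integrates to (E_Q y - m) / \<Lambda> \<le>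
  \<delta> + \<kappa> s^2 / (4 (1 - e) \<Lambda>^2), and \<Lambda> > 0 is at choice. The summand
  \<open>r\<close> in the conclusion is the price for a multiplier that stays admissible when the
  variance is small or zero.\<close>

lemma robust_upper:
  fixes y :: "'a \<Rightarrow> real"
  assumes Young: "\<And>t u. \<bar>u\<bar> \<le> \<eta> \<Longrightarrow> ennreal (u * (t - 1) - \<kappa> * u\<^sup>2 / (4 * (1 - e))) \<le> \<phi> t"
    and pos: "\<kappa> > 0" "0 < e" "e < 1" "\<delta> > 0" "r > 0"
    and P: "prob_space P" and y: "y \<in> borel_measurable P" "AE x in P. \<bar>y x\<bar> \<le> C"
    and small: "4 * C * sqrt \<delta> \<le> \<eta> * r * sqrt \<kappa>"
    and QA: "Q \<in> ambiguity_set \<phi> \<delta> P"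
  shows "(\<integral>x. y x \<partial>Q) \<le> (\<integral>x. y x \<partial>P) + (sqrt (prob_space.variance P y) + r) * (sqrt \<kappa> * sqrt \<delta> / sqrt (1 - e))"
proof -
  interpret P: prob_space P by fact
  have Q: "prob_space Q" "sets Q = sets P" "absolutely_continuous P Q"
    using QA by (auto simp: ambiguity_set_def)
  interpret Q: prob_space Q by fact
  have y_int: "integrable P y" by (rule P.integrable_const_bound[of _ C]) (use y in auto)
  define m where "m = (\<integral>x. y x \<partial>P)"
  define v where "v = (\<lambda>x. y x - m)"
  define s where "s = sqrt (P.variance y)"
  have s: "s \<ge> 0" "s\<^sup>2 = (\<integral>x. (v x)\<^sup>2 \<partial>P)"
    by (simp_all add: s_def v_def m_def P.variance_positive)
  have yC: "\<bar>m\<bar> \<le> C" unfolding m_def by (rule P.abs_expectation_le[OF y])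
  have v: "v \<in> borel_measurable P" "AE x in P. \<bar>v x\<bar> \<le> 2 * C"
    using y yC by (auto simp: v_def elim!: eventually_mono)
  obtain w where w: "w \<in> borel_measurable P" and w0: "\<And>x. 0 \<le> w x"
    and Qw: "Q = density P (\<lambda>x. ennreal (w x))" and phiw: "(\<integral>\<^sup>+x. \<phi> (w x) \<partial>P) \<le> ennreal \<delta>"
    using ambiguity_set_density[OF P QA] by blast
  have [measurable]: "w \<in> borel_measurable P" "y \<in> borel_measurable P" "v \<in> borel_measurable P"
    using w y v by auto
  have yQ: "integrable Q y"
  proof (rule Q.integrable_const_bound[of _ C])
    show "AE x in Q. norm (y x) \<le> C" using absolutely_continuous_AE[OF Q(2) Q(3) y(2)] by simp
    show "y \<in> borel_measurable Q" using y(1) measurable_cong_sets[OF Q(2) refl] by blast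
  qed
  have wy: "integrable P (\<lambda>x. w x * y x)" "(\<integral>x. w x * y x \<partial>P) = (\<integral>x. y x \<partial>Q)"
    using yQ unfolding Qw by (simp_all add: integrable_real_density integral_real_density w0)
  have "integrable Q (\<lambda>_. 1::real)" by simp
  then have w1: "integrable P w" unfolding Qw by (subst (asm) integrable_real_density) (simp_all add: w0)
  have "(\<integral>x. 1 \<partial>Q) = (1::real)" by (simp add: Q.prob_space)
  then have w1': "(\<integral>x. w x \<partial>P) = 1" unfolding Qw by (subst (asm) integral_real_density) (simp_all add: w0)
  have wv: "integrable P (\<lambda>x. (w x - 1) * v x)" "(\<integral>x. (w x - 1) * v x \<partial>P) = (\<integral>x. y x \<partial>Q) - m"
  proof -
    have eq: "(w x - 1) * v x = w x * y x - m * w x - y x + m" for x by (simp add: v_def algebra_simps)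
    show "integrable P (\<lambda>x. (w x - 1) * v x)" unfolding eq using wy w1 y_int by auto
    show "(\<integral>x. (w x - 1) * v x \<partial>P) = (\<integral>x. y x \<partial>Q) - m" unfolding eq
      using wy w1 y_int by (simp add: w1' P.prob_space m_def)
  qed
  have v2: "integrable P (\<lambda>x. (v x)\<^sup>2)"
  proof (rule P.integrable_const_bound[of _ "(2*C)\<^sup>2"])
    show "AE x in P. norm ((v x)\<^sup>2) \<le> (2*C)\<^sup>2"
      using v(2) by (rule eventually_mono) (simp only: real_norm_def abs_power2 square_le_of_abs_le)
  qed simp
  define q D K where "q = sqrt (1 - e)" and "D = sqrt \<delta>" and "K = sqrt \<kappa>"
  have qDK: "q > 0" "D > 0" "K > 0" "q \<le> 1" "1 - e = q\<^sup>2" "\<delta> = D\<^sup>2" "\<kappa> = K\<^sup>2" using pos by (auto simp: q_def D_def K_def)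
  \<comment> \<open>The minimizer of \<Lambda> \<delta> + \<kappa> s^2 / (4 (1 - e) \<Lambda>), with
    \<open>s\<close> replaced by s + r. The extra \<open>r\<close> keeps \<Lambda> positive and so
    large that |v| / \<Lambda> \<le> \<eta>, the range of the Young inequality.\<close>
  define \<Lambda> where "\<Lambda> = (s + r) * K / (2 * q * D)"
  have Lpos: "\<Lambda> > 0" using qDK pos s by (auto simp: \<Lambda>_def)
  have "2 * C \<le> \<eta> * \<Lambda>"
  proof -
    have C0: "C \<ge> 0" using yC by linarith
    have "\<eta> * r * K \<ge> 0" using small C0 qDK pos by (smt (verit, best) D_def K_def mult_nonneg_nonneg)
    then have eta0: "\<eta> \<ge> 0" using qDK pos by (simp add: zero_le_mult_iff)
    have "4 * C * D * q \<le> 4 * C * D * 1" using qDK C0 by (intro mult_left_mono) auto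
    also have "\<dots> \<le> \<eta> * r * K" using small by (simp add: D_def K_def)
    also have "\<dots> \<le> \<eta> * (s + r) * K" using s eta0 qDK by (intro mult_right_mono mult_left_mono) auto
    finally show ?thesis unfolding \<Lambda>_def using qDK by (simp add: field_simps)
  qed
  then have vL: "AE x in P. \<bar>v x / \<Lambda>\<bar> \<le> \<eta>"
    using v(2) by (rule_tac eventually_mono[OF v(2)]) (use Lpos in \<open>auto simp: abs_mult field_simps\<close>)
  define k where "k = (\<lambda>x. v x / \<Lambda> * (w x - 1) - \<kappa> * (v x / \<Lambda>)\<^sup>2 / (4 * (1 - e)))"
  have "(\<integral>\<^sup>+x. ennreal (k x) \<partial>P) \<le> (\<integral>\<^sup>+x. \<phi> (w x) \<partial>P)"
    unfolding k_def by (intro nn_integral_mono_AE eventually_mono[OF vL] Young)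
  also have "\<dots> \<le> ennreal \<delta>" by (rule phiw)
  \<comment> \<open>The nonnegative integral ignores the negative part of \<open>k\<close>, so its
    bound passes to the real integral.\<close>
  finally have "(\<integral>x. k x \<partial>P) \<le> \<delta>" by (intro integral_real_bounded) (use pos in auto)
  moreover have "(\<integral>x. k x \<partial>P) = ((\<integral>x. y x \<partial>Q) - m) / \<Lambda> - \<kappa> * s\<^sup>2 / \<Lambda>\<^sup>2 / (4 * (1 - e))"
  proof -
    have eq: "k x = ((w x - 1) * v x) / \<Lambda> - \<kappa> / \<Lambda>\<^sup>2 / (4 * (1 - e)) * (v x)\<^sup>2" for x
      by (simp add: k_def power_divide)
    show ?thesis unfolding eq using wv v2 by (simp add: s(2))
  qed
  ultimately have "((\<integral>x. y x \<partial>Q) - m) / \<Lambda> \<le> \<delta> + \<kappa> * s\<^sup>2 / \<Lambda>\<^sup>2 / (4 * (1 - e))" by simp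
  then have "(\<integral>x. y x \<partial>Q) - m \<le> \<Lambda> * (\<delta> + \<kappa> * s\<^sup>2 / \<Lambda>\<^sup>2 / (4 * (1 - e)))"
    using Lpos by (simp add: pos_divide_le_eq mult.commute)
  also have "\<dots> = \<Lambda> * \<delta> + \<kappa> * s\<^sup>2 / (4 * (1 - e)) / \<Lambda>"
    using Lpos pos by (simp add: distrib_left power2_eq_square)
  also have "\<kappa> * s\<^sup>2 / (4 * (1 - e)) / \<Lambda> \<le> \<kappa> * (s + r)\<^sup>2 / (4 * (1 - e)) / \<Lambda>"
    using pos s Lpos by (intro divide_right_mono mult_left_mono power_mono) auto
  also have "\<dots> = (s + r) * (K * D / (2 * q))"
  proof -
    have "K\<^sup>2 * a\<^sup>2 / (4 * q\<^sup>2) / (a * K / (2 * q * D)) = a * (K * D / (2 * q))" if "a > 0" for a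
      using qDK(1-3) that by (simp add: power2_eq_square)
    from this[of "s + r"] show ?thesis unfolding qDK(5,7) \<Lambda>_def using s(1) pos(5) by simp
  qed
  also have "\<Lambda> * \<delta> = (s + r) * (K * D / (2 * q))"
    unfolding qDK(6) \<Lambda>_def using qDK(1-3) by (simp add: power2_eq_square)
  finally show ?thesis by (simp add: m_def s_def K_def D_def q_def field_simps)
qed

text \<open>The density 1 + a v, tilted linearly along the centred loss, is the first-order form of
  the maximizer. It has E_Q y = m + a s^2 and, by the upper parabola, divergence at most (1 + e) a^2
  s^2 / \<kappa>.\<close>

lemma robust_lower:
  fixes y :: "'a \<Rightarrow> real"
  assumes up: "\<And>t. \<bar>t - 1\<bar> \<le> \<eta> \<Longrightarrow> \<phi> t \<le> ennreal ((1 + e) * (t - 1)\<^sup>2 / \<kappa>)"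
    and pos: "\<kappa> > 0" "0 < e" "\<delta> > 0" "r > 0"
    and P: "prob_space P" and y: "y \<in> borel_measurable P" "AE x in P. \<bar>y x\<bar> \<le> C"
    and small: "2 * C * sqrt (\<kappa> * \<delta>) \<le> min \<eta> 1 * r"
  shows "\<exists>Q\<in>ambiguity_set \<phi> \<delta> P.
    (\<integral>x. y x \<partial>Q) \<ge> (\<integral>x. y x \<partial>P) + (sqrt (prob_space.variance P y) - r) * (sqrt \<kappa> * sqrt \<delta> / sqrt (1 + e))"
proof -
  interpret P: prob_space P by fact
  have [measurable]: "y \<in> borel_measurable P" by fact
  have y_int: "integrable P y" by (rule P.integrable_const_bound[of _ C]) (use y in auto)
  define m where "m = (\<integral>x. y x \<partial>P)"
  define v where "v = (\<lambda>x. y x - m)"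
  define s where "s = sqrt (P.variance y)"
  have s: "s \<ge> 0" "s\<^sup>2 = (\<integral>x. (v x)\<^sup>2 \<partial>P)"
    by (simp_all add: s_def v_def m_def P.variance_positive)
  have yC: "\<bar>m\<bar> \<le> C" unfolding m_def by (rule P.abs_expectation_le[OF y])
  have v: "v \<in> borel_measurable P" "AE x in P. \<bar>v x\<bar> \<le> 2 * C"
    using y yC by (auto simp: v_def elim!: eventually_mono)
  have [measurable]: "v \<in> borel_measurable P" by fact
  have v_int: "integrable P v" using y_int by (simp add: v_def)
  have v0: "(\<integral>x. v x \<partial>P) = 0" using y_int by (simp add: v_def m_def P.prob_space)
  have v2: "integrable P (\<lambda>x. (v x)\<^sup>2)"
  proof (rule P.integrable_const_bound[of _ "(2*C)\<^sup>2"])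
    show "AE x in P. norm ((v x)\<^sup>2) \<le> (2*C)\<^sup>2"
      using v(2) by (rule eventually_mono) (simp only: real_norm_def abs_power2 square_le_of_abs_le)
  qed simp
  \<comment> \<open>With this \<open>b\<close>, the choice a = b / s would spend the budget \<delta>
    exactly. Dividing by s + r instead keeps \<open>a\<close> under control for s = 0 and small
    enough for |a v| \<le> min \<eta> 1, which gives both \<open>w\<close> \<ge> 0 and the validity
    of the parabola.\<close>
  define b where "b = sqrt (\<kappa> * \<delta> / (1 + e))"
  define a where "a = b / (s + r)"
  have ab: "b > 0" "a > 0" using pos s by (auto simp: a_def b_def intro!: divide_pos_pos)
  have b2: "b\<^sup>2 = \<kappa> * \<delta> / (1 + e)" using pos by (simp add: b_def)
  have "2 * C * b \<le> min \<eta> 1 * r"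
  proof -
    have "C \<ge> 0" using yC by linarith
    moreover have "b \<le> sqrt (\<kappa> * \<delta>)" unfolding b_def using pos by (simp add: pos_divide_le_eq)
    ultimately have "2 * C * b \<le> 2 * C * sqrt (\<kappa> * \<delta>)" by (intro mult_left_mono) auto
    then show ?thesis using small by linarith
  qed
  moreover have "0 \<le> min \<eta> 1"
    using calculation yC ab pos by (smt (verit, best) mult_nonneg_nonneg zero_le_mult_iff)
  then have "min \<eta> 1 * r \<le> min \<eta> 1 * (s + r)" using s by (intro mult_left_mono) auto
  ultimately have aC: "a * (2 * C) \<le> min \<eta> 1"
  proof -
    assume "2 * C * b \<le> min \<eta> 1 * r" "min \<eta> 1 * r \<le> min \<eta> 1 * (s + r)"
    then have "2 * C * b / (s + r) \<le> min \<eta> 1" using s pos by (subst pos_divide_le_eq) linarith+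
    then show ?thesis by (simp only: a_def) (metis mult.commute times_divide_eq_right)
  qed
  have av: "AE x in P. \<bar>a * v x\<bar> \<le> \<eta> \<and> \<bar>a * v x\<bar> \<le> 1"
    using v(2)
  proof (rule eventually_mono)
    fix x assume "\<bar>v x\<bar> \<le> 2 * C"
    then have "a * \<bar>v x\<bar> \<le> a * (2 * C)" using ab by (intro mult_left_mono) auto
    then show "\<bar>a * v x\<bar> \<le> \<eta> \<and> \<bar>a * v x\<bar> \<le> 1" using aC ab(2) by (simp only: abs_mult abs_of_pos min.bounded_iff) linarith
  qed
  define w where "w = (\<lambda>x. 1 + a * v x)"
  have [measurable]: "w \<in> borel_measurable P" by (simp add: w_def)
  have w0: "AE x in P. 0 \<le> w x" using av by (rule eventually_mono) (auto simp: w_def)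
  have w_int: "integrable P w" "(\<integral>x. w x \<partial>P) = 1" using v_int by (auto simp: w_def v0 P.prob_space)
  define Q where "Q = density P (\<lambda>x. ennreal (w x))"
  have "(\<integral>\<^sup>+x. ennreal (w x) \<partial>P) = ennreal (\<integral>x. w x \<partial>P)"
    using w_int w0 by (intro nn_integral_eq_integral) auto
  then have w1: "(\<integral>\<^sup>+x. ennreal (w x) \<partial>P) = 1" by (simp add: w_int)
  have "(\<integral>\<^sup>+x. \<phi> (w x) \<partial>P) \<le> (\<integral>\<^sup>+x. ennreal ((1 + e) * a\<^sup>2 / \<kappa> * (v x)\<^sup>2) \<partial>P)"
  proof (rule nn_integral_mono_AE, rule eventually_mono[OF av])
    fix x assume "\<bar>a * v x\<bar> \<le> \<eta> \<and> \<bar>a * v x\<bar> \<le> 1"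
    then show "\<phi> (w x) \<le> ennreal ((1 + e) * a\<^sup>2 / \<kappa> * (v x)\<^sup>2)"
      using up[of "w x"] by (simp add: w_def power_mult_distrib mult_ac)
  qed
  also have "\<dots> = ennreal (\<integral>x. (1 + e) * a\<^sup>2 / \<kappa> * (v x)\<^sup>2 \<partial>P)"
    using pos v2 by (intro nn_integral_eq_integral) auto
  also have "(\<integral>x. (1 + e) * a\<^sup>2 / \<kappa> * (v x)\<^sup>2 \<partial>P) = (1 + e) * a\<^sup>2 / \<kappa> * s\<^sup>2" by (simp add: s)
  also have "\<dots> = \<delta> * (s / (s + r))\<^sup>2"
    using pos s by (simp add: a_def power_divide b2)
  also have "\<dots> \<le> \<delta> * 1"
    using pos s by (intro mult_left_mono power_le_one) auto
  finally have "(\<integral>\<^sup>+x. \<phi> (w x) \<partial>P) \<le> ennreal \<delta>" by (simp add: ennreal_leI)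
  then have QA: "Q \<in> ambiguity_set \<phi> \<delta> P"
    unfolding Q_def using w0 w1 by (intro density_in_ambiguity_set P) auto
  have "(\<integral>x. y x \<partial>Q) = (\<integral>x. w x * y x \<partial>P)"
    unfolding Q_def by (rule integral_real_density) (use w0 in auto)
  also have "\<dots> = (\<integral>x. y x + a * (v x)\<^sup>2 + a * m * v x \<partial>P)"
    by (intro Bochner_Integration.integral_cong) (auto simp: w_def v_def algebra_simps power2_eq_square)
  also have "\<dots> = m + a * s\<^sup>2" using y_int v2 v_int by (simp add: m_def v0 s)
  finally have yQ: "(\<integral>x. y x \<partial>Q) = m + a * s\<^sup>2" .
  \<comment> \<open>Here the summand \<open>r\<close> is lost: a s^2 = b s^2 / (s + r), and (s - r)
    (s + r) \<le> s^2.\<close>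
  have "(s - r) * b \<le> a * s\<^sup>2"
  proof -
    have "(s - r) * (s + r) \<le> s\<^sup>2" by (simp add: algebra_simps power2_eq_square)
    then have "b * ((s - r) * (s + r)) \<le> b * s\<^sup>2" using ab by (intro mult_left_mono) auto
    then show ?thesis unfolding a_def using s pos by (simp add: field_simps)
  qed
  moreover have "b = sqrt \<kappa> * sqrt \<delta> / sqrt (1 + e)" by (simp add: b_def real_sqrt_mult real_sqrt_divide)
  ultimately show ?thesis using QA yQ by (intro bexI[of _ Q]) (auto simp: m_def s_def)
qed

text \<open>Without this bound the real-valued supremum over the ambiguity set would have no
  meaning. Absolute continuity carries the almost sure bound from \<open>P\<close> to
  \<open>Q\<close>.\<close>

lemma ambiguity_set_bounds:
  fixes y :: "'a \<Rightarrow> real"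
  assumes P: "prob_space P" and y: "y \<in> borel_measurable P" "AE x in P. \<bar>y x\<bar> \<le> C"
    and Q: "Q \<in> ambiguity_set \<phi> \<delta> P"
  shows "\<bar>\<integral>x. y x \<partial>Q\<bar> \<le> C"
proof -
  have Q: "prob_space Q" "sets Q = sets P" "absolutely_continuous P Q"
    using Q by (auto simp: ambiguity_set_def)
  interpret Q: prob_space Q by fact
  show ?thesis
  proof (rule Q.abs_expectation_le)
    show "AE x in Q. \<bar>y x\<bar> \<le> C" by (rule absolutely_continuous_AE[OF Q(2) Q(3) y(2)])
    show "y \<in> borel_measurable Q" using y(1) measurable_cong_sets[OF Q(2) refl] by blast
  qed
qed

lemma sd_bounded:
  fixes y :: "'a \<Rightarrow> real"
  assumes P: "prob_space P" and y: "y \<in> borel_measurable P" "AE x in P. \<bar>y x\<bar> \<le> C"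
  shows "0 \<le> C" "sqrt (prob_space.variance P y) \<le> C"
proof -
  interpret P: prob_space P by fact
  have "\<exists>x. \<bar>y x\<bar> \<le> C" using y(2) P.AE_const eventually_happens'[OF P.ae_filter_bot y(2)] by auto
  then show C: "0 \<le> C" by (smt (verit))
  have i: "integrable P y" by (rule P.integrable_const_bound[of _ C]) (use y in auto)
  have sq: "AE x in P. (y x)\<^sup>2 \<le> C\<^sup>2" using y(2) C by (auto elim!: eventually_mono intro!: square_le_of_abs_le)
  have i2: "integrable P (\<lambda>x. (y x)\<^sup>2)" by (rule P.integrable_const_bound[of _ "C\<^sup>2"]) (use y sq in auto)
  have "P.variance y \<le> (\<integral>x. (y x)\<^sup>2 \<partial>P)" using P.variance_eq[OF i i2] by simp
  also have "\<dots> \<le> (\<integral>x. C\<^sup>2 \<partial>P)" by (rule integral_mono_AE) (use i2 sq in auto)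
  finally have "P.variance y \<le> C\<^sup>2" by (simp add: P.prob_space)
  then have "sqrt (P.variance y) \<le> sqrt (C\<^sup>2)" by (rule real_sqrt_le_mono)
  then show "sqrt (P.variance y) \<le> C" using C by simp
qed

lemma robust_expansion:
  assumes phi: "convex_lsc_divergence \<phi>" and C2: "C2_near \<phi> 1"
    and kappa: "\<kappa> = 2 / second_deriv \<phi> 1" "\<kappa> > 0" and \<epsilon>: "0 < \<epsilon>"
  obtains d where "d > 0"
    "\<And>\<delta> P (y :: 'a \<Rightarrow> real). \<lbrakk>0 < \<delta>; \<delta> \<le> d; prob_space P; y \<in> borel_measurable P; AE x in P. \<bar>y x\<bar> \<le> C\<rbrakk> \<Longrightarrow>
       \<bar>(SUP Q\<in>ambiguity_set \<phi> \<delta> P. \<integral>x. y x \<partial>Q)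
         - ((\<integral>x. y x \<partial>P) + sqrt \<kappa> * sqrt \<delta> * sqrt (prob_space.variance P y))\<bar> \<le> \<epsilon> * sqrt \<delta>"
proof -
  \<comment> \<open>The constants are tuned so that the errors add up: \<open>e\<close> satisfies 1
    / sqrt (1 - e) = 1 + \<xi>, and s \<xi> + r (1 + \<xi>) is at most \<epsilon> / sqrt \<kappa>,
    half from each summand. The sign of \<open>C\<close> is unknown until a function bounded by it
    is given, hence |C| + 1 in the denominators.\<close>
  define \<xi> where "\<xi> = min 1 (\<epsilon> / (2 * sqrt \<kappa> * (\<bar>C\<bar> + 1)))"
  define r where "r = \<epsilon> / (4 * sqrt \<kappa>)"
  define e where "e = 1 - 1 / (1 + \<xi>)\<^sup>2"
  have \<xi>: "0 < \<xi>" "\<xi> \<le> 1" "\<xi> \<le> \<epsilon> / (2 * sqrt \<kappa> * (\<bar>C\<bar> + 1))" using \<epsilon> kappa by (auto simp: \<xi>_def)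
  have r: "r > 0" using \<epsilon> kappa by (simp add: r_def)
  have e: "0 < e" "e < 1" using \<xi> by (auto simp: e_def power_less_one_iff one_less_power)
  have sq1: "1 / sqrt (1 - e) = 1 + \<xi>" using \<xi> by (simp add: e_def real_sqrt_divide)
  have sq2: "1 / sqrt (1 + e) \<ge> 1 - \<xi>" "1 / sqrt (1 + e) \<le> 1"
  proof -
    have "1 - \<xi> \<le> 1 / (1 + \<xi>)" using \<xi> by (simp add: field_simps)
    also have "\<dots> = sqrt (1 - e)" using \<xi> by (simp add: e_def real_sqrt_divide)
    \<comment> \<open>Because (1 - e) (1 + e) = 1 - e^2 \<le> 1; the same \<open>e\<close> thus
      serves both halves.\<close>
    also have "\<dots> \<le> sqrt (1 / (1 + e))"
      using e by (intro real_sqrt_le_mono) (simp add: field_simps power2_eq_square[symmetric])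
    finally show "1 / sqrt (1 + e) \<ge> 1 - \<xi>" by (simp add: real_sqrt_divide)
    show "1 / sqrt (1 + e) \<le> 1" using e by simp
  qed
  obtain \<eta> where eta: "\<eta> > 0"
    and Young: "\<And>t u. \<bar>u\<bar> \<le> \<eta> \<Longrightarrow> ennreal (u * (t - 1) - \<kappa> * u\<^sup>2 / (4 * (1 - e))) \<le> \<phi> t"
    and up: "\<And>t. \<bar>t - 1\<bar> \<le> \<eta> \<Longrightarrow> \<phi> t \<le> ennreal ((1 + e) * (t - 1)\<^sup>2 / \<kappa>)"
    using phi_Young[OF phi C2 kappa e] by blast
  \<comment> \<open>The smallness conditions of \<open>robust_upper\<close> and
    \<open>robust_lower\<close>, solved for sqrt \<delta>. The threshold for \<delta> is therefore
    the square of \<open>D\<close> and depends on neither \<open>P\<close> nor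
    \<open>y\<close>.\<close>
  define D where "D = min (\<eta> * r * sqrt \<kappa> / (4 * (\<bar>C\<bar> + 1))) (min \<eta> 1 * r / (2 * (\<bar>C\<bar> + 1) * sqrt \<kappa>))"
  have D: "D > 0" using eta r kappa by (auto simp: D_def)
  show ?thesis
  proof (rule that[of "D\<^sup>2"])
    show "0 < D\<^sup>2" using D by simp
    fix \<delta> P and y :: "'a \<Rightarrow> real"
    assume a: "0 < \<delta>" "\<delta> \<le> D\<^sup>2" "prob_space P" "y \<in> borel_measurable P" "AE x in P. \<bar>y x\<bar> \<le> C"
    define s where "s = sqrt (prob_space.variance P y)"
    define m where "m = (\<integral>x. y x \<partial>P)"
    have C: "0 \<le> C" "0 \<le> s" "s \<le> C" using sd_bounded[OF a(3-5)] prob_space.variance_positive[OF a(3), of y] by (auto simp: s_def)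
    have "sqrt \<delta> \<le> D" using a D real_le_lsqrt by force
    then have small: "sqrt \<delta> \<le> \<eta> * r * sqrt \<kappa> / (4 * (C + 1))" "sqrt \<delta> \<le> min \<eta> 1 * r / (2 * (C + 1) * sqrt \<kappa>)"
      using C by (auto simp: D_def)
    have small1: "4 * C * sqrt \<delta> \<le> \<eta> * r * sqrt \<kappa>"
    proof -
      have "4 * C * sqrt \<delta> \<le> 4 * (C + 1) * sqrt \<delta>" using a by (intro mult_right_mono) auto
      also have "\<dots> \<le> \<eta> * r * sqrt \<kappa>" using small(1) C by (simp add: field_simps)
      finally show ?thesis .
    qed
    have small2: "2 * C * sqrt (\<kappa> * \<delta>) \<le> min \<eta> 1 * r"
    proof -
      have "2 * C * (sqrt \<kappa> * sqrt \<delta>) \<le> 2 * (C + 1) * (sqrt \<kappa> * sqrt \<delta>)"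
        by (intro mult_right_mono) (use a(1) kappa(2) in auto)
      then have "2 * C * sqrt (\<kappa> * \<delta>) \<le> (2 * (C + 1) * sqrt \<kappa>) * sqrt \<delta>"
        by (simp only: real_sqrt_mult mult.assoc)
      also have "\<dots> \<le> min \<eta> 1 * r"
      proof -
        have "0 < 2 * (C + 1) * sqrt \<kappa>" using C kappa(2) by simp
        then have "sqrt \<delta> * (2 * (C + 1) * sqrt \<kappa>) \<le> min \<eta> 1 * r"
          using small(2) pos_le_divide_eq by blast
        then show ?thesis by (simp only: mult.commute)
      qed
      finally show ?thesis .
    qed
    let ?A = "ambiguity_set \<phi> \<delta> P" and ?K = "sqrt \<kappa> * sqrt \<delta>"
    have K: "?K > 0" using a kappa by simp
    obtain Q where Q: "Q \<in> ?A" "(\<integral>x. y x \<partial>Q) \<ge> m + (s - r) * (?K / sqrt (1 + e))"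
      unfolding m_def s_def
      using robust_lower[of \<eta> \<phi> e \<kappa> \<delta> r P y C, OF up kappa(2) e(1) a(1) r a(3-5) small2] by blast
    have U: "(\<integral>x. y x \<partial>Q) \<le> m + (s + r) * (?K / sqrt (1 - e))" if "Q \<in> ?A" for Q
      unfolding m_def s_def
      using robust_upper[of \<eta> \<kappa> e \<phi> \<delta> r P y C, OF Young kappa(2) e a(1) r a(3-5) small1 that] by blast
    have "(SUP Q\<in>?A. \<integral>x. y x \<partial>Q) \<le> m + (s + r) * (?K / sqrt (1 - e))"
      using Q(1) U by (intro cSUP_least) auto
    also have "\<dots> = m + ?K * ((s + r) * (1 / sqrt (1 - e)))" by simp
    also have "\<dots> = m + ?K * s + ?K * (s * \<xi> + r * (1 + \<xi>))" unfolding sq1 by (simp add: algebra_simps)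
    finally have 1: "(SUP Q\<in>?A. \<integral>x. y x \<partial>Q) \<le> m + ?K * s + ?K * (s * \<xi> + r * (1 + \<xi>))" .
    have "(\<integral>x. y x \<partial>Q) \<le> (SUP Q\<in>?A. \<integral>x. y x \<partial>Q)"
      using Q(1) ambiguity_set_bounds[OF a(3-5)] by (intro cSUP_upper bdd_aboveI2[of _ _ C]) (auto simp: abs_le_iff)
    then have 2: "m + ?K * ((s - r) * (1 / sqrt (1 + e))) \<le> (SUP Q\<in>?A. \<integral>x. y x \<partial>Q)"
      using Q(2) by (simp add: mult_ac)
    have "(s - r) * (1 / sqrt (1 + e)) \<ge> s - (s * \<xi> + r * (1 + \<xi>))"
    proof -
      have "s * (1 / sqrt (1 + e)) \<ge> s * (1 - \<xi>)" using sq2 C by (intro mult_left_mono) auto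
      moreover have "r * (1 / sqrt (1 + e)) \<le> r * (1 + \<xi>)"
        by (rule mult_left_mono) (use sq2(2) r \<xi>(1) in simp_all)
      ultimately show ?thesis
        unfolding left_diff_distrib right_diff_distrib by (simp only: mult_1_right)
    qed
    then have "?K * (s - (s * \<xi> + r * (1 + \<xi>))) \<le> ?K * ((s - r) * (1 / sqrt (1 + e)))"
      using K by (intro mult_left_mono) auto
    with 2 have 2: "m + ?K * s - ?K * (s * \<xi> + r * (1 + \<xi>)) \<le> (SUP Q\<in>?A. \<integral>x. y x \<partial>Q)"
      by (simp add: right_diff_distrib)
    have "s * \<xi> + r * (1 + \<xi>) \<le> (C + 1) * \<xi> + r * 2"
      using C \<xi> r by (intro add_mono mult_right_mono mult_left_mono) auto
    also have "\<dots> \<le> \<epsilon> / (2 * sqrt \<kappa>) + \<epsilon> / (2 * sqrt \<kappa>)"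
    proof (rule add_mono)
      have "(C + 1) * \<xi> \<le> (C + 1) * (\<epsilon> / (2 * sqrt \<kappa> * (C + 1)))"
        using \<xi>(3) C by (intro mult_left_mono) auto
      also have "\<dots> = \<epsilon> / (2 * sqrt \<kappa>)" using C(1) by simp
      finally show "(C + 1) * \<xi> \<le> \<epsilon> / (2 * sqrt \<kappa>)" .
    qed (simp add: r_def)
    also have "\<dots> = \<epsilon> / sqrt \<kappa>" by simp
    finally have "?K * (s * \<xi> + r * (1 + \<xi>)) \<le> ?K * (\<epsilon> / sqrt \<kappa>)" using K by (intro mult_left_mono) auto
    also have "\<dots> = \<epsilon> * sqrt \<delta>" using kappa by simp
    finally show "\<bar>(SUP Q\<in>ambiguity_set \<phi> \<delta> P. \<integral>x. y x \<partial>Q)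
         - ((\<integral>x. y x \<partial>P) + sqrt \<kappa> * sqrt \<delta> * sqrt (prob_space.variance P y))\<bar> \<le> \<epsilon> * sqrt \<delta>"
      unfolding s_def[symmetric] unfolding m_def[symmetric] using 1 2 by (simp add: abs_le_iff)
  qed
qed

section \<open>A maximal inequality for sums of independent vectors\<close>

text \<open>Young's inequality for the exponents k / (k - 1) and k, without roots. For a > 0 it is
  Bernoulli's inequality for (b / a)^k multiplied by a^k.\<close>

lemma power_weighted_mean:
  fixes a b :: real
  assumes "0 \<le> a" "0 \<le> b" "1 \<le> k"
  shows "real k * a ^ (k - 1) * b \<le> real (k - 1) * a ^ k + b ^ k"
proof (cases "a = 0")
  case True
  then show ?thesis using assms by (cases "k = 1") (auto simp: power_0_left)
next
  case False
  then have a: "a > 0" using assms by simp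
  have "1 + real k * (b / a - 1) \<le> (1 + (b / a - 1)) ^ k"
    by (rule Bernoulli_inequality) (use assms in simp)
  then have "a ^ k * (1 + real k * (b / a - 1)) \<le> a ^ k * (b / a) ^ k"
    using a by (intro mult_left_mono) auto
  also have "\<dots> = b ^ k" using a by (simp add: power_mult_distrib[symmetric])
  also have "a ^ k * (1 + real k * (b / a - 1)) = a ^ k - real k * a ^ k + real k * a ^ (k - 1) * b"
    using a assms by (simp add: algebra_simps power_eq_if)
  finally show ?thesis using assms by (simp add: of_nat_diff algebra_simps)
qed

text \<open>Hoelder's inequality, with any upper bound \<open>N\<close> in place of the sum of the
  a^k, so that a regularized sum may be inserted. Rescaling \<open>b\<close> by \<alpha> balances
  the two sides before Young's inequality is applied term by term.\<close>

lemma sum_power_Hoelder: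
  fixes a b :: "'e \<Rightarrow> real"
  assumes ab: "\<And>e. e \<in> E \<Longrightarrow> 0 \<le> a e" "\<And>e. e \<in> E \<Longrightarrow> 0 \<le> b e" and E: "finite E" and k: "1 \<le> k"
    and N: "(\<Sum>e\<in>E. a e ^ k) \<le> N" "0 < N"
  shows "(\<Sum>e\<in>E. a e ^ (k - 1) * b e) \<le> (\<Sum>e\<in>E. b e ^ k) powr (1 / k) * N powr (1 - 1 / k)"
proof (cases "(\<Sum>e\<in>E. b e ^ k) = 0")
  case True
  then have "\<forall>e\<in>E. b e ^ k = 0"
    using ab E by (subst (asm) sum_nonneg_eq_0_iff) auto
  then show ?thesis using True k by (simp add: power_0_left)
next
  case False
  define B where "B = (\<Sum>e\<in>E. b e ^ k)"
  have B: "B > 0" using False ab by (simp add: B_def less_le sum_nonneg)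
  define \<beta> \<nu> where "\<beta> = B powr (1 / k)" and "\<nu> = N powr (1 / k)"
  have bn: "\<beta> > 0" "\<nu> > 0" using B N by (auto simp: \<beta>_def \<nu>_def)
  have bk: "\<beta> ^ k = B" "\<nu> ^ k = N" using B N k by (simp_all add: \<beta>_def \<nu>_def powr_realpow[symmetric] powr_powr)
  define \<alpha> where "\<alpha> = \<beta> / \<nu>"
  have al: "\<alpha> > 0" using bn by (simp add: \<alpha>_def)
  have "(\<Sum>e\<in>E. real k * a e ^ (k - 1) * (b e / \<alpha>)) \<le> (\<Sum>e\<in>E. real (k - 1) * a e ^ k + (b e / \<alpha>) ^ k)"
    using ab k al by (intro sum_mono power_weighted_mean) auto
  also have "\<dots> = real (k - 1) * (\<Sum>e\<in>E. a e ^ k) + B / \<alpha> ^ k"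
    by (simp add: sum.distrib sum_distrib_left power_divide B_def sum_divide_distrib)
  also have "\<dots> \<le> real (k - 1) * N + N"
    using N B bn by (intro add_mono mult_left_mono) (auto simp: \<alpha>_def power_divide bk)
  also have "\<dots> = real k * N" using k by (simp add: of_nat_diff algebra_simps)
  also have "(\<Sum>e\<in>E. real k * a e ^ (k - 1) * (b e / \<alpha>)) = real k * ((\<Sum>e\<in>E. a e ^ (k - 1) * b e) / \<alpha>)"
    by (simp add: sum_distrib_left sum_divide_distrib mult.assoc)
  finally have "(\<Sum>e\<in>E. a e ^ (k - 1) * b e) \<le> N * \<alpha>" using k al by (simp add: pos_divide_le_eq)
  also have "\<dots> = \<beta> * N powr (1 - 1 / k)"
    using N by (simp add: \<alpha>_def \<nu>_def powr_diff)
  finally show ?thesis by (simp add: \<beta>_def B_def)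
qed

text \<open>Two-smoothness of the \<open>\<ell>\<^sup>2\<^sup>k\<close> norm; the regularization \<open>\<epsilon>\<close> removes the
  singularity at the origin. It makes second moments of sums of independent vectors grow
  linearly in that norm, with a constant that does not depend on the dimension.\<close>

lemma even_norm_smooth:
  fixes x y :: "'e \<Rightarrow> real" and N :: "('e \<Rightarrow> real) \<Rightarrow> real"
  assumes E: "finite E" and k: "1 \<le> k" and \<epsilon>: "0 < \<epsilon>"
    and N: "\<And>x. N x = \<epsilon> + (\<Sum>e\<in>E. x e ^ (2 * k))"
  shows "N (\<lambda>e. x e + y e) powr (1 / k) \<le> N x powr (1 / k)
      + (\<Sum>e\<in>E. 2 * N x powr (1 / k - 1) * x e ^ (2 * k - 1) * y e)
      + (2 * real k - 1) * (\<Sum>e\<in>E. y e ^ (2 * k)) powr (1 / k)"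
proof -
  define p where "p = 1 / real k"
  have p: "0 < p" "p \<le> 1" "real k * p = 1" using k by (auto simp: p_def)
  \<comment> \<open>The segment from \<open>x\<close> to x + y. Since \<open>n0\<close> stays at
    least \<epsilon>, its power with exponent p \<le> 1 is twice differentiable, and Taylor's
    formula of second order applies on [0, 1].\<close>
  define n0 where "n0 = (\<lambda>t. N (\<lambda>e. x e + t * y e))"
  define n1 where "n1 = (\<lambda>t. \<Sum>e\<in>E. real (2 * k) * (x e + t * y e) ^ (2 * k - 1) * y e)"
  define n2 where "n2 = (\<lambda>t. \<Sum>e\<in>E. real (2 * k) * (real (2 * k - 1) * (x e + t * y e) ^ (2 * k - 2) * y e) * y e)"
  have n0pos: "n0 t > 0" for t
    using \<epsilon> by (simp add: n0_def N add_pos_nonneg sum_nonneg)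
  have k2: "2 * k - 1 - Suc 0 = 2 * k - 2" "k * 2 - Suc (Suc 0) = k * 2 - 2" by simp_all
  have k1: "real (2 * k - 1) = 2 * real k - 1" using k by (simp add: of_nat_diff)
  have D0: "(n0 has_real_derivative n1 t) (at t)" for t
    unfolding n0_def N n1_def
    by (rule derivative_eq_intros refl | simp)+ (simp add: mult_ac)
  have D1: "(n1 has_real_derivative n2 t) (at t)" for t
    unfolding n1_def n2_def
    by (rule derivative_eq_intros refl | simp)+ (simp add: mult_ac k2)
  define f0 where "f0 = (\<lambda>t. n0 t powr p)"
  define f1 where "f1 = (\<lambda>t. p * n0 t powr (p - 1) * n1 t)"
  define f2 where "f2 = (\<lambda>t. p * (p - 1) * n0 t powr (p - 1 - 1) * (n1 t)\<^sup>2 + p * n0 t powr (p - 1) * n2 t)"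
  have F0: "(f0 has_real_derivative f1 t) (at t)" for t
    unfolding f0_def f1_def using DERIV_powr[OF D0 n0pos DERIV_const[of p]] n0pos[of t]
    by (simp add: powr_diff field_simps)
  have F1: "(f1 has_real_derivative f2 t) (at t)" for t
  proof -
    have "((\<lambda>t. n0 t powr (p - 1)) has_real_derivative (p - 1) * n0 t powr (p - 1 - 1) * n1 t) (at t)"
    proof (rule DERIV_cong[OF DERIV_powr[OF D0 n0pos DERIV_const[of "p - 1"]]])
      have "n0 t powr (p - 1 - 1) = n0 t powr (p - 1) / n0 t"
        unfolding powr_diff[of "n0 t" "p - 1" 1] using n0pos[of t] by simp
      then show "n0 t powr (p - 1) * (0 * ln (n0 t) + n1 t * (p - 1) / n0 t)
          = (p - 1) * n0 t powr (p - 1 - 1) * n1 t" by simp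
    qed
    from DERIV_mult[OF DERIV_cmult[OF this, of p] D1] show ?thesis
      unfolding f1_def f2_def by (simp add: power2_eq_square algebra_simps)
  qed
  define \<beta> where "\<beta> = (\<Sum>e\<in>E. y e ^ (2 * k)) powr p"
  \<comment> \<open>The term with the square of \<open>n1\<close> is nonpositive because p \<le> 1.
    In the other one Hoelder's inequality produces the power of \<open>n0\<close> that cancels the
    prefactor, so the bound is free of \<open>t\<close>, \<open>x\<close> and the number of
    coordinates.\<close>
  have f2: "f2 t \<le> 2 * (2 * real k - 1) * \<beta>" for t
  proof -
    have "(\<Sum>e\<in>E. ((x e + t * y e)\<^sup>2) ^ (k - 1) * (y e)\<^sup>2) \<le> (\<Sum>e\<in>E. ((y e)\<^sup>2) ^ k) powr (1 / k) * n0 t powr (1 - 1 / k)"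
      by (rule sum_power_Hoelder) (use E k \<epsilon> n0pos in \<open>auto simp: n0_def N power_mult\<close>)
    then have h: "(\<Sum>e\<in>E. (x e + t * y e) ^ (2 * k - 2) * (y e)\<^sup>2) \<le> \<beta> * n0 t powr (1 - p)"
      unfolding \<beta>_def p_def by (simp add: power_mult[symmetric] right_diff_distrib')
    have "n2 t = 2 * real k * (2 * real k - 1) * (\<Sum>e\<in>E. (x e + t * y e) ^ (2 * k - 2) * (y e)\<^sup>2)"
      by (simp only: n2_def sum_distrib_left power2_eq_square k1) (auto intro!: sum.cong simp: algebra_simps)
    also have "\<dots> \<le> 2 * real k * (2 * real k - 1) * (\<beta> * n0 t powr (1 - p))"
      using h k by (intro mult_left_mono) auto
    finally have "p * n0 t powr (p - 1) * n2 t \<le> p * n0 t powr (p - 1) * (2 * real k * (2 * real k - 1) * (\<beta> * n0 t powr (1 - p)))"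
      using p by (intro mult_left_mono) auto
    also have "\<dots> = (k * p) * 2 * (2 * real k - 1) * \<beta> * (n0 t powr (p - 1) * n0 t powr (1 - p))"
      by (simp add: mult_ac)
    also have "n0 t powr (p - 1) * n0 t powr (1 - p) = 1" using n0pos[of t] by (simp add: powr_add[symmetric])
    finally have "p * n0 t powr (p - 1) * n2 t \<le> 2 * (2 * real k - 1) * \<beta>" using p by simp
    moreover have "p * (p - 1) * n0 t powr (p - 1 - 1) * (n1 t)\<^sup>2 \<le> 0"
      using p by (intro mult_nonpos_nonneg mult_nonneg_nonpos) auto
    ultimately show ?thesis by (simp add: f2_def)
  qed
  define diff where "diff = (\<lambda>m::nat. if m = 0 then f0 else if m = 1 then f1 else f2)"
  have "\<forall>m t. m < 2 \<and> 0 \<le> t \<and> t \<le> 1 \<longrightarrow> (diff m has_real_derivative diff (Suc m) t) (at t)"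
    using F0 F1 by (auto simp: diff_def less_2_cases_iff)
  then have "\<exists>t>0. t < 1 \<and> f0 1 = (\<Sum>m<2. diff m 0 / fact m * (1 - 0) ^ m) + diff 2 t / fact 2 * (1 - 0) ^ 2"
    using Taylor_up[of 2 diff f0 0 1 0] by (auto simp: diff_def)
  then obtain t where "f0 1 = f0 0 + f1 0 + f2 t / 2"
    by (auto simp: diff_def lessThan_Suc numeral_2_eq_2)
  then have "f0 1 \<le> f0 0 + f1 0 + (2 * real k - 1) * \<beta>" using f2[of t] by (simp add: algebra_simps)
  moreover have "f1 0 = (\<Sum>e\<in>E. 2 * N x powr (p - 1) * x e ^ (2 * k - 1) * y e)"
  proof -
    have "f1 0 = (k * p) * (\<Sum>e\<in>E. 2 * N x powr (p - 1) * x e ^ (2 * k - 1) * y e)"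
      by (simp add: f1_def n1_def n0_def sum_distrib_left mult_ac)
    then show ?thesis using p by simp
  qed
  ultimately show ?thesis by (simp add: f0_def n0_def \<beta>_def p_def)
qed

section \<open>Second moments of vector sums along an i.i.d. sample\<close>

locale iid_sample = prob_space M for M :: "'w measure" +
  fixes N P :: "'x measure" and X :: "nat \<Rightarrow> 'w \<Rightarrow> 'x"
  assumes indep: "indep_vars (\<lambda>_. N) X {1..}"
    and ident: "\<And>i. i \<ge> 1 \<Longrightarrow> distr M N (X i) = P"
begin

lemma X_measurable [measurable]: "i \<ge> 1 \<Longrightarrow> X i \<in> measurable M N"
  using indep by (auto simp: indep_vars_def)

lemma sets_P [simp, measurable_cong]: "sets P = sets N"
  using ident[of 1] by (metis order_refl sets_distr)

lemma space_P [simp]: "space P = space N"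
  by (rule sets_eq_imp_space_eq) simp

lemma prob_space_P: "prob_space P"
  using prob_space_distr[OF X_measurable[of 1]] ident[of 1] by simp

lemma integral_X:
  fixes f :: "'x \<Rightarrow> real"
  assumes "i \<ge> 1" "f \<in> borel_measurable N"
  shows "(\<integral>\<omega>. f (X i \<omega>) \<partial>M) = (\<integral>x. f x \<partial>P)"
  using integral_distr[OF X_measurable[OF assms(1)] assms(2)] unfolding ident[OF assms(1)] by simp

lemma integrable_X:
  fixes f :: "'x \<Rightarrow> real"
  assumes "i \<ge> 1" "f \<in> borel_measurable N"
  shows "integrable M (\<lambda>\<omega>. f (X i \<omega>)) \<longleftrightarrow> integrable P f"
  using integrable_distr_eq[OF X_measurable[OF assms(1)] assms(2)] unfolding ident[OF assms(1)] by simp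

lemma X_space: "i \<ge> 1 \<Longrightarrow> \<omega> \<in> space M \<Longrightarrow> X i \<omega> \<in> space N"
  using X_measurable by (auto simp: measurable_def)

lemma AE_X:
  assumes "AE x in P. Q x"
  shows "AE \<omega> in M. \<forall>i\<ge>1. Q (X i \<omega>)"
proof -
  have "AE \<omega> in M. i \<ge> 1 \<longrightarrow> Q (X i \<omega>)" for i
  proof (cases "i \<ge> 1")
    case True
    have "AE x in distr M N (X i). Q x" unfolding ident[OF True] by (rule assms)
    then show ?thesis using AE_distrD[OF X_measurable[OF True]] True by simp
  qed simp
  then show ?thesis by (subst AE_all_countable) auto
qed

text \<open>When an observation is added, the first-order term of \<open>even_norm_smooth\<close> is
  a function of the past times a centred function of the new observation, hence has mean zero, and
  the second-order term adds the same constant each time. \<open>B\<close> secures integrability;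
  the size is measured by \<open>D\<close> and \<Psi>, for which a second moment is enough.\<close>

lemma expectation_even_norm:
  fixes q :: "'e \<Rightarrow> 'x \<Rightarrow> real"
  assumes E: "finite E" and k: "1 \<le> k" and \<epsilon>: "0 < \<epsilon>"
    and q: "\<And>e. e \<in> E \<Longrightarrow> q e \<in> borel_measurable N"
      "\<And>e x. e \<in> E \<Longrightarrow> x \<in> space N \<Longrightarrow> \<bar>q e x\<bar> \<le> B"
      "\<And>e. e \<in> E \<Longrightarrow> (\<integral>x. q e x \<partial>P) = 0"
      "\<And>e x. e \<in> E \<Longrightarrow> x \<in> space N \<Longrightarrow> \<bar>q e x\<bar> \<le> D * \<Psi> x"
    and \<Psi>: "integrable P (\<lambda>x. (\<Psi> x)\<^sup>2)"
  defines "\<Phi> \<equiv> \<lambda>n \<omega>. (\<epsilon> + (\<Sum>e\<in>E. (\<Sum>i=1..n. q e (X i \<omega>)) ^ (2 * k))) powr (1 / real k)"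
  shows "integrable M (\<Phi> n)"
    "(\<integral>\<omega>. \<Phi> n \<omega> \<partial>M) \<le> \<epsilon> powr (1 / k)
      + real n * ((2 * real k - 1) * real (card E) powr (1 / real k) * D\<^sup>2 * (\<integral>x. (\<Psi> x)\<^sup>2 \<partial>P))"
proof -
  define S where "S = (\<lambda>n \<omega> e. \<Sum>i=1..n. q e (X i \<omega>))"
  define V where "V = (\<lambda>x::'e \<Rightarrow> real. \<epsilon> + (\<Sum>e\<in>E. x e ^ (2 * k)))"
  define p where "p = 1 / real k"
  have p: "0 < p" "p \<le> 1" using k by (auto simp: p_def)
  have Vge: "V x \<ge> \<epsilon>" for x by (simp add: V_def sum_nonneg)
  have Phi: "\<Phi> n \<omega> = V (S n \<omega>) powr p" for n \<omega> by (simp add: \<Phi>_def V_def S_def p_def)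
  have [measurable]: "(\<lambda>\<omega>. S n \<omega> e) \<in> borel_measurable M" if "e \<in> E" for n e
    unfolding S_def using q(1)[OF that] by (intro borel_measurable_sum measurable_compose[OF X_measurable]) auto
  have Sb: "\<bar>S n \<omega> e\<bar> \<le> real n * B" if "e \<in> E" "\<omega> \<in> space M" for n \<omega> e
  proof -
    have "\<bar>S n \<omega> e\<bar> \<le> (\<Sum>i=1..n. B)" unfolding S_def
      by (intro order_trans[OF sum_abs] sum_mono q(2) X_space) (use that in auto)
    then show ?thesis by simp
  qed
  have Vm [measurable]: "(\<lambda>\<omega>. V (S n \<omega>)) \<in> borel_measurable M" for n unfolding V_def by measurable
  show int: "integrable M (\<Phi> n)" for n
  proof (rule integrable_const_bound)
    show "AE \<omega> in M. norm (\<Phi> n \<omega>) \<le> (\<epsilon> + (\<Sum>e\<in>E. (real n * B) ^ (2 * k))) powr p"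
    proof (rule AE_I2)
      fix \<omega> assume w: "\<omega> \<in> space M"
      have "S n \<omega> e ^ (2 * k) \<le> (real n * B) ^ (2 * k)" if "e \<in> E" for e
        using power_mono[OF Sb[OF that w, of n], of "2 * k"] by (simp add: power_even_abs)
      then have "V (S n \<omega>) \<le> \<epsilon> + (\<Sum>e\<in>E. (real n * B) ^ (2 * k))"
        unfolding V_def by (intro add_mono sum_mono) auto
      then show "norm (\<Phi> n \<omega>) \<le> (\<epsilon> + (\<Sum>e\<in>E. (real n * B) ^ (2 * k))) powr p"
        unfolding Phi using Vge[of "S n \<omega>"] \<epsilon> p by (simp add: powr_mono2)
    qed
    show "\<Phi> n \<in> borel_measurable M" unfolding Phi by measurable
  qed
  define K where "K = (2 * real k - 1) * real (card E) powr p * D\<^sup>2 * (\<integral>x. (\<Psi> x)\<^sup>2 \<partial>P)"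
  show "(\<integral>\<omega>. \<Phi> n \<omega> \<partial>M) \<le> \<epsilon> powr (1 / k) + real n * ((2 * real k - 1) * real (card E) powr (1 / real k) * D\<^sup>2 * (\<integral>x. (\<Psi> x)\<^sup>2 \<partial>P))"
    unfolding p_def[symmetric] K_def[symmetric]
  proof (induction n)
    case 0
    show ?case using k by (simp add: \<Phi>_def p_def power_0_left prob_space)
  next
    case (Suc n)
    define A where "A = (\<lambda>e x. 2 * V x powr (p - 1) * x e ^ (2 * k - 1))"
    define T where "T = (\<lambda>\<omega>. \<Sum>e\<in>E. A e (S n \<omega>) * q e (X (Suc n) \<omega>))"
    define R where "R = (\<lambda>\<omega>. (2 * real k - 1) * real (card E) powr p * D\<^sup>2 * (\<Psi> (X (Suc n) \<omega>))\<^sup>2)"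
    have cross: "integrable M (\<lambda>\<omega>. A e (S n \<omega>) * q e (X (Suc n) \<omega>))"
      "(\<integral>\<omega>. A e (S n \<omega>) * q e (X (Suc n) \<omega>) \<partial>M) = 0" if e: "e \<in> E" for e
    proof -
      let ?f = "\<lambda>z. A e (\<lambda>e. \<Sum>i=1..n. q e (z i))"
      have m1: "?f \<in> borel_measurable (PiM {1..n} (\<lambda>_. N))"
      proof -
        have [measurable]: "(\<lambda>z. \<Sum>i=1..n. q e (z i)) \<in> borel_measurable (PiM {1..n} (\<lambda>_. N))" if "e \<in> E" for e
          using q(1)[OF that] by (intro borel_measurable_sum measurable_compose[OF measurable_component_singleton]) auto
        show ?thesis unfolding A_def V_def using e by measurable
      qed
      have m2: "(\<lambda>z. q e (z (Suc n))) \<in> borel_measurable (PiM {Suc n} (\<lambda>_. N))"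
        by (rule measurable_compose[OF _ q(1)[OF e]]) (rule measurable_component_singleton, simp)
      \<comment> \<open>One factor depends on the observations 1, ..., n and the other one on
        observation n + 1: independence of two disjoint blocks, transported through measurable
        functions of the blocks.\<close>
      have "indep_var borel (?f \<circ> (\<lambda>\<omega>. restrict (\<lambda>i. X i \<omega>) {1..n})) borel ((\<lambda>z. q e (z (Suc n))) \<circ> (\<lambda>\<omega>. restrict (\<lambda>i. X i \<omega>) {Suc n}))"
        by (rule indep_var_compose[OF indep_var_restrict[OF indep] m1 m2]) auto
      then have iv: "indep_var borel (\<lambda>\<omega>. A e (S n \<omega>)) borel (\<lambda>\<omega>. q e (X (Suc n) \<omega>))"
        by (simp add: comp_def S_def)
      have i2: "integrable M (\<lambda>\<omega>. q e (X (Suc n) \<omega>))"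
        by (rule integrable_const_bound[of _ B]) (use q e X_space in \<open>auto intro: measurable_compose[OF X_measurable]\<close>)
      have i1: "integrable M (\<lambda>\<omega>. A e (S n \<omega>))"
      proof (rule integrable_const_bound)
        show "AE \<omega> in M. norm (A e (S n \<omega>)) \<le> 2 * \<epsilon> powr (p - 1) * (real n * B) ^ (2 * k - 1)"
        proof (rule AE_I2)
          fix \<omega> assume w: "\<omega> \<in> space M"
          \<comment> \<open>The exponent is nonpositive, so it is the lower bound \<epsilon> of
            \<open>V\<close> that bounds this factor, which could blow up at the origin
            otherwise.\<close>
          have "V (S n \<omega>) powr (p - 1) \<le> \<epsilon> powr (p - 1)"
            using p \<epsilon> Vge by (intro powr_mono2') auto
          moreover have "\<bar>S n \<omega> e\<bar> ^ (2 * k - 1) \<le> (real n * B) ^ (2 * k - 1)"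
            by (rule power_mono[OF Sb[OF e w]]) simp
          ultimately show "norm (A e (S n \<omega>)) \<le> 2 * \<epsilon> powr (p - 1) * (real n * B) ^ (2 * k - 1)"
            unfolding A_def by (simp add: abs_mult power_abs mult_mono)
        qed
        show "(\<lambda>\<omega>. A e (S n \<omega>)) \<in> borel_measurable M" unfolding A_def using e by measurable
      qed
      show "integrable M (\<lambda>\<omega>. A e (S n \<omega>) * q e (X (Suc n) \<omega>))"
        by (rule indep_var_integrable[OF iv i1 i2])
      show "(\<integral>\<omega>. A e (S n \<omega>) * q e (X (Suc n) \<omega>) \<partial>M) = 0"
        by (subst indep_var_lebesgue_integral[OF iv i1 i2]) (use integral_X[OF _ q(1)[OF e]] q(3)[OF e] in simp)
    qed
    have intT: "integrable M T" "(\<integral>\<omega>. T \<omega> \<partial>M) = 0"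
      unfolding T_def using cross by auto
    have psi: "(\<lambda>x. (\<Psi> x)\<^sup>2) \<in> borel_measurable N" using borel_measurable_integrable[OF \<Psi>] by simp
    have intR: "integrable M R" "(\<integral>\<omega>. R \<omega> \<partial>M) = K"
      unfolding R_def K_def using integrable_X[OF _ psi, of "Suc n"] integral_X[OF _ psi, of "Suc n"] \<Psi> by auto
    have le: "\<Phi> (Suc n) \<omega> \<le> \<Phi> n \<omega> + T \<omega> + R \<omega>" if w: "\<omega> \<in> space M" for \<omega>
    proof -
      let ?y = "\<lambda>e. q e (X (Suc n) \<omega>)"
      have "\<Phi> (Suc n) \<omega> = V (\<lambda>e. S n \<omega> e + ?y e) powr (1 / real k)"
        unfolding Phi p_def by (simp add: S_def)
      also have "\<dots> \<le> V (S n \<omega>) powr (1 / real k)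
          + (\<Sum>e\<in>E. 2 * V (S n \<omega>) powr (1 / real k - 1) * S n \<omega> e ^ (2 * k - 1) * ?y e)
          + (2 * real k - 1) * (\<Sum>e\<in>E. ?y e ^ (2 * k)) powr (1 / real k)"
        by (rule even_norm_smooth[OF E k \<epsilon>]) (simp add: V_def)
      also have "\<dots> = \<Phi> n \<omega> + T \<omega> + (2 * real k - 1) * (\<Sum>e\<in>E. ?y e ^ (2 * k)) powr p"
        unfolding Phi T_def A_def p_def by simp
      \<comment> \<open>All coordinates obey the same bound D \<Psi>, so the norm costs a factor
        \<open>card E\<close> to the power 1 / k. Only here does the number of coordinates
        enter.\<close>
      also have "(\<Sum>e\<in>E. ?y e ^ (2 * k)) powr p \<le> real (card E) powr p * (D\<^sup>2 * (\<Psi> (X (Suc n) \<omega>))\<^sup>2)"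
      proof -
        have "?y e ^ (2 * k) \<le> (D * \<Psi> (X (Suc n) \<omega>)) ^ (2 * k)" if "e \<in> E" for e
          using power_mono[OF q(4)[OF that X_space[OF _ w], of "Suc n"], of "2 * k"] by (simp add: power_even_abs)
        then have "(\<Sum>e\<in>E. ?y e ^ (2 * k)) \<le> real (card E) * (D * \<Psi> (X (Suc n) \<omega>)) ^ (2 * k)"
          by (intro sum_bounded_above) auto
        then have "(\<Sum>e\<in>E. ?y e ^ (2 * k)) powr p \<le> (real (card E) * ((D * \<Psi> (X (Suc n) \<omega>))\<^sup>2) ^ k) powr p"
          using p by (intro powr_mono2) (auto intro!: sum_nonneg simp: power_mult)
        also have "\<dots> = real (card E) powr p * (((D * \<Psi> (X (Suc n) \<omega>))\<^sup>2) ^ k) powr p"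
          by (rule powr_mult)
        also have "(((D * \<Psi> (X (Suc n) \<omega>))\<^sup>2) ^ k) powr p = (D * \<Psi> (X (Suc n) \<omega>))\<^sup>2"
        proof (cases "D * \<Psi> (X (Suc n) \<omega>) = 0")
          case True
          then show ?thesis using k unfolding True by (simp add: zero_power)
        next
          case False
          then have "((D * \<Psi> (X (Suc n) \<omega>))\<^sup>2) ^ k = ((D * \<Psi> (X (Suc n) \<omega>))\<^sup>2) powr real k"
            by (subst powr_realpow) auto
          then show ?thesis using k by (simp only: powr_powr) (simp add: p_def)
        qed
        finally show ?thesis by (simp add: power_mult_distrib)
      qed
      finally show ?thesis using k by (simp add: R_def mult_left_mono mult.assoc)
    qed
    have "(\<integral>\<omega>. \<Phi> (Suc n) \<omega> \<partial>M) \<le> (\<integral>\<omega>. \<Phi> n \<omega> + T \<omega> + R \<omega> \<partial>M)"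
      using int intT intR le by (intro integral_mono) auto
    also have "\<dots> = (\<integral>\<omega>. \<Phi> n \<omega> \<partial>M) + K" using int intT intR by simp
    finally show ?case using Suc.IH by (simp add: algebra_simps)
  qed
qed

text \<open>Markov's inequality for the squared norm: if one coordinate sum exceeds t sqrt n, then
  so does the norm. Compared with a union bound, the cardinality of \<open>E\<close> enters through
  its k-th root only.\<close>

lemma max_sum_tail:
  fixes q :: "'e \<Rightarrow> 'x \<Rightarrow> real"
  assumes E: "finite E" and k: "1 \<le> k" and n: "1 \<le> n" and t: "0 < t"
    and q: "\<And>e. e \<in> E \<Longrightarrow> q e \<in> borel_measurable N"
      "\<And>e x. e \<in> E \<Longrightarrow> x \<in> space N \<Longrightarrow> \<bar>q e x\<bar> \<le> B"
      "\<And>e. e \<in> E \<Longrightarrow> (\<integral>x. q e x \<partial>P) = 0"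
      "\<And>e x. e \<in> E \<Longrightarrow> x \<in> space N \<Longrightarrow> \<bar>q e x\<bar> \<le> D * \<Psi> x"
    and \<Psi>: "integrable P (\<lambda>x. (\<Psi> x)\<^sup>2)"
  defines "A \<equiv> {\<omega>\<in>space M. \<exists>e\<in>E. \<bar>\<Sum>i=1..n. q e (X i \<omega>)\<bar> > t * sqrt n}"
  shows "A \<in> events"
    "prob A \<le> (2 * real k - 1) * real (card E) powr (1 / real k) * D\<^sup>2 * (\<integral>x. (\<Psi> x)\<^sup>2 \<partial>P) / t\<^sup>2"
proof -
  have [measurable]: "(\<lambda>\<omega>. \<Sum>i=1..n. q e (X i \<omega>)) \<in> borel_measurable M" if "e \<in> E" for e
    using q(1)[OF that] by (intro borel_measurable_sum measurable_compose[OF X_measurable]) auto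
  show ev: "A \<in> events" unfolding A_def using E by measurable
  define K where "K = (2 * real k - 1) * real (card E) powr (1 / real k) * D\<^sup>2 * (\<integral>x. (\<Psi> x)\<^sup>2 \<partial>P)"
  have "prob A * (t\<^sup>2 * n) \<le> n * K + \<xi>" if \<xi>: "\<xi> > 0" for \<xi>
  proof -
    \<comment> \<open>The k-th root of this \<epsilon> is \<xi>, so the regularization contributes
      an arbitrarily small summand, removed at the end by \<open>field_le_epsilon\<close>.\<close>
    define \<epsilon> where "\<epsilon> = \<xi> ^ k"
    have e: "\<epsilon> > 0" using \<xi> by (simp add: \<epsilon>_def)
    have e': "\<epsilon> powr (1 / real k) = \<xi>" unfolding \<epsilon>_def powr_realpow[OF \<xi>, symmetric] powr_powr using \<xi> k by simp
    define \<Phi> where "\<Phi> = (\<lambda>\<omega>. (\<epsilon> + (\<Sum>e\<in>E. (\<Sum>i=1..n. q e (X i \<omega>)) ^ (2 * k))) powr (1 / real k))"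
    have \<Phi>: "integrable M \<Phi>" "(\<integral>\<omega>. \<Phi> \<omega> \<partial>M) \<le> \<xi> + n * K"
      unfolding \<Phi>_def K_def e'[symmetric] by (rule expectation_even_norm[OF E k e q \<Psi>]; assumption)+
    have "prob A \<le> prob {\<omega>\<in>space M. \<Phi> \<omega> \<ge> t\<^sup>2 * n}"
    proof (rule finite_measure_mono)
      show "{\<omega>\<in>space M. \<Phi> \<omega> \<ge> t\<^sup>2 * n} \<in> events" using \<Phi>(1) by measurable
      show "A \<subseteq> {\<omega>\<in>space M. \<Phi> \<omega> \<ge> t\<^sup>2 * n}"
      proof
        fix \<omega> assume "\<omega> \<in> A"
        then obtain e0 where w: "\<omega> \<in> space M" and e0: "e0 \<in> E" "\<bar>\<Sum>i=1..n. q e0 (X i \<omega>)\<bar> > t * sqrt n"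
          by (auto simp: A_def)
        have "(t\<^sup>2 * n) powr real k = (t * sqrt n) ^ (2 * k)"
          using t n by (subst powr_realpow) (auto simp: power_mult power_mult_distrib)
        also have "\<dots> \<le> \<bar>\<Sum>i=1..n. q e0 (X i \<omega>)\<bar> ^ (2 * k)"
          using e0 t by (intro power_mono) auto
        also have "\<dots> = (\<Sum>i=1..n. q e0 (X i \<omega>)) ^ (2 * k)" by (simp add: power_even_abs)
        also have "\<dots> \<le> (\<Sum>e\<in>E. (\<Sum>i=1..n. q e (X i \<omega>)) ^ (2 * k))"
          using E e0 by (intro member_le_sum) auto
        also have "\<dots> \<le> \<epsilon> + \<dots>" using e by simp
        finally have "((t\<^sup>2 * n) powr real k) powr (1 / real k) \<le> \<Phi> \<omega>"
          unfolding \<Phi>_def by (intro powr_mono2) auto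
        moreover have "((t\<^sup>2 * n) powr real k) powr (1 / real k) = t\<^sup>2 * n" using k t n by (simp add: powr_powr)
        ultimately show "\<omega> \<in> {\<omega>\<in>space M. \<Phi> \<omega> \<ge> t\<^sup>2 * n}" using w by simp
      qed
    qed
    also have "\<dots> \<le> (\<integral>\<omega>. \<Phi> \<omega> \<partial>M) / (t\<^sup>2 * n)"
      by (rule integral_Markov_inequality_measure[where A = "{}", OF \<Phi>(1)]) (use t n in \<open>auto simp: \<Phi>_def\<close>)
    finally show ?thesis using \<Phi>(2) t n by (simp add: pos_le_divide_eq)
  qed
  then have "prob A * (t\<^sup>2 * n) \<le> n * K" by (rule field_le_epsilon)
  then have "prob A * t\<^sup>2 \<le> K" using n by (simp add: mult.assoc[symmetric])
  then show "prob A \<le> (2 * real k - 1) * real (card E) powr (1 / real k) * D\<^sup>2 * (\<integral>x. (\<Psi> x)\<^sup>2 \<partial>P) / t\<^sup>2"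
    unfolding K_def[symmetric] using t by (simp add: pos_le_divide_eq)
qed

end

section \<open>Chaining\<close>

text \<open>One point of \<Theta> is chosen from each dyadic cube that meets \<Theta>, so the net
  consists of parameters where the loss is controlled. The choice depends on the cube only, which
  bounds the number of points by the number of cubes.\<close>

lemma dyadic_net:
  fixes \<Theta> :: "(real ^ 'm) set"
  assumes "bounded \<Theta>"
  obtains \<pi> :: "nat \<Rightarrow> real ^ 'm \<Rightarrow> real ^ 'm" and c :: real where "c \<ge> 1"
    "\<And>j \<theta>. \<theta> \<in> \<Theta> \<Longrightarrow> \<pi> j \<theta> \<in> \<Theta>"
    "\<And>j \<theta>. \<theta> \<in> \<Theta> \<Longrightarrow> norm (\<pi> j \<theta> - \<theta>) \<le> c * (1 / 2) ^ j"
    "\<And>j. finite (\<pi> j ` \<Theta>)" "\<And>j. real (card (\<pi> j ` \<Theta>)) \<le> (c * 2 ^ j) ^ CARD('m)"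
proof -
  obtain R0 where R0: "\<And>\<theta>. \<theta> \<in> \<Theta> \<Longrightarrow> norm \<theta> \<le> R0" using assms by (auto simp: bounded_iff)
  define R where "R = nat \<lceil>R0\<rceil>"
  have R: "norm \<theta> \<le> real R" if "\<theta> \<in> \<Theta>" for \<theta>
    using R0[OF that] real_nat_ceiling_ge[of R0] by (simp add: R_def)
  define cell where "cell = (\<lambda>j (\<theta> :: real ^ 'm) i. \<lfloor>2 ^ j * \<theta> $ i\<rfloor>)"
  define pick where "pick = (\<lambda>j C. SOME t. t \<in> \<Theta> \<and> cell j t = C)"
  define \<pi> where "\<pi> = (\<lambda>j \<theta>. pick j (cell j \<theta>))"
  have pi: "\<pi> j \<theta> \<in> \<Theta>" "cell j (\<pi> j \<theta>) = cell j \<theta>" if "\<theta> \<in> \<Theta>" for j \<theta>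
    using someI[of "\<lambda>t. t \<in> \<Theta> \<and> cell j t = cell j \<theta>" \<theta>] that by (auto simp: \<pi>_def pick_def)
  \<comment> \<open>One constant for two purposes: the first summand bounds the l^1 distance within
    a cube in units of 2^(-j), the other two the number of cubes per coordinate in units of
    2^j.\<close>
  define c where "c = real (CARD('m)) + 2 * real R + 1"
  have dist: "norm (\<pi> j \<theta> - \<theta>) \<le> c * (1 / 2) ^ j" if "\<theta> \<in> \<Theta>" for j \<theta>
  proof -
    have "\<bar>(\<pi> j \<theta> - \<theta>) $ i\<bar> \<le> (1 / 2) ^ j" for i
    proof -
      have "\<lfloor>2 ^ j * \<pi> j \<theta> $ i\<rfloor> = \<lfloor>2 ^ j * \<theta> $ i\<rfloor>"
        using pi(2)[OF that, of j] by (simp add: cell_def fun_eq_iff)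
      then have "\<bar>2 ^ j * \<pi> j \<theta> $ i - 2 ^ j * \<theta> $ i\<bar> \<le> 1" by linarith
      then have "2 ^ j * \<bar>(\<pi> j \<theta> - \<theta>) $ i\<bar> \<le> 1" by (simp add: abs_mult right_diff_distrib[symmetric])
      then show ?thesis by (simp add: power_divide field_simps)
    qed
    then have "norm (\<pi> j \<theta> - \<theta>) \<le> (\<Sum>i\<in>(UNIV::'m set). (1 / 2) ^ j)"
      by (intro order_trans[OF norm_le_l1_cart] sum_mono) auto
    also have "\<dots> \<le> c * (1 / 2) ^ j" by (simp add: c_def mult_right_mono)
    finally show ?thesis .
  qed
  have sub: "cell j ` \<Theta> \<subseteq> UNIV \<rightarrow>\<^sub>E {- int (R * 2 ^ j)..int (R * 2 ^ j)}" for j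
  proof (clarsimp simp: PiE_UNIV_domain)
    fix \<theta> i assume "\<theta> \<in> \<Theta>"
    then have "\<bar>\<theta> $ i\<bar> \<le> real R" using R[of \<theta>] component_le_norm_cart[of \<theta> i] by linarith
    then have "\<bar>2 ^ j * \<theta> $ i\<bar> \<le> 2 ^ j * real R" by (simp add: abs_mult)
    then have b: "- (2 ^ j * real R) \<le> 2 ^ j * \<theta> $ i" "2 ^ j * \<theta> $ i \<le> 2 ^ j * real R" by linarith+
    have zr: "real_of_int (int R * 2 ^ j) = 2 ^ j * real R" by simp
    have "real_of_int \<lfloor>2 ^ j * \<theta> $ i\<rfloor> \<le> real_of_int (int R * 2 ^ j)" unfolding zr using b(2) by linarith
    then have "\<lfloor>2 ^ j * \<theta> $ i\<rfloor> \<le> int R * 2 ^ j" by (simp only: of_int_le_iff)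
    moreover have "real_of_int (- (int R * 2 ^ j)) \<le> 2 ^ j * \<theta> $ i" unfolding of_int_minus zr by (rule b(1))
    then have "- (int R * 2 ^ j) \<le> \<lfloor>2 ^ j * \<theta> $ i\<rfloor>" by (simp only: le_floor_iff)
    ultimately show "- (int R * 2 ^ j) \<le> cell j \<theta> i \<and> cell j \<theta> i \<le> int R * 2 ^ j"
      unfolding cell_def by blast
  qed
  have fin: "finite (UNIV \<rightarrow>\<^sub>E {- int (R * 2 ^ j)..int (R * 2 ^ j)} :: ('m \<Rightarrow> int) set)" for j
    by (intro finite_PiE) auto
  have img: "\<pi> j ` \<Theta> = pick j ` (cell j ` \<Theta>)" for j by (auto simp: \<pi>_def)
  show ?thesis
  proof (rule that[of c \<pi>])
    show "c \<ge> 1" by (simp add: c_def)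
    show "finite (\<pi> j ` \<Theta>)" for j unfolding img using finite_subset[OF sub fin] by blast
    show "real (card (\<pi> j ` \<Theta>)) \<le> (c * 2 ^ j) ^ CARD('m)" for j
    proof -
      have "card (\<pi> j ` \<Theta>) \<le> card (cell j ` \<Theta>)"
        unfolding img by (rule card_image_le) (rule finite_subset[OF sub fin])
      also have "\<dots> \<le> card (UNIV \<rightarrow>\<^sub>E {- int (R * 2 ^ j)..int (R * 2 ^ j)} :: ('m \<Rightarrow> int) set)"
        by (rule card_mono[OF fin sub])
      also have "\<dots> = (2 * R * 2 ^ j + 1) ^ CARD('m)"
        by (simp add: card_PiE nat_add_distrib nat_mult_distrib nat_power_eq mult.assoc)
      finally have "real (card (\<pi> j ` \<Theta>)) \<le> real ((2 * R * 2 ^ j + 1) ^ CARD('m))" by linarith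
      also have "\<dots> = (2 * real R * 2 ^ j + 1) ^ CARD('m)" by (simp add: add.commute)
      also have "\<dots> \<le> (c * 2 ^ j) ^ CARD('m)"
      proof (rule power_mono)
        have "2 * real R * 2 ^ j + 1 \<le> (2 * real R + 1) * 2 ^ j" by (simp add: distrib_right)
        also have "\<dots> \<le> c * 2 ^ j" by (intro mult_right_mono) (auto simp: c_def)
        finally show "2 * real R * 2 ^ j + 1 \<le> c * 2 ^ j" .
      qed simp
      finally show ?thesis .
    qed
  qed (use pi dist in auto)
qed

section \<open>Uniform control of the empirical process\<close>

context iid_sample
begin

lemma measure_P_space [simp]: "measure P (space N) = 1"
  using prob_space.prob_space[OF prob_space_P] by simp

definition emp_process :: "('x \<Rightarrow> 't \<Rightarrow> real) \<Rightarrow> nat \<Rightarrow> 't \<Rightarrow> 'w \<Rightarrow> real" where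
  "emp_process f n \<theta> \<omega> = (\<Sum>i=1..n. f (X i \<omega>) \<theta> - (\<integral>x. f x \<theta> \<partial>P)) / sqrt n"

lemma emp_process_measurable [measurable]:
  "(\<lambda>x. f x \<theta>) \<in> borel_measurable N \<Longrightarrow> emp_process f n \<theta> \<in> borel_measurable M"
  unfolding emp_process_def
  by (intro borel_measurable_divide borel_measurable_sum borel_measurable_diff measurable_compose[OF X_measurable]) auto

text \<open>The bounds are required at every point of the sample space, so that they hold along
  every sample path and for all parameters at once. Almost sure hypotheses are brought to this form
  by changing the loss on one null set.\<close>

definition lipschitz_family :: "('x \<Rightarrow> 't::real_normed_vector \<Rightarrow> real) \<Rightarrow> 't set \<Rightarrow> real \<Rightarrow> ('x \<Rightarrow> real) \<Rightarrow> bool" where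
  "lipschitz_family f \<Theta> C \<psi> \<longleftrightarrow>
     (\<forall>\<theta>\<in>\<Theta>. (\<lambda>x. f x \<theta>) \<in> borel_measurable N) \<and>
     (\<forall>x\<in>space N. \<forall>\<theta>\<in>\<Theta>. \<bar>f x \<theta>\<bar> \<le> C) \<and>
     (\<forall>x\<in>space N. 0 \<le> \<psi> x \<and> (\<forall>\<theta>\<in>\<Theta>. \<forall>\<theta>'\<in>\<Theta>. \<bar>f x \<theta> - f x \<theta>'\<bar> \<le> \<psi> x * norm (\<theta> - \<theta>'))) \<and>
     \<psi> \<in> borel_measurable N \<and> integrable P (\<lambda>x. (\<psi> x)\<^sup>2)"

lemma lipschitz_familyD:
  assumes "lipschitz_family f \<Theta> C \<psi>"
  shows "\<theta> \<in> \<Theta> \<Longrightarrow> (\<lambda>x. f x \<theta>) \<in> borel_measurable N"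
    "x \<in> space N \<Longrightarrow> \<theta> \<in> \<Theta> \<Longrightarrow> \<bar>f x \<theta>\<bar> \<le> C" "x \<in> space N \<Longrightarrow> 0 \<le> \<psi> x"
    "x \<in> space N \<Longrightarrow> \<theta> \<in> \<Theta> \<Longrightarrow> \<theta>' \<in> \<Theta> \<Longrightarrow> \<bar>f x \<theta> - f x \<theta>'\<bar> \<le> \<psi> x * norm (\<theta> - \<theta>')"
    "\<psi> \<in> borel_measurable N" "integrable P (\<lambda>x. (\<psi> x)\<^sup>2)" "integrable P \<psi>"
    "\<theta> \<in> \<Theta> \<Longrightarrow> integrable P (\<lambda>x. f x \<theta>)" "0 \<le> (\<integral>x. \<psi> x \<partial>P)" "\<theta> \<in> \<Theta> \<Longrightarrow> 0 \<le> C"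
    "\<theta> \<in> \<Theta> \<Longrightarrow> \<theta>' \<in> \<Theta> \<Longrightarrow> \<bar>(\<integral>x. f x \<theta> \<partial>P) - (\<integral>x. f x \<theta>' \<partial>P)\<bar> \<le> (\<integral>x. \<psi> x \<partial>P) * norm (\<theta> - \<theta>')"
    "\<theta> \<in> \<Theta> \<Longrightarrow> \<bar>\<integral>x. f x \<theta> \<partial>P\<bar> \<le> C"
proof -
  interpret P: prob_space P by (rule prob_space_P)
  have 1: "(\<lambda>x. f x \<theta>) \<in> borel_measurable N" if "\<theta> \<in> \<Theta>" for \<theta>
    using assms that by (simp add: lipschitz_family_def)
  have 2: "\<bar>f x \<theta>\<bar> \<le> C" if "x \<in> space N" "\<theta> \<in> \<Theta>" for x \<theta>
    using assms that by (simp add: lipschitz_family_def)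
  have 3: "0 \<le> \<psi> x" if "x \<in> space N" for x
    using assms that by (simp add: lipschitz_family_def)
  have 4: "\<bar>f x \<theta> - f x \<theta>'\<bar> \<le> \<psi> x * norm (\<theta> - \<theta>')" if "x \<in> space N" "\<theta> \<in> \<Theta>" "\<theta>' \<in> \<Theta>" for x \<theta> \<theta>'
    using assms that by (simp add: lipschitz_family_def)
  have 5: "\<psi> \<in> borel_measurable N" "integrable P (\<lambda>x. (\<psi> x)\<^sup>2)"
    using assms by (simp_all add: lipschitz_family_def)
  show "\<theta> \<in> \<Theta> \<Longrightarrow> (\<lambda>x. f x \<theta>) \<in> borel_measurable N"
    "x \<in> space N \<Longrightarrow> \<theta> \<in> \<Theta> \<Longrightarrow> \<bar>f x \<theta>\<bar> \<le> C" "x \<in> space N \<Longrightarrow> 0 \<le> \<psi> x"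
    "x \<in> space N \<Longrightarrow> \<theta> \<in> \<Theta> \<Longrightarrow> \<theta>' \<in> \<Theta> \<Longrightarrow> \<bar>f x \<theta> - f x \<theta>'\<bar> \<le> \<psi> x * norm (\<theta> - \<theta>')"
    "\<psi> \<in> borel_measurable N" "integrable P (\<lambda>x. (\<psi> x)\<^sup>2)"
    by (fact 1 2 3 4 5)+
  have m: "\<psi> \<in> borel_measurable P" using 5(1) by simp
  show 6: "integrable P \<psi>"
    by (rule P.square_integrable_imp_integrable[OF m 5(2)])
  have 7: "integrable P (\<lambda>x. f x \<theta>)" if "\<theta> \<in> \<Theta>" for \<theta>
    by (rule P.integrable_const_bound[of _ C]) (use 1 2 that in auto)
  then show "\<theta> \<in> \<Theta> \<Longrightarrow> integrable P (\<lambda>x. f x \<theta>)" .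
  show "0 \<le> (\<integral>x. \<psi> x \<partial>P)" by (rule Bochner_Integration.integral_nonneg) (use 3 in auto)
  have ne: "space N \<noteq> {}" using P.not_empty by simp
  show "\<theta> \<in> \<Theta> \<Longrightarrow> 0 \<le> C" using ne 2 by (metis abs_ge_zero equals0I order_trans)
  show "\<bar>(\<integral>x. f x \<theta> \<partial>P) - (\<integral>x. f x \<theta>' \<partial>P)\<bar> \<le> (\<integral>x. \<psi> x \<partial>P) * norm (\<theta> - \<theta>')" if "\<theta> \<in> \<Theta>" "\<theta>' \<in> \<Theta>"
  proof -
    have "\<bar>(\<integral>x. f x \<theta> \<partial>P) - (\<integral>x. f x \<theta>' \<partial>P)\<bar> = \<bar>\<integral>x. f x \<theta> - f x \<theta>' \<partial>P\<bar>" using 7 that by simp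
    also have "\<dots> \<le> (\<integral>x. \<bar>f x \<theta> - f x \<theta>'\<bar> \<partial>P)" by (rule integral_abs_bound)
    also have "\<dots> \<le> (\<integral>x. \<psi> x * norm (\<theta> - \<theta>') \<partial>P)"
      by (rule integral_mono) (use 4 6 7 that in auto)
    finally show ?thesis by simp
  qed
  show "\<bar>\<integral>x. f x \<theta> \<partial>P\<bar> \<le> C" if "\<theta> \<in> \<Theta>"
    by (rule P.abs_expectation_le) (use 1 2 that in auto)
qed

text \<open>Continuity of a single path for fixed \<open>n\<close>. The constant depends on \<omega>
  and \<open>n\<close>, hence gives nothing uniform; it justifies passing to the limit along the
  nets at the end of the chaining.\<close>

lemma emp_process_lipschitz:
  assumes f: "lipschitz_family f \<Theta> C \<psi>" and \<omega>: "\<omega> \<in> space M"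
  obtains L where "\<And>\<theta> \<theta>'. \<theta> \<in> \<Theta> \<Longrightarrow> \<theta>' \<in> \<Theta> \<Longrightarrow> \<bar>emp_process f n \<theta> \<omega> - emp_process f n \<theta>' \<omega>\<bar> \<le> L * norm (\<theta> - \<theta>')"
proof
  note f = lipschitz_familyD[OF f]
  fix \<theta> \<theta>' assume t: "\<theta> \<in> \<Theta>" "\<theta>' \<in> \<Theta>"
  have "emp_process f n \<theta> \<omega> - emp_process f n \<theta>' \<omega>
      = (\<Sum>i=1..n. (f (X i \<omega>) \<theta> - f (X i \<omega>) \<theta>') - ((\<integral>x. f x \<theta> \<partial>P) - (\<integral>x. f x \<theta>' \<partial>P))) / sqrt n"
    by (simp add: emp_process_def diff_divide_distrib[symmetric] sum_subtractf[symmetric] algebra_simps)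
  also have "\<bar>\<dots>\<bar> = \<bar>\<Sum>i=1..n. (f (X i \<omega>) \<theta> - f (X i \<omega>) \<theta>') - ((\<integral>x. f x \<theta> \<partial>P) - (\<integral>x. f x \<theta>' \<partial>P))\<bar> / sqrt n"
    by simp
  also have "\<dots> \<le> (\<Sum>i=1..n. (\<psi> (X i \<omega>) + (\<integral>x. \<psi> x \<partial>P)) * norm (\<theta> - \<theta>')) / sqrt n"
  proof (intro divide_right_mono order_trans[OF sum_abs] sum_mono)
    fix i assume "i \<in> {1..n}"
    then have "\<bar>f (X i \<omega>) \<theta> - f (X i \<omega>) \<theta>'\<bar> \<le> \<psi> (X i \<omega>) * norm (\<theta> - \<theta>')"
      using f(4) t X_space[OF _ \<omega>] by auto
    with f(11)[OF t] show "\<bar>(f (X i \<omega>) \<theta> - f (X i \<omega>) \<theta>') - ((\<integral>x. f x \<theta> \<partial>P) - (\<integral>x. f x \<theta>' \<partial>P))\<bar> \<le> (\<psi> (X i \<omega>) + (\<integral>x. \<psi> x \<partial>P)) * norm (\<theta> - \<theta>')"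
      by (simp add: distrib_right)
  qed simp
  also have "\<dots> = (\<Sum>i=1..n. \<psi> (X i \<omega>) + (\<integral>x. \<psi> x \<partial>P)) / sqrt n * norm (\<theta> - \<theta>')"
    by (simp add: sum_distrib_right[symmetric])
  finally show "\<bar>emp_process f n \<theta> \<omega> - emp_process f n \<theta>' \<omega>\<bar> \<le> (\<Sum>i=1..n. \<psi> (X i \<omega>) + (\<integral>x. \<psi> x \<partial>P)) / sqrt n * norm (\<theta> - \<theta>')" .
qed

text \<open>The difference is telescoped along the nets of all levels j \<ge> J. The level
  \<open>J\<close> is fixed before \<open>n\<close>, so one finite net serves every sample
  size.\<close>

lemma emp_process_chaining:
  fixes \<Theta> :: "(real ^ 'm) set"
  assumes bdd: "bounded \<Theta>" and f: "lipschitz_family f \<Theta> C \<psi>" and \<eta>: "\<eta> > 0"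
  obtains \<pi> where "\<And>\<theta>. \<theta> \<in> \<Theta> \<Longrightarrow> \<pi> \<theta> \<in> \<Theta>" "\<And>\<theta>. \<theta> \<in> \<Theta> \<Longrightarrow> norm (\<pi> \<theta> - \<theta>) \<le> \<eta>" "finite (\<pi> ` \<Theta>)"
    "\<And>n. 1 \<le> n \<Longrightarrow> \<exists>A\<in>events. prob A \<le> \<eta> \<and>
       (\<forall>\<omega>\<in>space M - A. \<forall>\<theta>\<in>\<Theta>. \<bar>emp_process f n \<theta> \<omega> - emp_process f n (\<pi> \<theta>) \<omega>\<bar> \<le> \<eta>)"
proof -
  interpret P: prob_space P by (rule prob_space_P)
  obtain \<pi> c where c: "c \<ge> 1" and pi: "\<And>j \<theta>. \<theta> \<in> \<Theta> \<Longrightarrow> \<pi> j \<theta> \<in> \<Theta>"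
    "\<And>j \<theta>. \<theta> \<in> \<Theta> \<Longrightarrow> norm (\<pi> j \<theta> - \<theta>) \<le> c * (1 / 2) ^ j"
    "\<And>j. finite (\<pi> j ` \<Theta>)" "\<And>j. real (card (\<pi> j ` \<Theta>)) \<le> (c * 2 ^ j) ^ CARD('m)"
    by (rule dyadic_net[OF bdd]) (rule that; assumption)
  note f' = lipschitz_familyD[OF f]
  \<comment> \<open>The links of level \<open>j\<close> number at most a^(2 m) with a = c 2^(j + 1),
    so for k = 2 m + 1 the k-th root is at most \<open>a\<close>. This grows like 2^j, which the
    squared link lengths of order 4^(-j) outweigh.\<close>
  define k where "k = 2 * CARD('m) + 1"
  have k: "1 \<le> k" by (simp add: k_def)
  \<comment> \<open>Envelope of the centred increments: the mean contributes a Lipschitz constant of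
    its own.\<close>
  define \<Psi> where "\<Psi> = (\<lambda>x. \<psi> x + (\<integral>x. \<psi> x \<partial>P))"
  have \<Psi>: "integrable P (\<lambda>x. (\<Psi> x)\<^sup>2)"
    unfolding \<Psi>_def power2_sum using f'(6,7) by auto
  define B where "B = (\<integral>x. (\<Psi> x)\<^sup>2 \<partial>P)"
  have B: "B \<ge> 0" by (simp add: B_def)
  \<comment> \<open>Links are stored as pairs of net points of consecutive levels. Parameters that
    share both points give the same link, which keeps the set finite.\<close>
  define E where "E = (\<lambda>j. (\<lambda>\<theta>. (\<pi> (Suc j) \<theta>, \<pi> j \<theta>)) ` \<Theta>)"
  have Esub: "E j \<subseteq> \<pi> (Suc j) ` \<Theta> \<times> \<pi> j ` \<Theta>" for j by (auto simp: E_def)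
  have Efin: "finite (E j)" for j by (rule finite_subset[OF Esub]) (use pi in auto)
  have Ecard: "real (card (E j)) powr (1 / real k) \<le> c * 2 * 2 ^ j" for j
  proof -
    define a where "a = c * 2 ^ Suc j"
    have "1 * 1 \<le> c * 2 ^ Suc j" by (intro mult_mono one_le_power) (use c in auto)
    then have a: "a \<ge> 1" by (simp add: a_def)
    have "card (E j) \<le> card (\<pi> (Suc j) ` \<Theta>) * card (\<pi> j ` \<Theta>)"
      using card_mono[OF _ Esub] pi(3) by (simp add: card_cartesian_product)
    then have "real (card (E j)) \<le> real (card (\<pi> (Suc j) ` \<Theta>)) * real (card (\<pi> j ` \<Theta>))"
      by (metis of_nat_le_iff of_nat_mult)
    also have "\<dots> \<le> a ^ CARD('m) * a ^ CARD('m)"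
    proof (rule mult_mono)
      have "(c * 2 ^ j) ^ CARD('m) \<le> a ^ CARD('m)" using c by (intro power_mono) (auto simp: a_def)
      then show "real (card (\<pi> j ` \<Theta>)) \<le> a ^ CARD('m)" using pi(4)[of j] by linarith
    qed (use pi(4)[of "Suc j"] a in \<open>auto simp: a_def\<close>)
    also have "\<dots> = a ^ (2 * CARD('m))" by (simp add: power_add[symmetric] mult_2)
    also have "\<dots> \<le> a ^ k" using a by (intro power_increasing) (auto simp: k_def)
    finally have "real (card (E j)) powr (1 / real k) \<le> (a ^ k) powr (1 / real k)" by (intro powr_mono2) auto
    also have "(a ^ k) powr (1 / real k) = a"
      using a k by (simp add: powr_realpow[symmetric] powr_powr)
    finally show ?thesis by (simp add: a_def)
  qed
  define q where "q = (\<lambda>e x. f x (fst e) - f x (snd e) - ((\<integral>x. f x (fst e) \<partial>P) - (\<integral>x. f x (snd e) \<partial>P)))"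
  \<comment> \<open>Bound for the length of a link, c 2^(-j-1) + c 2^(-j), rounded up.\<close>
  define D where "D = (\<lambda>j. 2 * c * (1 / 2) ^ j)"
  have q: "q e \<in> borel_measurable N" "x \<in> space N \<Longrightarrow> \<bar>q e x\<bar> \<le> 4 * C" "(\<integral>x. q e x \<partial>P) = 0"
    "x \<in> space N \<Longrightarrow> \<bar>q e x\<bar> \<le> D j * \<Psi> x" if eE: "e \<in> E j" for e j x
  proof -
    obtain \<theta> where e: "e = (\<pi> (Suc j) \<theta>, \<pi> j \<theta>)" and t: "\<theta> \<in> \<Theta>" using eE by (auto simp: E_def)
    have ab: "fst e \<in> \<Theta>" "snd e \<in> \<Theta>" using pi(1)[OF t] by (auto simp: e)
    have "norm (fst e - snd e) \<le> norm (\<pi> (Suc j) \<theta> - \<theta>) + norm (\<pi> j \<theta> - \<theta>)"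
      using norm_triangle_ineq4[of "\<pi> (Suc j) \<theta> - \<theta>" "\<pi> j \<theta> - \<theta>"] by (simp add: e)
    also have "\<dots> \<le> c * (1 / 2) ^ Suc j + c * (1 / 2) ^ j" by (intro add_mono pi t)
    also have "\<dots> \<le> D j" using c by (simp add: D_def)
    finally have d: "norm (fst e - snd e) \<le> D j" .
    show "q e \<in> borel_measurable N" unfolding q_def using f'(1) ab by auto
    show "(\<integral>x. q e x \<partial>P) = 0" unfolding q_def using f'(8) ab by (simp add: P.prob_space)
    assume x: "x \<in> space N"
    show "\<bar>q e x\<bar> \<le> 4 * C"
      using f'(2)[OF x ab(1)] f'(2)[OF x ab(2)] f'(12)[OF ab(1)] f'(12)[OF ab(2)] by (simp add: q_def)
    have "\<bar>q e x\<bar> \<le> \<Psi> x * norm (fst e - snd e)"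
      using f'(4)[OF x ab] f'(11)[OF ab] by (simp add: q_def \<Psi>_def distrib_right)
    also have "\<dots> \<le> \<Psi> x * D j" using d f'(3)[OF x] f'(9) by (intro mult_left_mono) (auto simp: \<Psi>_def)
    finally show "\<bar>q e x\<bar> \<le> D j * \<Psi> x" by (simp add: mult.commute)
  qed
  \<comment> \<open>The factor 8 c^3 is 2 c from the k-th root of the number of links times (2 c)^2
    from the squared link length.\<close>
  define K where "K = (2 * real k - 1) * (8 * c ^ 3) * B"
  \<comment> \<open>The thresholds (4/5)^j must be summable, and so must 2^j 4^(-j) divided by their
    squares. Any ratio strictly between 1 / sqrt 2 and 1 would do; 4/5 gives the failure
    probabilities the ratio 25/32.\<close>
  define A where "A = (\<lambda>n j. {\<omega>\<in>space M. \<exists>e\<in>E j. \<bar>\<Sum>i=1..n. q e (X i \<omega>)\<bar> > (4 / 5) ^ j * sqrt n})"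
  have A: "A n j \<in> events" "prob (A n j) \<le> K * (25 / 32) ^ j" if n: "1 \<le> n" for n j
  proof -
    have q1: "q e \<in> borel_measurable N" "(\<integral>x. q e x \<partial>P) = 0" if "e \<in> E j" for e
      using q[OF that] by blast+
    have q2: "\<bar>q e x\<bar> \<le> 4 * C" "\<bar>q e x\<bar> \<le> D j * \<Psi> x" if "e \<in> E j" "x \<in> space N" for e x
      using q[OF that(1)] that(2) by blast+
    have "(0::real) < (4 / 5) ^ j" by simp
    note tail = max_sum_tail[where q = q, OF Efin[of j] k n this q1(1) q2(1) q1(2) q2(2) \<Psi>]
    show "A n j \<in> events" using tail(1) by (simp add: A_def)
    have "prob (A n j) \<le> (2 * real k - 1) * real (card (E j)) powr (1 / real k) * (D j)\<^sup>2 * B / ((4 / 5) ^ j)\<^sup>2"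
      using tail(2) by (simp add: A_def B_def)
    also have "\<dots> \<le> (2 * real k - 1) * (c * 2 * 2 ^ j) * (D j)\<^sup>2 * B / ((4 / 5) ^ j)\<^sup>2"
      using k B Ecard by (intro divide_right_mono mult_right_mono mult_left_mono) auto
    also have "\<dots> = K * (2 ^ j * ((1 / 2) ^ j)\<^sup>2 / ((4 / 5) ^ j)\<^sup>2)"
      by (simp add: K_def D_def power_mult_distrib power2_eq_square power3_eq_cube)
    also have "2 ^ j * ((1 / 2) ^ j)\<^sup>2 / ((4 / 5) ^ j)\<^sup>2 = (25 / 32 :: real) ^ j"
    proof -
      have "x ^ j * (y ^ j)\<^sup>2 / (z ^ j)\<^sup>2 = (x * y\<^sup>2 / z\<^sup>2) ^ j" for x y z :: real
        by (simp add: power_mult_distrib power_divide mult.commute flip: power_mult)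
      from this[of 2 "1 / 2" "4 / 5"] show ?thesis by (simp add: power2_eq_square)
    qed
    finally show "prob (A n j) \<le> K * (25 / 32) ^ j" .
  qed
  have "(\<lambda>j. c * (1 / 2 :: real) ^ j) \<longlonglongrightarrow> c * 0" "(\<lambda>j. (4 / 5 :: real) ^ j * 5) \<longlonglongrightarrow> 0 * 5"
    "(\<lambda>j. K * (25 / 32 :: real) ^ j * (32 / 7)) \<longlonglongrightarrow> K * 0 * (32 / 7)"
    by (intro tendsto_intros LIMSEQ_power_zero; simp)+
  then have "\<forall>\<^sub>F j in sequentially. c * (1 / 2) ^ j < \<eta> \<and> (4 / 5) ^ j * 5 < \<eta> \<and> K * (25 / 32) ^ j * (32 / 7) < \<eta>"
    using \<eta> by (intro eventually_conj order_tendstoD) auto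
  \<comment> \<open>\<open>J\<close> makes three things small at once: the mesh, the sum 5 (4/5)^J
    of the thresholds from level \<open>J\<close> on, and the total failure probability, where 32/7
    = 1 / (1 - 25/32).\<close>
  then obtain J where J: "c * (1 / 2) ^ J < \<eta>" "(4 / 5) ^ J * 5 < \<eta>" "K * (25 / 32) ^ J * (32 / 7) < \<eta>"
    by (auto simp: eventually_sequentially)
  show ?thesis
  proof (rule that[of "\<pi> J"])
    show "norm (\<pi> J \<theta> - \<theta>) \<le> \<eta>" if "\<theta> \<in> \<Theta>" for \<theta> using pi(2)[OF that, of J] J(1) by linarith
    fix n :: nat assume n: "1 \<le> n"
    define U where "U = (\<Union>i. A n (J + i))"
    have U: "U \<in> events" unfolding U_def using A(1)[OF n] by blast
    have gs: "(\<lambda>i. K * (25 / 32) ^ (J + i)) sums (K * (25 / 32) ^ J * (32 / 7))"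
      using sums_mult[OF geometric_sums[of "25/32 :: real"], of "K * (25 / 32) ^ J"] by (simp add: power_add mult.assoc)
    have sm: "summable (\<lambda>i. prob (A n (J + i)))"
      by (rule summable_comparison_test'[OF sums_summable[OF gs], of 0]) (use A(2)[OF n] in auto)
    have "prob U \<le> (\<Sum>i. prob (A n (J + i)))"
      unfolding U_def using A(1)[OF n] sm by (intro finite_measure_subadditive_countably) auto
    also have "\<dots> \<le> (\<Sum>i. K * (25 / 32) ^ (J + i))"
      by (intro suminf_le sm sums_summable[OF gs] A(2) n)
    also have "\<dots> = K * (25 / 32) ^ J * (32 / 7)" using gs by (simp add: sums_iff)
    finally have PU: "prob U \<le> \<eta>" using J(3) by linarith
    have "\<bar>emp_process f n \<theta> \<omega> - emp_process f n (\<pi> J \<theta>) \<omega>\<bar> \<le> \<eta>" if w: "\<omega> \<in> space M - U" and t: "\<theta> \<in> \<Theta>" for \<omega> \<theta>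
    proof -
      let ?G = "\<lambda>\<theta>. emp_process f n \<theta> \<omega>"
      have step: "\<bar>?G (\<pi> (Suc j) \<theta>) - ?G (\<pi> j \<theta>)\<bar> \<le> (4 / 5) ^ j" if "J \<le> j" for j
      proof -
        let ?e = "(\<pi> (Suc j) \<theta>, \<pi> j \<theta>)"
        have "\<omega> \<notin> A n (J + (j - J))" using w by (auto simp: U_def)
        then have "\<omega> \<notin> A n j" using that by simp
        then have "\<bar>\<Sum>i=1..n. q ?e (X i \<omega>)\<bar> \<le> (4 / 5) ^ j * sqrt n"
          using w t by (auto simp: A_def E_def not_less)
        then have "\<bar>(\<Sum>i=1..n. q ?e (X i \<omega>)) / sqrt n\<bar> \<le> (4 / 5) ^ j"
          using n by (simp add: pos_divide_le_eq)
        also have "(\<Sum>i=1..n. q ?e (X i \<omega>)) / sqrt n = ?G (\<pi> (Suc j) \<theta>) - ?G (\<pi> j \<theta>)"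
          by (simp add: emp_process_def q_def diff_divide_distrib[symmetric] sum_subtractf[symmetric] algebra_simps)
        finally show ?thesis .
      qed
      \<comment> \<open>Partial sums of the geometric series of thresholds in closed form, so that
        the induction closes.\<close>
      have part: "\<bar>?G (\<pi> (J + r) \<theta>) - ?G (\<pi> J \<theta>)\<bar> \<le> 5 * (4 / 5) ^ J - 5 * (4 / 5) ^ (J + r)" for r
      proof (induction r)
        case (Suc r)
        then show ?case using step[of "J + r"] by simp
      qed simp
      obtain L where L: "\<And>\<theta> \<theta>'. \<theta> \<in> \<Theta> \<Longrightarrow> \<theta>' \<in> \<Theta> \<Longrightarrow> \<bar>?G \<theta> - ?G \<theta>'\<bar> \<le> L * norm (\<theta> - \<theta>')"
        using emp_process_lipschitz[OF f, of \<omega> n] w by blast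
      \<comment> \<open>The chain ends at \<theta> itself because the path is Lipschitz and the nets
        become arbitrarily fine.\<close>
      have "(\<lambda>r. ?G (\<pi> (J + r) \<theta>)) \<longlonglongrightarrow> ?G \<theta>"
      proof (rule LIM_zero_cancel, rule Lim_null_comparison)
        have "norm (?G (\<pi> (J + r) \<theta>) - ?G \<theta>) \<le> \<bar>L\<bar> * (c * (1 / 2) ^ (J + r))" for r
        proof -
          have "norm (?G (\<pi> (J + r) \<theta>) - ?G \<theta>) \<le> L * norm (\<pi> (J + r) \<theta> - \<theta>)" using L pi(1) t by simp
          also have "\<dots> \<le> \<bar>L\<bar> * norm (\<pi> (J + r) \<theta> - \<theta>)" by (intro mult_right_mono) auto
          also have "\<dots> \<le> \<bar>L\<bar> * (c * (1 / 2) ^ (J + r))" by (intro mult_left_mono pi t) auto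
          finally show ?thesis .
        qed
        then show "\<forall>\<^sub>F r in sequentially. norm (?G (\<pi> (J + r) \<theta>) - ?G \<theta>) \<le> \<bar>L\<bar> * (c * (1 / 2) ^ (J + r))" by simp
        have "(\<lambda>r. \<bar>L\<bar> * (c * ((1 / 2) ^ J * (1 / 2) ^ r))) \<longlonglongrightarrow> \<bar>L\<bar> * (c * ((1 / 2) ^ J * 0))"
          by (intro tendsto_intros LIMSEQ_power_zero) simp
        then show "(\<lambda>r. \<bar>L\<bar> * (c * (1 / 2) ^ (J + r))) \<longlonglongrightarrow> 0" by (simp add: power_add)
      qed
      then have "(\<lambda>r. \<bar>?G (\<pi> (J + r) \<theta>) - ?G (\<pi> J \<theta>)\<bar>) \<longlonglongrightarrow> \<bar>?G \<theta> - ?G (\<pi> J \<theta>)\<bar>"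
        by (intro tendsto_intros)
      then show ?thesis
      proof (rule LIMSEQ_le_const2, intro exI allI impI)
        fix r :: nat
        have "0 \<le> 5 * (4 / 5 :: real) ^ (J + r)" by simp
        then show "\<bar>?G (\<pi> (J + r) \<theta>) - ?G (\<pi> J \<theta>)\<bar> \<le> \<eta>" using part[of r] J(2) by linarith
      qed
    qed
    then show "\<exists>A\<in>events. prob A \<le> \<eta> \<and>
       (\<forall>\<omega>\<in>space M - A. \<forall>\<theta>\<in>\<Theta>. \<bar>emp_process f n \<theta> \<omega> - emp_process f n (\<pi> J \<theta>) \<omega>\<bar> \<le> \<eta>)"
      using U PU by blast
  qed (use pi in auto)
qed

text \<open>For a fixed finite set no saving in the cardinality is required, so the maximal
  inequality is used with k = 1 and constant envelope 2 C: Chebyshev's inequality with a union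
  bound.\<close>

lemma emp_process_finite_tail:
  assumes T: "finite T" and f: "\<And>t. t \<in> T \<Longrightarrow> (\<lambda>x. f x t) \<in> borel_measurable N"
      "\<And>t x. t \<in> T \<Longrightarrow> x \<in> space N \<Longrightarrow> \<bar>f x t\<bar> \<le> C"
    and n: "1 \<le> n" and K: "K > 0"
  defines "A \<equiv> {\<omega>\<in>space M. \<exists>t\<in>T. \<bar>emp_process f n t \<omega>\<bar> > K}"
  shows "A \<in> events" "prob A \<le> real (card T) * (2 * C)\<^sup>2 / K\<^sup>2"
proof -
  interpret P: prob_space P by (rule prob_space_P)
  define q where "q = (\<lambda>t x. f x t - (\<integral>x. f x t \<partial>P))"
  have q: "q t \<in> borel_measurable N" "x \<in> space N \<Longrightarrow> \<bar>q t x\<bar> \<le> 2 * C" "(\<integral>x. q t x \<partial>P) = 0"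
    "x \<in> space N \<Longrightarrow> \<bar>q t x\<bar> \<le> 1 * (2 * C)" if t: "t \<in> T" for t x
  proof -
    have m: "(\<lambda>x. f x t) \<in> borel_measurable P" and b: "AE x in P. \<bar>f x t\<bar> \<le> C" using f t by auto
    have "integrable P (\<lambda>x. f x t)" by (rule P.integrable_const_bound[of _ C]) (use m b in auto)
    then show "(\<integral>x. q t x \<partial>P) = 0" unfolding q_def by simp
    show "q t \<in> borel_measurable N" unfolding q_def using f(1)[OF t] by auto
    assume "x \<in> space N"
    then show "\<bar>q t x\<bar> \<le> 2 * C" "\<bar>q t x\<bar> \<le> 1 * (2 * C)"
      using f(2)[OF t, of x] P.abs_expectation_le[OF m b] by (simp_all add: q_def)
  qed
  have "integrable P (\<lambda>x. (2 * C)\<^sup>2)" by simp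
  note tail = max_sum_tail[OF T order_refl[of 1] n K q this]
  have eq: "A = {\<omega>\<in>space M. \<exists>e\<in>T. \<bar>\<Sum>i=1..n. q e (X i \<omega>)\<bar> > K * sqrt n}"
    using n by (auto simp: A_def emp_process_def q_def pos_less_divide_eq)
  show "A \<in> events" unfolding eq by (rule tail(1))
  show "prob A \<le> real (card T) * (2 * C)\<^sup>2 / K\<^sup>2" unfolding eq using tail(2) by (simp add: P.prob_space)
qed

text \<open>Chaining at accuracy \<eta> / 2 reduces the supremum to finitely many parameters, for
  which a second-moment bound suffices.\<close>

lemma emp_process_tight:
  fixes \<Theta> :: "(real ^ 'm) set"
  assumes bdd: "bounded \<Theta>" and f: "lipschitz_family f \<Theta> C \<psi>" and \<eta>: "\<eta> > 0"
  obtains K where "K > 0" "\<And>n. 1 \<le> n \<Longrightarrow> \<exists>A\<in>events. prob A \<le> \<eta> \<and>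
       (\<forall>\<omega>\<in>space M - A. \<forall>\<theta>\<in>\<Theta>. \<bar>emp_process f n \<theta> \<omega>\<bar> \<le> K)"
proof -
  have \<eta>2: "\<eta> / 2 > 0" using \<eta> by simp
  obtain \<pi> where pi: "\<And>\<theta>. \<theta> \<in> \<Theta> \<Longrightarrow> \<pi> \<theta> \<in> \<Theta>" "finite (\<pi> ` \<Theta>)"
    and ch: "\<And>n. 1 \<le> n \<Longrightarrow> \<exists>A\<in>events. prob A \<le> \<eta> / 2 \<and>
       (\<forall>\<omega>\<in>space M - A. \<forall>\<theta>\<in>\<Theta>. \<bar>emp_process f n \<theta> \<omega> - emp_process f n (\<pi> \<theta>) \<omega>\<bar> \<le> \<eta> / 2)"
    using emp_process_chaining[OF bdd f \<eta>2] by metis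
  let ?T = "\<pi> ` \<Theta>"
  define c where "c = real (card ?T) * (2 * C)\<^sup>2"
  define K where "K = sqrt (2 * c / \<eta>) + 1"
  have c: "c \<ge> 0" by (simp add: c_def)
  have K: "K > 0" using c \<eta> by (simp add: K_def add_nonneg_pos)
  have "2 * c / \<eta> \<le> K\<^sup>2" using c \<eta> by (simp add: K_def power2_sum add_increasing2)
  then have cK: "c / K\<^sup>2 \<le> \<eta> / 2" using \<eta> K by (simp add: field_simps)
  show ?thesis
  proof (rule that[of "K + \<eta> / 2"])
    fix n :: nat assume n: "1 \<le> n"
    obtain A1 where A1: "A1 \<in> events" "prob A1 \<le> \<eta> / 2"
      "\<forall>\<omega>\<in>space M - A1. \<forall>\<theta>\<in>\<Theta>. \<bar>emp_process f n \<theta> \<omega> - emp_process f n (\<pi> \<theta>) \<omega>\<bar> \<le> \<eta> / 2" using ch[OF n] by blast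
    define A2 where "A2 = {\<omega>\<in>space M. \<exists>t\<in>?T. \<bar>emp_process f n t \<omega>\<bar> > K}"
    have fT: "(\<lambda>x. f x t) \<in> borel_measurable N" "x \<in> space N \<Longrightarrow> \<bar>f x t\<bar> \<le> C" if "t \<in> ?T" for t x
      using lipschitz_familyD(1,2)[OF f] pi(1) that by auto
    have A2: "A2 \<in> events" "prob A2 \<le> \<eta> / 2"
      using emp_process_finite_tail[where f = f, OF pi(2) fT n K] cK by (auto simp: A2_def c_def)
    show "\<exists>A\<in>events. prob A \<le> \<eta> \<and> (\<forall>\<omega>\<in>space M - A. \<forall>\<theta>\<in>\<Theta>. \<bar>emp_process f n \<theta> \<omega>\<bar> \<le> K + \<eta> / 2)"
    proof (intro bexI[of _ "A1 \<union> A2"] conjI ballI)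
      show "prob (A1 \<union> A2) \<le> \<eta>" using measure_Un_le[OF A1(1) A2(1)] A1 A2 by linarith
      fix \<omega> \<theta> assume w: "\<omega> \<in> space M - (A1 \<union> A2)" "\<theta> \<in> \<Theta>"
      then have "\<bar>emp_process f n (\<pi> \<theta>) \<omega>\<bar> \<le> K" by (auto simp: A2_def not_less)
      moreover have "\<bar>emp_process f n \<theta> \<omega> - emp_process f n (\<pi> \<theta>) \<omega>\<bar> \<le> \<eta> / 2" using A1(3) w by auto
      ultimately show "\<bar>emp_process f n \<theta> \<omega>\<bar> \<le> K + \<eta> / 2" by linarith
    qed (use A1 A2 in auto)
  qed (use K \<eta> in auto)
qed

end

section \<open>Finite-dimensional convergence\<close>

text \<open>The phase \<open>b\<close> makes sines and constants special cases. By the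
  product-to-sum formula these functions form an algebra, as the Stone-Weierstrass theorem requires,
  while each summand involves a single linear form of the coordinates, so that the one-dimensional
  central limit theorem determines the limit of its expectation.\<close>

inductive trig_poly :: "'i set \<Rightarrow> (('i \<Rightarrow> real) \<Rightarrow> real) \<Rightarrow> bool" for T where
  cos: "trig_poly T (\<lambda>y. a * cos ((\<Sum>t\<in>T. u t * y t) + b))"
| add: "trig_poly T F \<Longrightarrow> trig_poly T H \<Longrightarrow> trig_poly T (\<lambda>y. F y + H y)"

lemma trig_poly_mult_cos:
  assumes "trig_poly T H"
  shows "trig_poly T (\<lambda>y. a * cos ((\<Sum>t\<in>T. u t * y t) + b) * H y)"
  using assms
proof induction
  case (cos a' u' b')
  have "a * cos ((\<Sum>t\<in>T. u t * y t) + b) * (a' * cos ((\<Sum>t\<in>T. u' t * y t) + b'))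
      = a * a' / 2 * cos ((\<Sum>t\<in>T. (u t - u' t) * y t) + (b - b'))
        + a * a' / 2 * cos ((\<Sum>t\<in>T. (u t + u' t) * y t) + (b + b'))" for y
  proof -
    have "a * cos v * (a' * cos w) = a * a' / 2 * cos (v - w) + a * a' / 2 * cos (v + w)" for v w
      by (simp add: cos_add cos_diff algebra_simps)
    from this[of "(\<Sum>t\<in>T. u t * y t) + b" "(\<Sum>t\<in>T. u' t * y t) + b'"] show ?thesis
      by (simp add: left_diff_distrib distrib_right sum.distrib sum_subtractf algebra_simps)
  qed
  then show ?case by (simp only:) (intro trig_poly.intros)
next
  case (add F H)
  then show ?case unfolding distrib_left by (intro trig_poly.add)
qed

lemma trig_poly_mult:
  assumes "trig_poly T F" "trig_poly T H"
  shows "trig_poly T (\<lambda>y. F y * H y)"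
  using assms
proof (induction F)
  case (add F1 F2)
  then show ?case unfolding distrib_right by (intro trig_poly.add)
qed (rule trig_poly_mult_cos)

lemma trig_poly_measurable: "trig_poly T F \<Longrightarrow> (\<And>t. t \<in> T \<Longrightarrow> (\<lambda>\<omega>. Y t \<omega>) \<in> borel_measurable M) \<Longrightarrow> (\<lambda>\<omega>. F (\<lambda>t. Y t \<omega>)) \<in> borel_measurable M"
proof (induction rule: trig_poly.induct)
  case (cos a u b)
  then have "(\<lambda>\<omega>. \<Sum>t\<in>T. u t * Y t \<omega>) \<in> borel_measurable M" by (intro borel_measurable_sum) auto
  then show ?case by measurable
qed auto

text \<open>With \<open>\<tau> x = L * arcsin (sin (x / L))\<close>, the identity on \<open>[-L, L]\<close>, a continuous function of
  \<open>\<tau> (y t)\<close>, \<open>t \<in> T\<close>, is a continuous function on the cube \<open>[-1, 1]\<^sup>T\<close> of the values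
  \<open>sin (y t / L)\<close>; a polynomial in these is a trigonometric polynomial in \<open>y\<close>, and its bound on
  the cube holds for all \<open>y\<close>.\<close>

lemma trig_poly_approx:
  fixes h :: "('i :: countable \<Rightarrow> real) \<Rightarrow> real"
  assumes h: "continuous_on UNIV h" "\<And>y. \<bar>h y\<bar> \<le> B" and T: "finite T" and e: "0 < e" and L: "0 < L"
  obtains F where "trig_poly T F" "\<And>y. \<bar>F y\<bar> \<le> B + e"
    "\<And>y. (\<forall>t\<in>T. \<bar>y t\<bar> \<le> L) \<Longrightarrow> (\<forall>t. t \<notin> T \<longrightarrow> y t = 0) \<Longrightarrow> \<bar>h y - F y\<bar> \<le> e"
proof -
  \<comment> \<open>The cube has a coordinate for every index, not just for those in
    \<open>T\<close>, because \<open>h\<close> is a function on the whole product; the surplus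
    coordinates are held at 0 below.\<close>
  define K where "K = {x :: 'i \<Rightarrow> real. \<forall>t. x t \<in> {-1..1}}"
  \<comment> \<open>Not the trigonometric polynomials themselves, but the functions on the cube that
    become such when the values sin (y t / L) are inserted. They contain the coordinates and hence
    separate points.\<close>
  define R where "R = {p. continuous_on K p \<and> trig_poly T (\<lambda>y. p (\<lambda>t. if t \<in> T then sin (y t / L) else 0))}"
  have const: "trig_poly T (\<lambda>_. c)" for c using trig_poly.cos[of T c "\<lambda>_. 0" 0] by simp
  have K: "compact K"
  proof -
    have "compactin (product_topology (\<lambda>_::'i. euclidean) UNIV) (PiE UNIV (\<lambda>_. {-1..1::real}))"
      unfolding compactin_PiE by simp
    moreover have "PiE UNIV (\<lambda>_. {-1..1::real}) = K" by (auto simp: K_def PiE_UNIV_domain)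
    ultimately show ?thesis by (simp add: euclidean_product_topology)
  qed
  have coord: "(\<lambda>x. x t) \<in> R" for t
  proof -
    have "trig_poly T (\<lambda>y. if t \<in> T then sin (y t / L) else 0)"
    proof (cases "t \<in> T")
      case True
      have "sin (y t / L) = 1 * cos ((\<Sum>s\<in>T. (if s = t then 1 / L else 0) * y s) + - (pi / 2))" for y :: "'i \<Rightarrow> real"
        using T True by (simp add: if_distrib[of "\<lambda>z. z * _"] cong: if_cong) (simp add: cos_diff)
      then show ?thesis using True by (simp only: if_True) (rule trig_poly.cos)
    qed (simp add: const)
    then show ?thesis unfolding R_def by (auto intro: continuous_on_product_then_coordinatewise[OF continuous_on_id])
  qed
  interpret function_ring_on R K
  proof
    fix x y :: "'i \<Rightarrow> real" assume "x \<noteq> y"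
    then obtain t where "x t \<noteq> y t" by auto
    then show "\<exists>f\<in>R. f x \<noteq> f y" using coord[of t] by (intro bexI[of _ "\<lambda>x. x t"])
  qed (auto simp: R_def K const intro: trig_poly.add trig_poly_mult continuous_intros)
  define H where "H = (\<lambda>s. h (\<lambda>t. L * arcsin (s t)))"
  have "continuous_on K H" unfolding H_def
  proof (rule continuous_on_compose2[OF h(1)])
    show "continuous_on K (\<lambda>s t. L * arcsin (s t))"
      by (intro continuous_on_coordinatewise_then_product continuous_intros
          continuous_on_product_then_coordinatewise[OF continuous_on_id]) (auto simp: K_def)
  qed simp
  then obtain p where p: "p \<in> R" "\<And>x. x \<in> K \<Longrightarrow> \<bar>H x - p x\<bar> < e"
    using Stone_Weierstrass_basic[OF _ e] by blast
  let ?s = "\<lambda>y t. if t \<in> T then sin (y t / L) else 0"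
  have sK: "?s y \<in> K" for y by (auto simp: K_def)
  show ?thesis
  proof (rule that[of "\<lambda>y. p (?s y)"])
    show "trig_poly T (\<lambda>y. p (?s y))" using p(1) by (simp add: R_def)
    show "\<bar>p (?s y)\<bar> \<le> B + e" for y
      using p(2)[OF sK[of y]] h(2)[of "\<lambda>t. L * arcsin (?s y t)"] unfolding H_def by linarith
    fix y assume y: "\<forall>t\<in>T. \<bar>y t\<bar> \<le> L" "\<forall>t. t \<notin> T \<longrightarrow> y t = 0"
    have "L * arcsin (?s y t) = y t" for t
    proof (cases "t \<in> T")
      case True
      then have "\<bar>y t / L\<bar> \<le> 1" using y L by simp
      \<comment> \<open>Since 1 \<le> pi / 2, the bound |y t| \<le> L places y t / L where
        \<open>arcsin\<close> inverts \<open>sin\<close>.\<close>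
      then have "- (pi / 2) \<le> y t / L" "y t / L \<le> pi / 2" using pi_ge_two by linarith+
      then show ?thesis using True L by (simp add: arcsin_sin)
    qed (use y in simp)
    then have "H (?s y) = h y" by (simp add: H_def)
    then show "\<bar>h y - p (?s y)\<bar> \<le> e" using p(2)[OF sK[of y]] by simp
  qed
qed

text \<open>Convergence for cosines of linear forms extends by linearity to trigonometric
  polynomials. These approximate \<open>h\<close> on a large cube and remain bounded off it, where
  tightness makes the mass small. \<open>ext\<close> pads with 0 outside \<open>T\<close> so that
  \<open>h\<close> can be evaluated on the full product; countability of the index type makes the
  padded vectors measurable.\<close>

lemma cos_conv_imp_joint_conv:
  fixes Y :: "nat \<Rightarrow> 'i :: countable \<Rightarrow> 'a \<Rightarrow> real" and Z :: "'i \<Rightarrow> 'b \<Rightarrow> real" and h :: "('i \<Rightarrow> real) \<Rightarrow> real"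
  defines "ext \<equiv> \<lambda>T y t. if t \<in> T then y t else (0::real)"
  assumes M: "prob_space M" and G: "prob_space G" and T: "finite T"
    and Y: "\<And>n t. t \<in> T \<Longrightarrow> Y n t \<in> borel_measurable M" and Z: "\<And>t. t \<in> T \<Longrightarrow> Z t \<in> borel_measurable G"
    and cos: "\<And>u b. (\<lambda>n. \<integral>\<omega>. cos ((\<Sum>t\<in>T. u t * Y n t \<omega>) + b) \<partial>M) \<longlonglongrightarrow> (\<integral>\<omega>. cos ((\<Sum>t\<in>T. u t * Z t \<omega>) + b) \<partial>G)"
    and tight: "\<And>\<eta>. \<eta> > 0 \<Longrightarrow> \<exists>L>0. (\<forall>n\<ge>1. measure M {\<omega>\<in>space M. \<exists>t\<in>T. \<bar>Y n t \<omega>\<bar> > L} \<le> \<eta>) \<and>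
        measure G {\<omega>\<in>space G. \<exists>t\<in>T. \<bar>Z t \<omega>\<bar> > L} \<le> \<eta>"
    and h: "continuous_on UNIV h" "\<And>y. \<bar>h y\<bar> \<le> B"
  shows "(\<lambda>n. \<integral>\<omega>. h (ext T (\<lambda>t. Y n t \<omega>)) \<partial>M) \<longlonglongrightarrow> (\<integral>\<omega>. h (ext T (\<lambda>t. Z t \<omega>)) \<partial>G)"
proof -
  interpret M: prob_space M by fact
  interpret G: prob_space G by fact
  have hm: "(\<lambda>\<omega>. h (ext T (\<lambda>t. W t \<omega>))) \<in> borel_measurable Q"
    if W: "\<And>t. t \<in> T \<Longrightarrow> W t \<in> borel_measurable Q" for W and Q :: "'c measure"
  proof (rule measurable_compose[OF _ borel_measurable_continuous_onI[OF h(1)]])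
    show "(\<lambda>\<omega>. ext T (\<lambda>t. W t \<omega>)) \<in> borel_measurable Q"
    proof (rule measurable_coordinatewise_then_product)
      show "(\<lambda>\<omega>. ext T (\<lambda>t. W t \<omega>) i) \<in> borel_measurable Q" for i
        using W by (cases "i \<in> T") (auto simp: ext_def)
    qed
  qed
  have trigm: "trig_poly T F \<Longrightarrow> F (ext T y) = F y" for F y
    by (induction rule: trig_poly.induct) (auto simp: ext_def intro!: arg_cong[of _ _ "\<lambda>z. _ * cos (z + _)"] sum.cong)
  have trigb: "trig_poly T F \<Longrightarrow> \<exists>c. \<forall>y. \<bar>F y\<bar> \<le> c" for F
  proof (induction rule: trig_poly.induct)
    case (cos a u b)
    have "\<bar>a * cos x\<bar> \<le> \<bar>a\<bar>" for x by (simp add: abs_mult mult_left_le)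
    then show ?case by blast
  next
    case (add F H)
    then obtain c d where "\<forall>y. \<bar>F y\<bar> \<le> c" "\<forall>y. \<bar>H y\<bar> \<le> d" by blast
    then have "\<forall>y. \<bar>F y + H y\<bar> \<le> c + d" by (meson abs_triangle_ineq add_mono order_trans)
    then show ?case by blast
  qed
  have trigi: "integrable M (\<lambda>\<omega>. F (\<lambda>t. Y n t \<omega>))" "integrable G (\<lambda>\<omega>. F (\<lambda>t. Z t \<omega>))" if F: "trig_poly T F" for F n
  proof -
    obtain c where "\<forall>y. \<bar>F y\<bar> \<le> c" using trigb[OF F] by blast
    then show "integrable M (\<lambda>\<omega>. F (\<lambda>t. Y n t \<omega>))" "integrable G (\<lambda>\<omega>. F (\<lambda>t. Z t \<omega>))"
      using trig_poly_measurable[OF F, of "Y n" M] trig_poly_measurable[OF F, of Z G] Y Z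
      by (auto intro!: M.integrable_const_bound[of _ c] G.integrable_const_bound[of _ c])
  qed
  have trigc: "trig_poly T F \<Longrightarrow> (\<lambda>n. \<integral>\<omega>. F (\<lambda>t. Y n t \<omega>) \<partial>M) \<longlonglongrightarrow> (\<integral>\<omega>. F (\<lambda>t. Z t \<omega>) \<partial>G)" for F
  proof (induction rule: trig_poly.induct)
    case (cos a u b)
    show ?case using tendsto_mult_left[OF assms(7), of a u b] by simp
  next
    case (add F H)
    then show ?case using trigi by (simp add: tendsto_add)
  qed
  show ?thesis
  proof (rule LIMSEQ_I)
    fix r :: real assume r: "r > 0"
    have B: "B \<ge> 0" using h(2)[of undefined] by linarith
    \<comment> \<open>Two approximations and one limit total (4 B + 5) e < 8 (B + 1) e \<le> r. The
      cap 1 turns the bound 2 B + e off the cube into 2 B + 1.\<close>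
    define e where "e = min 1 (r / (8 * (B + 1)))"
    have e: "0 < e" "e \<le> 1" "8 * (B + 1) * e \<le> r"
    proof -
      show "0 < e" "e \<le> 1" using r B by (auto simp: e_def)
      have "e \<le> r / (8 * (B + 1))" by (simp add: e_def)
      then show "8 * (B + 1) * e \<le> r" using B by (simp add: pos_le_divide_eq mult.commute)
    qed
    obtain L where L: "L > 0" and LY: "\<And>n. n \<ge> 1 \<Longrightarrow> measure M {\<omega>\<in>space M. \<exists>t\<in>T. \<bar>Y n t \<omega>\<bar> > L} \<le> e"
      and LZ: "measure G {\<omega>\<in>space G. \<exists>t\<in>T. \<bar>Z t \<omega>\<bar> > L} \<le> e" using tight[OF e(1)] by blast
    obtain F where F: "trig_poly T F" "\<And>y. \<bar>F y\<bar> \<le> B + e"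
      "\<And>y. (\<forall>t\<in>T. \<bar>y t\<bar> \<le> L) \<Longrightarrow> (\<forall>t. t \<notin> T \<longrightarrow> y t = 0) \<Longrightarrow> \<bar>h y - F y\<bar> \<le> e"
      using trig_poly_approx[OF h T e(1) L] by blast
    \<comment> \<open>Stated for an arbitrary probability space because it is applied both to the
      sequence on \<open>M\<close> and to the limit on \<open>G\<close>.\<close>
    have gen: "\<bar>(\<integral>\<omega>. h (ext T (\<lambda>t. W t \<omega>)) \<partial>Q) - (\<integral>\<omega>. F (\<lambda>t. W t \<omega>) \<partial>Q)\<bar> \<le> e + (2 * B + 1) * e"
      if Q: "prob_space Q" and W: "\<And>t. t \<in> T \<Longrightarrow> W t \<in> borel_measurable Q"
        and FW: "integrable Q (\<lambda>\<omega>. F (\<lambda>t. W t \<omega>))"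
        and small: "measure Q {\<omega>\<in>space Q. \<exists>t\<in>T. \<bar>W t \<omega>\<bar> > L} \<le> e" for Q :: "'c measure" and W
    proof -
      interpret Q: prob_space Q by fact
      let ?A = "{\<omega>\<in>space Q. \<exists>t\<in>T. \<bar>W t \<omega>\<bar> > L}"
      have A: "?A \<in> sets Q" using W T by measurable
      have hi: "integrable Q (\<lambda>\<omega>. h (ext T (\<lambda>t. W t \<omega>)))" by (rule Q.integrable_const_bound[of _ B]) (use h hm W in auto)
      have "\<bar>(\<integral>\<omega>. h (ext T (\<lambda>t. W t \<omega>)) \<partial>Q) - (\<integral>\<omega>. F (\<lambda>t. W t \<omega>) \<partial>Q)\<bar>
          = \<bar>\<integral>\<omega>. h (ext T (\<lambda>t. W t \<omega>)) - F (\<lambda>t. W t \<omega>) \<partial>Q\<bar>" using hi FW by simp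
      also have "\<dots> \<le> (\<integral>\<omega>. \<bar>h (ext T (\<lambda>t. W t \<omega>)) - F (\<lambda>t. W t \<omega>)\<bar> \<partial>Q)" by (rule integral_abs_bound)
      also have "\<dots> \<le> (\<integral>\<omega>. e + (2 * B + 1) * indicator ?A \<omega> \<partial>Q)"
      proof (rule integral_mono)
        show "integrable Q (\<lambda>\<omega>. \<bar>h (ext T (\<lambda>t. W t \<omega>)) - F (\<lambda>t. W t \<omega>)\<bar>)" using hi FW by auto
        show "integrable Q (\<lambda>\<omega>. e + (2 * B + 1) * indicator ?A \<omega>)" using A by (auto simp: less_top[symmetric])
        fix \<omega> assume w: "\<omega> \<in> space Q"
        show "\<bar>h (ext T (\<lambda>t. W t \<omega>)) - F (\<lambda>t. W t \<omega>)\<bar> \<le> e + (2 * B + 1) * indicator ?A \<omega>"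
        proof (cases "\<omega> \<in> ?A")
          case True
          have "\<bar>h (ext T (\<lambda>t. W t \<omega>))\<bar> \<le> B" "\<bar>F (\<lambda>t. W t \<omega>)\<bar> \<le> B + e" using h(2) F(2) by auto
          then show ?thesis using True e by simp
        next
          case False
          then have "\<forall>t\<in>T. \<bar>ext T (\<lambda>t. W t \<omega>) t\<bar> \<le> L" using w by (auto simp: ext_def not_less)
          then have "\<bar>h (ext T (\<lambda>t. W t \<omega>)) - F (ext T (\<lambda>t. W t \<omega>))\<bar> \<le> e" by (rule F(3)) (simp add: ext_def)
          then show ?thesis using False by (simp add: trigm[OF F(1)])
        qed
      qed
      also have "\<dots> = e + (2 * B + 1) * measure Q ?A" using A by (simp add: Q.prob_space less_top[symmetric])
      also have "\<dots> \<le> e + (2 * B + 1) * e" using small B by (intro add_mono mult_left_mono) auto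
      finally show ?thesis .
    qed
    have "\<forall>\<^sub>F n in sequentially. \<bar>(\<integral>\<omega>. F (\<lambda>t. Y n t \<omega>) \<partial>M) - (\<integral>\<omega>. F (\<lambda>t. Z t \<omega>) \<partial>G)\<bar> < e"
      using tendstoD[OF trigc[OF F(1)] e(1)] by (simp add: dist_real_def)
    then obtain n0 where n0: "\<And>n. n \<ge> n0 \<Longrightarrow> \<bar>(\<integral>\<omega>. F (\<lambda>t. Y n t \<omega>) \<partial>M) - (\<integral>\<omega>. F (\<lambda>t. Z t \<omega>) \<partial>G)\<bar> < e"
      by (auto simp: eventually_sequentially)
    show "\<exists>no. \<forall>n\<ge>no. norm ((\<integral>\<omega>. h (ext T (\<lambda>t. Y n t \<omega>)) \<partial>M) - (\<integral>\<omega>. h (ext T (\<lambda>t. Z t \<omega>)) \<partial>G)) < r"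
    proof (intro exI[of _ "max n0 1"] allI impI)
      fix n assume n: "max n0 1 \<le> n"
      have "\<bar>(\<integral>\<omega>. h (ext T (\<lambda>t. Y n t \<omega>)) \<partial>M) - (\<integral>\<omega>. F (\<lambda>t. Y n t \<omega>) \<partial>M)\<bar> \<le> e + (2 * B + 1) * e"
        using n by (intro gen M Y trigi F LY) auto
      moreover have "\<bar>(\<integral>\<omega>. h (ext T (\<lambda>t. Z t \<omega>)) \<partial>G) - (\<integral>\<omega>. F (\<lambda>t. Z t \<omega>) \<partial>G)\<bar> \<le> e + (2 * B + 1) * e"
        by (intro gen G Z trigi F LZ) auto
      moreover have "2 * (e + (2 * B + 1) * e) + e < r"
      proof -
        have "2 * (e + (2 * B + 1) * e) + e = (4 * B + 5) * e" by (simp add: algebra_simps)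
        also have "\<dots> < (8 * B + 8) * e" using B e by (intro mult_strict_right_mono) auto
        also have "\<dots> \<le> r" using e(3) by (simp add: algebra_simps)
        finally show ?thesis .
      qed
      ultimately show "norm ((\<integral>\<omega>. h (ext T (\<lambda>t. Y n t \<omega>)) \<partial>M) - (\<integral>\<omega>. h (ext T (\<lambda>t. Z t \<omega>)) \<partial>G)) < r"
        proof -
        have "\<bar>a - d\<bar> < r" if "\<bar>a - f\<bar> \<le> c" "\<bar>d - g\<bar> \<le> c" "2 * c + e < r" "\<bar>f - g\<bar> < e" for a d f g c
          using that by linarith
        moreover assume "\<bar>(\<integral>\<omega>. h (ext T (\<lambda>t. Y n t \<omega>)) \<partial>M) - (\<integral>\<omega>. F (\<lambda>t. Y n t \<omega>) \<partial>M)\<bar> \<le> e + (2 * B + 1) * e"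
          "\<bar>(\<integral>\<omega>. h (ext T (\<lambda>t. Z t \<omega>)) \<partial>G) - (\<integral>\<omega>. F (\<lambda>t. Z t \<omega>) \<partial>G)\<bar> \<le> e + (2 * B + 1) * e"
          "2 * (e + (2 * B + 1) * e) + e < r"
        ultimately show ?thesis using n0[of n] n unfolding real_norm_def by (metis max.bounded_iff)
      qed
    qed
  qed
qed

text \<open>Reconciles the sample, indexed from 1, with the central limit theorem, which is stated
  for sequences indexed from 0.\<close>

lemma (in prob_space) indep_vars_Suc:
  assumes "indep_vars M' X {1..}"
  shows "indep_vars (\<lambda>i. M' (Suc i)) (\<lambda>i. X (Suc i)) UNIV"
  unfolding indep_vars_def2
proof (intro conjI ballI)
  show "random_variable (M' (Suc i)) (X (Suc i))" for i using assms by (auto simp: indep_vars_def2)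
  define F where "F = (\<lambda>i. {X i -` A \<inter> space M |A. A \<in> sets (M' i)})"
  have F: "indep_sets F {1..}" using assms by (simp add: indep_vars_def2 F_def)
  show "indep_sets (\<lambda>i. {X (Suc i) -` A \<inter> space M |A. A \<in> sets (M' (Suc i))}) UNIV"
    unfolding indep_sets_def
  proof (intro conjI ballI allI impI)
    show "{X (Suc i) -` A \<inter> space M |A. A \<in> sets (M' (Suc i))} \<subseteq> events" for i
      using F by (auto simp: indep_sets_def F_def)
    fix J :: "nat set" and A
    assume J: "J \<noteq> {}" "finite J" and A: "A \<in> (\<Pi> i\<in>J. {X (Suc i) -` A \<inter> space M |A. A \<in> sets (M' (Suc i))})"
    have "prob (\<Inter>j\<in>Suc ` J. A (j - 1)) = (\<Prod>j\<in>Suc ` J. prob (A (j - 1)))"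
      using J A by (intro indep_setsD[OF F]) (auto simp: F_def Pi_iff)
    then show "prob (\<Inter>j\<in>J. A j) = (\<Prod>j\<in>J. prob (A j))" by (simp add: prod.reindex)
  qed
qed

lemma integral_weak_conv_cos:
  assumes W: "weak_conv_m (\<lambda>n. distr M borel (W n)) \<mu>" and M: "prob_space M" and \<mu>: "real_distribution \<mu>"
    and [measurable]: "\<And>n. W n \<in> borel_measurable M"
  shows "(\<lambda>n. \<integral>\<omega>. cos (s * W n \<omega> + b) \<partial>M) \<longlonglongrightarrow> (\<integral>x. cos (s * x + b) \<partial>\<mu>)"
proof -
  interpret M: prob_space M by fact
  have rd: "real_distribution (distr M borel (W n))" for n by (rule M.real_distribution_distr) simp
  have "(\<lambda>n. \<integral>x. cos (s * x + b) \<partial>distr M borel (W n)) \<longlonglongrightarrow> (\<integral>x. cos (s * x + b) \<partial>\<mu>)"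
    by (rule weak_conv_imp_integral_bdd_continuous_conv[OF rd \<mu> W, of _ 1]) auto
  then show ?thesis by (subst (asm) integral_distr) auto
qed

text \<open>The definition of a Gaussian field fixes distributions and does not mention
  integrability. Since integrals of nonintegrable functions are 0 by convention, second moments of
  linear combinations can be expanded only after this.\<close>

lemma gaussian_rv_square_integrable:
  assumes G: "prob_space G" and U: "gaussian_rv G U"
  shows "integrable G U" "integrable G (\<lambda>\<omega>. (U \<omega>)\<^sup>2)"
proof -
  interpret prob_space G by fact
  have m: "U \<in> borel_measurable G" using U by (simp add: gaussian_rv_def)
  have "integrable G (\<lambda>\<omega>. (U \<omega>)\<^sup>2)"
  proof (cases "\<exists>\<mu> \<sigma>. \<sigma> > 0 \<and> distributed G lborel U (normal_density \<mu> \<sigma>)")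
    case True
    then obtain \<mu> \<sigma> where s: "\<sigma> > 0" and d: "distributed G lborel U (normal_density \<mu> \<sigma>)" by blast
    have "integrable G (\<lambda>\<omega>. (U \<omega> - \<mu>) ^ k)" for k
      using distributed_integrable[OF d, of "\<lambda>x. (x - \<mu>) ^ k"] integrable_normal_moment[OF s, of \<mu> k] by simp
    from this[of 1] this[of 2] have i: "integrable G (\<lambda>\<omega>. U \<omega> - \<mu>)" "integrable G (\<lambda>\<omega>. (U \<omega> - \<mu>)\<^sup>2)" by simp_all
    have "(U \<omega>)\<^sup>2 = (U \<omega> - \<mu>)\<^sup>2 + 2 * \<mu> * (U \<omega> - \<mu>) + \<mu>\<^sup>2" for \<omega> by algebra
    then show ?thesis using i by simp
  next
    case False
    then obtain \<mu> where "distr G borel U = return borel \<mu>" using U by (auto simp: gaussian_rv_def)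
    moreover have "integrable (return borel \<mu>) (\<lambda>x. x\<^sup>2)"
    proof -
      interpret R: prob_space "return borel \<mu>" by (rule prob_space_return) simp
      show ?thesis by (rule R.integrable_const_bound[of _ "\<mu>\<^sup>2"]) (auto simp: AE_return)
    qed
    ultimately have "integrable (distr G borel U) (\<lambda>x. x\<^sup>2)" by simp
    then show ?thesis using m by (subst (asm) integrable_distr_eq) auto
  qed
  then show "integrable G (\<lambda>\<omega>. (U \<omega>)\<^sup>2)" "integrable G U"
    using square_integrable_imp_integrable[OF m] by auto
qed

text \<open>A normal law with mean 0 is determined by its variance, so \<open>U\<close> may be
  replaced by \<open>s\<close> times a standard normal variable. In the degenerate case the point
  mass sits at 0 and s = 0.\<close>

lemma gaussian_rv_cos:
  assumes G: "prob_space G" and U: "gaussian_rv G U" and mean: "(\<integral>\<omega>. U \<omega> \<partial>G) = 0"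
    and var: "(\<integral>\<omega>. (U \<omega>)\<^sup>2 \<partial>G) = s\<^sup>2" and s: "s \<ge> 0"
  shows "(\<integral>\<omega>. cos (U \<omega> + b) \<partial>G) = (\<integral>x. cos (s * x + b) \<partial>std_normal_distribution)"
proof -
  interpret prob_space G by fact
  interpret std: real_distribution std_normal_distribution by (rule real_dist_normal_dist)
  have m: "U \<in> borel_measurable G" using U by (simp add: gaussian_rv_def)
  show ?thesis
  proof (cases "\<exists>\<mu> \<sigma>. \<sigma> > 0 \<and> distributed G lborel U (normal_density \<mu> \<sigma>)")
    case True
    then obtain \<mu> \<sigma> where sg: "\<sigma> > 0" and d: "distributed G lborel U (normal_density \<mu> \<sigma>)" by blast
    have "\<mu> = 0" using normal_distributed_expectation[OF sg d] mean by simp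
    moreover have "\<sigma>\<^sup>2 = s\<^sup>2" using normal_distributed_variance[OF sg d] mean var by simp
    then have "\<sigma> = s" using sg s by (simp add: power2_eq_iff_nonneg)
    ultimately have "distributed G lborel (\<lambda>x. (U x - 0) / s) std_normal_density"
      using normal_standard_normal_convert[OF sg] d by blast
    then have "distr G lborel (\<lambda>x. U x / s) = std_normal_distribution" by (simp add: distributed_def)
    then have "(\<integral>x. cos (s * x + b) \<partial>std_normal_distribution) = (\<integral>x. cos (s * x + b) \<partial>distr G lborel (\<lambda>x. U x / s))" by simp
    also have "\<dots> = (\<integral>\<omega>. cos (s * (U \<omega> / s) + b) \<partial>G)" using m by (intro integral_distr) auto
    finally show ?thesis using sg \<open>\<sigma> = s\<close> by simp
  next
    case False
    then obtain \<mu> where d: "distr G borel U = return borel \<mu>" using U by (auto simp: gaussian_rv_def)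
    have I: "(\<integral>\<omega>. f (U \<omega>) \<partial>G) = f \<mu>" if "f \<in> borel_measurable borel" for f :: "real \<Rightarrow> real"
      using integral_distr[OF m that] that by (simp add: d integral_return)
    have "\<mu> = 0" using I[of "\<lambda>x. x"] mean by simp
    moreover have "s = 0" using I[of "\<lambda>x. x\<^sup>2"] var \<open>\<mu> = 0\<close> by simp
    ultimately show ?thesis using I[of "\<lambda>x. cos (x + b)"] std.prob_space by simp
  qed
qed

context iid_sample
begin

text \<open>The central limit theorem needs positive variance and divides by the standard deviation,
  which is reinserted as the factor of \<open>x\<close>. For zero variance the centred summands
  vanish almost surely and both sides are cos b.\<close>

lemma cos_normalized_sum_conv:
  fixes y :: "'x \<Rightarrow> real"
  assumes y: "y \<in> borel_measurable N" "\<And>x. x \<in> space N \<Longrightarrow> \<bar>y x\<bar> \<le> C"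
  shows "(\<lambda>n. \<integral>\<omega>. cos ((\<Sum>i=1..n. y (X i \<omega>) - (\<integral>x. y x \<partial>P)) / sqrt n + b) \<partial>M)
    \<longlonglongrightarrow> (\<integral>x. cos (sqrt (prob_space.variance P y) * x + b) \<partial>std_normal_distribution)"
proof -
  interpret P: prob_space P by (rule prob_space_P)
  interpret std: real_distribution std_normal_distribution by (rule real_dist_normal_dist)
  define m where "m = (\<integral>x. y x \<partial>P)"
  define s where "s = sqrt (P.variance y)"
  have s0: "s \<ge> 0" by (simp add: s_def P.variance_positive)
  have s2: "s\<^sup>2 = P.variance y" by (simp add: s_def P.variance_positive)
  have [measurable]: "y \<in> borel_measurable N" by fact
  have yi: "integrable P y" by (rule P.integrable_const_bound[of _ C]) (use y in auto)
  have y2: "(y x)\<^sup>2 \<le> C\<^sup>2" if "x \<in> space N" for x using y(2)[OF that] by (metis abs_ge_zero power2_abs power_mono)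
  have yi2: "integrable P (\<lambda>x. (y x)\<^sup>2)" by (rule P.integrable_const_bound[of _ "C\<^sup>2"]) (use y2 in auto)
  have vi: "integrable P (\<lambda>x. (y x - m)\<^sup>2)" unfolding power2_diff using yi yi2 by auto
  have ym: "(\<lambda>\<omega>. y (X i \<omega>)) \<in> borel_measurable M" if "i \<ge> 1" for i
    by (rule measurable_compose[OF X_measurable[OF that]]) simp
  show ?thesis
  proof (cases "s = 0")
    case True
    then have "AE x in P. (y x - m)\<^sup>2 = 0"
      using s2 vi by (subst integral_nonneg_eq_0_iff_AE[symmetric]) (auto simp: m_def)
    then have "AE x in P. y x - m = 0" by simp
    then have ae: "AE \<omega> in M. \<forall>i\<ge>1. y (X i \<omega>) - m = 0" by (rule AE_X)
    have "(\<integral>\<omega>. cos ((\<Sum>i=1..n. y (X i \<omega>) - m) / sqrt n + b) \<partial>M) = (\<integral>\<omega>. cos b \<partial>M)" for n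
    proof (rule integral_cong_AE)
      show "AE \<omega> in M. cos ((\<Sum>i=1..n. y (X i \<omega>) - m) / sqrt n + b) = cos b"
        using ae by (rule eventually_mono) simp
      have "(\<lambda>\<omega>. \<Sum>i=1..n. y (X i \<omega>) - m) \<in> borel_measurable M"
        using ym by (intro borel_measurable_sum borel_measurable_diff) auto
      then show "(\<lambda>\<omega>. cos ((\<Sum>i=1..n. y (X i \<omega>) - m) / sqrt n + b)) \<in> borel_measurable M" by measurable
    qed simp
    then show ?thesis unfolding s_def[symmetric] unfolding m_def[symmetric]
      using True std.prob_space by (simp add: prob_space)
  next
    case False
    then have s: "s > 0" using s0 by simp
    define Y where "Y = (\<lambda>i \<omega>. y (X (Suc i) \<omega>))"
    have dist: "distr M borel (Y i) = distr P borel y" for i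
    proof -
      have "distr M borel (y \<circ> X (Suc i)) = distr (distr M N (X (Suc i))) borel y"
        by (rule distr_distr[symmetric]) auto
      also have "\<dots> = distr P borel y" by (subst ident) auto
      finally show ?thesis by (simp add: Y_def comp_def)
    qed
    have "indep_vars (\<lambda>_. N) (\<lambda>i. X (Suc i)) UNIV" by (rule indep_vars_Suc[OF indep])
    then have ind: "indep_vars (\<lambda>_. borel) Y UNIV"
      unfolding Y_def by (rule indep_vars_compose2) simp
    have mean: "expectation (Y i) = m" for i
      unfolding Y_def m_def using integral_X[of "Suc i" y] by simp
    have var: "variance (Y i) = s\<^sup>2" for i
      unfolding mean unfolding Y_def s2 m_def[symmetric] using integral_X[of "Suc i" "\<lambda>x. (y x - m)\<^sup>2"] by simp
    have sq: "integrable M (\<lambda>\<omega>. (Y i \<omega>)\<^sup>2)" for i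
      unfolding Y_def using integrable_X[of "Suc i" "\<lambda>x. (y x)\<^sup>2"] yi2 by simp
    define W where "W = (\<lambda>n \<omega>. (\<Sum>i<n. Y i \<omega> - m) / sqrt (n * s\<^sup>2))"
    have W: "weak_conv_m (\<lambda>n. distr M borel (W n)) std_normal_distribution"
      unfolding W_def by (rule central_limit_theorem[OF ind mean s sq var dist])
    have Wm: "W n \<in> borel_measurable M" for n
      unfolding W_def Y_def using ym by (intro borel_measurable_divide borel_measurable_sum borel_measurable_diff) auto
    have conv: "(\<lambda>n. \<integral>\<omega>. cos (s * W n \<omega> + b) \<partial>M) \<longlonglongrightarrow> (\<integral>x. cos (s * x + b) \<partial>std_normal_distribution)"
      by (rule integral_weak_conv_cos[OF W prob_space_axioms real_dist_normal_dist Wm])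
    have "s * W n \<omega> = (\<Sum>i=1..n. y (X i \<omega>) - m) / sqrt n" for n \<omega>
    proof -
      have "(\<Sum>i<n. Y i \<omega> - m) = (\<Sum>i=1..n. y (X i \<omega>) - m)"
        unfolding Y_def lessThan_atLeast0 by (subst sum.shift_bounds_Suc_ivl[symmetric]) (simp add: atLeastLessThanSuc_atLeastAtMost)
      then show ?thesis using s by (simp add: W_def real_sqrt_mult)
    qed
    then show ?thesis using conv unfolding s_def[symmetric] unfolding m_def[symmetric] by simp
  qed
qed

text \<open>The Cramer-Wold device: a linear combination of values of the process is again a
  normalized sum, of the function \<open>y\<close> below, and the variance of \<open>y\<close> is
  that of the same combination of the Gaussian field. Parameters are addressed through an injection
  \<open>t\<close> from a countable type, since their own type need not be countable.\<close>

lemma emp_process_joint_conv: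
  fixes f :: "'x \<Rightarrow> 't::topological_space \<Rightarrow> real" and t :: "'i::countable \<Rightarrow> 't" and h :: "('i \<Rightarrow> real) \<Rightarrow> real"
  assumes f: "\<And>\<theta>. \<theta> \<in> \<Theta> \<Longrightarrow> (\<lambda>x. f x \<theta>) \<in> borel_measurable N"
      "\<And>\<theta> x. \<theta> \<in> \<Theta> \<Longrightarrow> x \<in> space N \<Longrightarrow> \<bar>f x \<theta>\<bar> \<le> C"
    and G: "mean_zero_gaussian_field G \<Theta> g (\<lambda>\<theta> \<theta>'. covar P (\<lambda>x. f x \<theta>) (\<lambda>x. f x \<theta>'))"
    and T: "finite T" "inj_on t T" "t ` T \<subseteq> \<Theta>"
    and h: "continuous_on UNIV h" "\<And>y. \<bar>h y\<bar> \<le> B"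
  shows "(\<lambda>n. \<integral>\<omega>. h (\<lambda>i. if i \<in> T then emp_process f n (t i) \<omega> else 0) \<partial>M)
    \<longlonglongrightarrow> (\<integral>\<omega>. h (\<lambda>i. if i \<in> T then g (t i) \<omega> else 0) \<partial>G)"
proof -
  interpret P: prob_space P by (rule prob_space_P)
  have Gp: "prob_space G" using G by (simp add: mean_zero_gaussian_field_def)
  interpret G: prob_space G by fact
  have tT: "t i \<in> \<Theta>" if "i \<in> T" for i using T that by auto
  \<comment> \<open>The definition of the field sums over sets of parameters; injectivity of
    \<open>t\<close> permits sums over indices.\<close>
  have lin: "gaussian_rv G (\<lambda>\<omega>. \<Sum>i\<in>T. u i * g (t i) \<omega>)" for u
  proof -
    have "gaussian_rv G (\<lambda>\<omega>. \<Sum>\<theta>\<in>t ` T. u (the_inv_into T t \<theta>) * g \<theta> \<omega>)"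
      using G T by (simp add: mean_zero_gaussian_field_def)
    then show ?thesis using T by (simp add: sum.reindex the_inv_into_f_f)
  qed
  have one: "gaussian_rv G (g \<theta>)" if "\<theta> \<in> \<Theta>" for \<theta>
  proof -
    have "gaussian_rv G (\<lambda>\<omega>. \<Sum>\<theta>\<in>{\<theta>}. 1 * g \<theta> \<omega>)"
    proof -
      have "\<forall>F c. finite F \<and> F \<subseteq> \<Theta> \<longrightarrow> gaussian_rv G (\<lambda>\<omega>. \<Sum>t\<in>F. c t * g t \<omega>)"
        using G by (simp add: mean_zero_gaussian_field_def)
      from this[rule_format, of "{\<theta>}" "\<lambda>_. 1"] show ?thesis using that by simp
    qed
    then show ?thesis by simp
  qed
  have gm [measurable]: "g \<theta> \<in> borel_measurable G" if "\<theta> \<in> \<Theta>" for \<theta> using one[OF that] by (simp add: gaussian_rv_def)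
  have mean: "(\<integral>\<omega>. g \<theta> \<omega> \<partial>G) = 0" if "\<theta> \<in> \<Theta>" for \<theta> using G that by (simp add: mean_zero_gaussian_field_def)
  have gi: "integrable G (g \<theta>)" "integrable G (\<lambda>\<omega>. (g \<theta> \<omega>)\<^sup>2)" if "\<theta> \<in> \<Theta>" for \<theta>
    using gaussian_rv_square_integrable[OF Gp one[OF that]] by auto
  have gg: "integrable G (\<lambda>\<omega>. g \<theta> \<omega> * g \<theta>' \<omega>)" if "\<theta> \<in> \<Theta>" "\<theta>' \<in> \<Theta>" for \<theta> \<theta>'
  proof (rule Bochner_Integration.integrable_bound[of G "\<lambda>\<omega>. (g \<theta> \<omega>)\<^sup>2 + (g \<theta>' \<omega>)\<^sup>2"])
    have "\<bar>a * b\<bar> \<le> a\<^sup>2 + b\<^sup>2" for a b :: real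
    proof -
      have "2 * \<bar>a * b\<bar> \<le> a\<^sup>2 + b\<^sup>2" using sum_squares_bound[of "\<bar>a\<bar>" "\<bar>b\<bar>"] by (simp add: abs_mult)
      moreover have "0 \<le> \<bar>a * b\<bar>" by simp
      ultimately show ?thesis by linarith
    qed
    then show "AE \<omega> in G. norm (g \<theta> \<omega> * g \<theta>' \<omega>) \<le> norm ((g \<theta> \<omega>)\<^sup>2 + (g \<theta>' \<omega>)\<^sup>2)" by simp
  qed (use gi gm that in auto)
  have cov: "(\<integral>\<omega>. g \<theta> \<omega> * g \<theta>' \<omega> \<partial>G) = covar P (\<lambda>x. f x \<theta>) (\<lambda>x. f x \<theta>')" if "\<theta> \<in> \<Theta>" "\<theta>' \<in> \<Theta>" for \<theta> \<theta>'
  proof -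
    have "covar G (g \<theta>) (g \<theta>') = covar P (\<lambda>x. f x \<theta>) (\<lambda>x. f x \<theta>')" using G that by (simp add: mean_zero_gaussian_field_def)
    then show ?thesis using mean that by (simp add: covar_def)
  qed
  have fi: "integrable P (\<lambda>x. f x \<theta>)" if "\<theta> \<in> \<Theta>" for \<theta>
    by (rule P.integrable_const_bound[of _ C]) (use f that in auto)
  have C: "0 \<le> C" if "\<theta> \<in> \<Theta>" for \<theta>
    using P.not_empty f(2)[OF that] by (metis abs_ge_zero equals0I order_trans space_P)
  define m where "m = (\<lambda>\<theta>. \<integral>x. f x \<theta> \<partial>P)"
  have mC: "\<bar>m \<theta>\<bar> \<le> C" if "\<theta> \<in> \<Theta>" for \<theta>
    unfolding m_def by (rule P.abs_expectation_le) (use f that in auto)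
  have ffi: "integrable P (\<lambda>x. (f x \<theta> - m \<theta>) * (f x \<theta>' - m \<theta>'))" if "\<theta> \<in> \<Theta>" "\<theta>' \<in> \<Theta>" for \<theta> \<theta>'
  proof (rule P.integrable_const_bound[of _ "(2 * C) * (2 * C)"])
    have d: "\<bar>f x \<theta> - m \<theta>\<bar> \<le> 2 * C" if "\<theta> \<in> \<Theta>" "x \<in> space N" for x \<theta>
      using f(2)[OF that] mC[OF that(1)] by linarith
    show "AE x in P. norm ((f x \<theta> - m \<theta>) * (f x \<theta>' - m \<theta>')) \<le> (2 * C) * (2 * C)"
    proof (rule AE_I2)
      fix x assume "x \<in> space P"
      then show "norm ((f x \<theta> - m \<theta>) * (f x \<theta>' - m \<theta>')) \<le> (2 * C) * (2 * C)"
        unfolding real_norm_def abs_mult using that C by (intro mult_mono d) auto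
    qed
    show "(\<lambda>x. (f x \<theta> - m \<theta>) * (f x \<theta>' - m \<theta>')) \<in> borel_measurable P"
      using f(1) that by auto
  qed
  have conv: "(\<lambda>n. \<integral>\<omega>. cos ((\<Sum>i\<in>T. u i * emp_process f n (t i) \<omega>) + b) \<partial>M)
      \<longlonglongrightarrow> (\<integral>\<omega>. cos ((\<Sum>i\<in>T. u i * g (t i) \<omega>) + b) \<partial>G)" for u b
  proof -
    define y where "y = (\<lambda>x. \<Sum>i\<in>T. u i * f x (t i))"
    have ym: "y \<in> borel_measurable N" unfolding y_def using f(1) tT by auto
    have yb: "\<bar>y x\<bar> \<le> (\<Sum>i\<in>T. \<bar>u i\<bar> * C)" if "x \<in> space N" for x
      unfolding y_def using f(2) tT that by (intro order_trans[OF sum_abs] sum_mono) (auto simp: abs_mult intro!: mult_left_mono)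
    have yint: "(\<integral>x. y x \<partial>P) = (\<Sum>i\<in>T. u i * m (t i))" unfolding y_def m_def using fi tT by simp
    have eq: "(\<Sum>i\<in>T. u i * emp_process f n (t i) \<omega>) = (\<Sum>i=1..n. y (X i \<omega>) - (\<integral>x. y x \<partial>P)) / sqrt n" for n \<omega>
    proof -
      have "(\<Sum>i\<in>T. u i * emp_process f n (t i) \<omega>) = (\<Sum>i\<in>T. \<Sum>k=1..n. u i * (f (X k \<omega>) (t i) - m (t i))) / sqrt n"
        by (simp add: emp_process_def sum_divide_distrib sum_distrib_left m_def)
      also have "(\<Sum>i\<in>T. \<Sum>k=1..n. u i * (f (X k \<omega>) (t i) - m (t i))) = (\<Sum>k=1..n. \<Sum>i\<in>T. u i * (f (X k \<omega>) (t i) - m (t i)))"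
        by (rule sum.swap)
      also have "\<dots> = (\<Sum>k=1..n. y (X k \<omega>) - (\<integral>x. y x \<partial>P))"
        by (simp add: right_diff_distrib sum_subtractf yint) (simp add: y_def)
      finally show ?thesis .
    qed
    have var: "P.variance y = (\<Sum>i\<in>T. \<Sum>j\<in>T. u i * u j * covar P (\<lambda>x. f x (t i)) (\<lambda>x. f x (t j)))"
    proof -
      have "(y x - (\<integral>x. y x \<partial>P))\<^sup>2 = (\<Sum>i\<in>T. \<Sum>j\<in>T. u i * u j * ((f x (t i) - m (t i)) * (f x (t j) - m (t j))))" for x
      proof -
        have "y x - (\<integral>x. y x \<partial>P) = (\<Sum>i\<in>T. u i * (f x (t i) - m (t i)))"
          by (simp add: right_diff_distrib sum_subtractf yint) (simp add: y_def)
        then show ?thesis unfolding power2_eq_square by (simp add: sum_product mult_ac)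
      qed
      then show ?thesis using ffi tT by (simp add: covar_def m_def)
    qed
    define U where "U = (\<lambda>\<omega>. \<Sum>i\<in>T. u i * g (t i) \<omega>)"
    have "(U \<omega>)\<^sup>2 = (\<Sum>i\<in>T. \<Sum>j\<in>T. u i * u j * (g (t i) \<omega> * g (t j) \<omega>))" for \<omega>
      unfolding U_def power2_eq_square by (simp add: sum_product mult_ac)
    then have "(\<integral>\<omega>. (U \<omega>)\<^sup>2 \<partial>G) = P.variance y"
      unfolding var using gg tT cov by simp
    also have "\<dots> = (sqrt (P.variance y))\<^sup>2" by (simp add: P.variance_positive)
    finally have Uvar: "(\<integral>\<omega>. (U \<omega>)\<^sup>2 \<partial>G) = (sqrt (P.variance y))\<^sup>2" .
    have Umean: "(\<integral>\<omega>. U \<omega> \<partial>G) = 0" unfolding U_def using gi mean tT by simp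
    have "(\<integral>\<omega>. cos (U \<omega> + b) \<partial>G) = (\<integral>x. cos (sqrt (P.variance y) * x + b) \<partial>std_normal_distribution)"
      by (rule gaussian_rv_cos[OF Gp lin[of u, folded U_def] Umean Uvar]) (simp add: P.variance_positive)
    then show ?thesis unfolding eq U_def using cos_normalized_sum_conv[OF ym yb, of b] by simp
  qed
  have tight: "\<exists>L>0. (\<forall>n\<ge>1. prob {\<omega>\<in>space M. \<exists>i\<in>T. \<bar>emp_process f n (t i) \<omega>\<bar> > L} \<le> \<eta>) \<and>
        measure G {\<omega>\<in>space G. \<exists>i\<in>T. \<bar>g (t i) \<omega>\<bar> > L} \<le> \<eta>" if eta: "\<eta> > 0" for \<eta>
  proof -
    \<comment> \<open>Total second moment of the finitely many limit variables. It is added to the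
      constant of the process so that one level \<open>L\<close> works for both.\<close>
    define V where "V = (\<Sum>i\<in>T. \<integral>\<omega>. (g (t i) \<omega>)\<^sup>2 \<partial>G)"
    define c where "c = real (card T) * (2 * C)\<^sup>2 + V"
    define L where "L = sqrt (c / \<eta>) + 1"
    have V: "V \<ge> 0" by (auto simp: V_def intro!: sum_nonneg)
    have c: "c \<ge> 0" using V by (simp add: c_def)
    have L: "L > 0" using c eta by (simp add: L_def add_nonneg_pos)
    have "c / \<eta> \<le> L\<^sup>2" using c eta by (simp add: L_def power2_sum add_increasing2)
    then have cL: "c / L\<^sup>2 \<le> \<eta>" using eta L by (simp add: field_simps)
    have 1: "prob {\<omega>\<in>space M. \<exists>i\<in>T. \<bar>emp_process f n (t i) \<omega>\<bar> > L} \<le> \<eta>" if n: "n \<ge> 1" for n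
    proof -
      have fT: "(\<lambda>x. f x \<theta>) \<in> borel_measurable N" "x \<in> space N \<Longrightarrow> \<bar>f x \<theta>\<bar> \<le> C" if "\<theta> \<in> t ` T" for \<theta> x
        using f tT that by auto
      have "prob {\<omega>\<in>space M. \<exists>i\<in>T. \<bar>emp_process f n (t i) \<omega>\<bar> > L} \<le> real (card T) * (2 * C)\<^sup>2 / L\<^sup>2"
        using emp_process_finite_tail(2)[where f = f, OF finite_imageI[OF T(1), of t] fT n L] by (simp add: card_image[OF T(2)])
      also have "\<dots> \<le> c / L\<^sup>2" using V by (intro divide_right_mono) (auto simp: c_def)
      finally show ?thesis using cL by linarith
    qed
    have "measure G {\<omega>\<in>space G. \<exists>i\<in>T. \<bar>g (t i) \<omega>\<bar> > L} \<le> measure G {\<omega>\<in>space G. (\<Sum>i\<in>T. (g (t i) \<omega>)\<^sup>2) \<ge> L\<^sup>2}"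
    proof (rule G.finite_measure_mono)
      show "{\<omega>\<in>space G. (\<Sum>i\<in>T. (g (t i) \<omega>)\<^sup>2) \<ge> L\<^sup>2} \<in> sets G" using gm tT by measurable
      show "{\<omega>\<in>space G. \<exists>i\<in>T. \<bar>g (t i) \<omega>\<bar> > L} \<subseteq> {\<omega>\<in>space G. (\<Sum>i\<in>T. (g (t i) \<omega>)\<^sup>2) \<ge> L\<^sup>2}"
      proof clarsimp
        fix \<omega> i assume i: "i \<in> T" "L < \<bar>g (t i) \<omega>\<bar>"
        have "L\<^sup>2 \<le> (g (t i) \<omega>)\<^sup>2" using i L by (metis less_imp_le power2_abs power_mono)
        also have "\<dots> \<le> (\<Sum>i\<in>T. (g (t i) \<omega>)\<^sup>2)" using i T by (intro member_le_sum) auto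
        finally show "L\<^sup>2 \<le> (\<Sum>i\<in>T. (g (t i) \<omega>)\<^sup>2)" .
      qed
    qed
    also have "\<dots> \<le> (\<integral>\<omega>. (\<Sum>i\<in>T. (g (t i) \<omega>)\<^sup>2) \<partial>G) / L\<^sup>2"
      by (rule integral_Markov_inequality_measure[where A = "{}"]) (use gi tT L in \<open>auto intro!: sum_nonneg\<close>)
    also have "\<dots> = V / L\<^sup>2" unfolding V_def using gi tT by simp
    also have "\<dots> \<le> c / L\<^sup>2" by (intro divide_right_mono) (auto simp: c_def)
    finally show ?thesis using 1 cL L by (intro exI[of _ L]) auto
  qed
  show ?thesis
    by (rule cos_conv_imp_joint_conv[where Y = "\<lambda>n i. emp_process f n (t i)" and Z = "\<lambda>i. g (t i)",
          OF prob_space_axioms Gp T(1) _ _ conv tight h]) (use f(1) gm tT in auto)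
qed

end

section \<open>Measurability of the robust value\<close>

lemma
  assumes n: "n \<ge> 1" and X: "\<And>i. i \<in> {1..n} \<Longrightarrow> X i \<omega> \<in> space N"
  shows nn_integral_empirical_measurable:
      "F \<in> borel_measurable N \<Longrightarrow> (\<integral>\<^sup>+x. F x \<partial>empirical N X n \<omega>) = (\<Sum>i=1..n. F (X i \<omega>)) / of_nat n"
    and integral_empirical:
      "h \<in> borel_measurable N \<Longrightarrow> (\<integral>x. h x \<partial>empirical N X n \<omega>) = (\<Sum>i=1..n. h (X i \<omega>) :: real) / real n"
    and prob_space_empirical: "prob_space (empirical N X n \<omega>)"
    and AE_empirical: "(\<And>i. i \<in> {1..n} \<Longrightarrow> Q (X i \<omega>)) \<Longrightarrow> (\<And>i. i \<in> {1..n} \<Longrightarrow> {X i \<omega>} \<in> sets N) \<Longrightarrow> AE x in empirical N X n \<omega>. Q x"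
proof -
  have m: "(\<lambda>i. X i \<omega>) \<in> measurable (uniform_count_measure {1..n}) N"
    using X by (auto simp: measurable_def space_uniform_count_measure sets_uniform_count_measure)
  show "(\<integral>\<^sup>+x. F x \<partial>empirical N X n \<omega>) = (\<Sum>i=1..n. F (X i \<omega>)) / of_nat n" if "F \<in> borel_measurable N" for F
  proof -
    have "(\<integral>\<^sup>+x. F x \<partial>empirical N X n \<omega>) = (\<Sum>i=1..n. ennreal (1 / real n) * F (X i \<omega>))"
      unfolding empirical_def using m that
      by (simp add: nn_integral_distr uniform_count_measure_def nn_integral_point_measure_finite)
    also have "\<dots> = ennreal (1 / real n) * (\<Sum>i=1..n. F (X i \<omega>))" by (simp add: sum_distrib_left)
    also have "\<dots> = (\<Sum>i=1..n. F (X i \<omega>)) / of_nat n"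
      using n by (simp add: divide_ennreal_def ennreal_of_nat_eq_real_of_nat inverse_ennreal inverse_eq_divide mult.commute)
    finally show ?thesis .
  qed
  show "(\<integral>x. h x \<partial>empirical N X n \<omega>) = (\<Sum>i=1..n. h (X i \<omega>) :: real) / real n" if "h \<in> borel_measurable N" for h
    unfolding empirical_def using m that
    by (simp add: integral_distr uniform_count_measure_def lebesgue_integral_point_measure_finite sum_divide_distrib)
  show "prob_space (empirical N X n \<omega>)"
    unfolding empirical_def by (rule prob_space.prob_space_distr[OF prob_space_uniform_count_measure m]) (use n in auto)
  show "AE x in empirical N X n \<omega>. Q x" if Q: "\<And>i. i \<in> {1..n} \<Longrightarrow> Q (X i \<omega>)" and s: "\<And>i. i \<in> {1..n} \<Longrightarrow> {X i \<omega>} \<in> sets N"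
  proof (rule AE_I')
    let ?U = "\<Union>i\<in>{1..n}. {X i \<omega>}"
    have U: "?U \<in> sets N" using s by blast
    show "space N - ?U \<in> null_sets (empirical N X n \<omega>)"
    proof -
      have "emeasure (empirical N X n \<omega>) (space N - ?U)
          = emeasure (uniform_count_measure {1..n}) ((\<lambda>i. X i \<omega>) -` (space N - ?U) \<inter> space (uniform_count_measure {1..n}))"
        unfolding empirical_def by (rule emeasure_distr[OF m]) (use U in auto)
      also have "(\<lambda>i. X i \<omega>) -` (space N - ?U) \<inter> space (uniform_count_measure {1..n}) = {}"
        by (auto simp: space_uniform_count_measure)
      finally show ?thesis using U by (auto simp: null_sets_def empirical_def)
    qed
    show "{x \<in> space (empirical N X n \<omega>). \<not> Q x} \<subseteq> space N - ?U"
      using Q by (auto simp: empirical_def)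
  qed
qed

text \<open>\<open>F\<close> is arbitrary, which admits \<phi> composed with a density without any
  measurability argument. The empirical measure lives on finitely many measurable singletons, so
  \<open>F\<close> agrees almost everywhere with a finite combination of their indicators.\<close>

lemma nn_integral_empirical:
  assumes n: "n \<ge> 1" and X: "\<And>i. i \<in> {1..n} \<Longrightarrow> X i \<omega> \<in> space N" and s: "\<And>x. x \<in> space N \<Longrightarrow> {x} \<in> sets N"
  shows "(\<integral>\<^sup>+x. F x \<partial>empirical N X n \<omega>) = (\<Sum>i=1..n. F (X i \<omega>)) / of_nat n"
proof -
  let ?A = "(\<lambda>i. X i \<omega>) ` {1..n}"
  define F' where "F' = (\<lambda>x. \<Sum>p\<in>?A. F p * indicator {p} x)"
  have F': "F' x = F x" if "x \<in> ?A" for x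
  proof -
    have "F' x = (\<Sum>p\<in>?A. if p = x then F p else 0)" unfolding F'_def by (intro sum.cong) auto
    then show ?thesis using that by simp
  qed
  have "(\<integral>\<^sup>+x. F x \<partial>empirical N X n \<omega>) = (\<integral>\<^sup>+x. F' x \<partial>empirical N X n \<omega>)"
  proof (intro nn_integral_cong_AE AE_empirical[where X = X, OF n X])
    show "F (X i \<omega>) = F' (X i \<omega>)" if "i \<in> {1..n}" for i by (rule F'[symmetric]) (use that in simp)
    show "{X i \<omega>} \<in> sets N" if "i \<in> {1..n}" for i by (rule s[OF X[OF that]])
  qed
  also have "\<dots> = (\<Sum>i=1..n. F' (X i \<omega>)) / of_nat n"
  proof (rule nn_integral_empirical_measurable[where X = X, OF n X])
    show "F' \<in> borel_measurable N" unfolding F'_def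
    proof (intro borel_measurable_sum)
      fix p assume "p \<in> ?A"
      then have "{p} \<in> sets N" using s X by blast
      then show "(\<lambda>x. F p * indicator {p} x) \<in> borel_measurable N" by simp
    qed
  qed
  also have "(\<Sum>i=1..n. F' (X i \<omega>)) = (\<Sum>i=1..n. F (X i \<omega>))" by (intro sum.cong refl F') (rule imageI)
  finally show ?thesis .
qed

text \<open>The density of \<open>Q \<in> ambiguity_set \<phi> \<delta> P\<^sub>n\<close> is a vector of weights that agree on coinciding
  sample points; \<open>E\<close> records the coincidences. Only \<open>E\<close> depends on the sample.\<close>

definition weights :: "(real \<Rightarrow> ennreal) \<Rightarrow> real \<Rightarrow> nat \<Rightarrow> (nat \<times> nat) set \<Rightarrow> (nat \<Rightarrow> real) set" where
  "weights \<phi> \<delta> n E = {r. (\<forall>i\<in>{1..n}. 0 \<le> r i) \<and> (\<forall>(i, j)\<in>E. r i = r j) \<and> (\<Sum>i=1..n. r i) = real n \<and>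
     (\<Sum>i=1..n. \<phi> (r i)) / of_nat n \<le> ennreal \<delta>}"

definition max_weighted_mean :: "(real \<Rightarrow> ennreal) \<Rightarrow> real \<Rightarrow> nat \<Rightarrow> (nat \<times> nat) set \<Rightarrow> (nat \<Rightarrow> real) \<Rightarrow> real" where
  "max_weighted_mean \<phi> \<delta> n E y = (SUP r\<in>weights \<phi> \<delta> n E. (\<Sum>i=1..n. r i * y i) / real n)"

definition coincidences :: "(nat \<Rightarrow> 'w \<Rightarrow> 'x) \<Rightarrow> nat \<Rightarrow> 'w \<Rightarrow> (nat \<times> nat) set" where
  "coincidences X n \<omega> = {(i, j) \<in> {1..n} \<times> {1..n}. X i \<omega> = X j \<omega>}"

text \<open>The two sets of values are equal, not just their suprema. A density is evaluated at the
  sample points; conversely, weights that agree on coinciding points are the values of a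
  density.\<close>

lemma sup_ambiguity_set_empirical:
  assumes n: "n \<ge> 1" and X: "\<And>i. i \<in> {1..n} \<Longrightarrow> X i \<omega> \<in> space N" and s: "\<And>x. x \<in> space N \<Longrightarrow> {x} \<in> sets N"
    and y: "y \<in> borel_measurable N"
  shows "(SUP Q\<in>ambiguity_set \<phi> \<delta> (empirical N X n \<omega>). \<integral>x. y x \<partial>Q)
    = max_weighted_mean \<phi> \<delta> n (coincidences X n \<omega>) (\<lambda>i. y (X i \<omega>))"
  unfolding max_weighted_mean_def
proof (rule arg_cong[where f = Sup], intro equalityI subsetI)
  let ?P = "empirical N X n \<omega>"
  have P: "prob_space ?P" by (rule prob_space_empirical[where X = X, OF n X])
  have sets [simp, measurable_cong]: "sets ?P = sets N" by (simp add: empirical_def)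
  have D: "(\<integral>x. y x \<partial>density ?P (\<lambda>x. ennreal (w x))) = (\<Sum>i=1..n. w (X i \<omega>) * y (X i \<omega>)) / real n"
    if w: "w \<in> borel_measurable N" "\<And>x. 0 \<le> w x" for w
  proof -
    have "(\<integral>x. y x \<partial>density ?P (\<lambda>x. ennreal (w x))) = (\<integral>x. w x * y x \<partial>?P)"
      by (rule integral_real_density) (use w y in auto)
    also have "\<dots> = (\<Sum>i=1..n. w (X i \<omega>) * y (X i \<omega>)) / real n"
      by (rule integral_empirical[where X = X, OF n X]) (use w y in auto)
    finally show ?thesis .
  qed
  have one: "(\<integral>\<^sup>+x. ennreal (w x) \<partial>?P) = 1 \<longleftrightarrow> (\<Sum>i=1..n. w (X i \<omega>)) = real n"
    if w: "w \<in> borel_measurable N" "\<And>x. 0 \<le> w x" for w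
  proof -
    have "(\<integral>\<^sup>+x. ennreal (w x) \<partial>?P) = (\<Sum>i=1..n. ennreal (w (X i \<omega>))) / of_nat n"
      by (rule nn_integral_empirical_measurable[where X = X, OF n X]) (use w in auto)
    also have "\<dots> = ennreal ((\<Sum>i=1..n. w (X i \<omega>)) / real n)"
      using n w by (simp add: sum_ennreal divide_ennreal[symmetric] ennreal_of_nat_eq_real_of_nat sum_nonneg)
    finally show ?thesis using n w by (auto simp: sum_nonneg)
  qed
  fix z assume "z \<in> (\<lambda>Q. \<integral>x. y x \<partial>Q) ` ambiguity_set \<phi> \<delta> ?P"
  then obtain Q where Q: "Q \<in> ambiguity_set \<phi> \<delta> ?P" and z: "z = (\<integral>x. y x \<partial>Q)" by blast
  obtain w where w: "w \<in> borel_measurable ?P" "\<And>x. 0 \<le> w x" and Qw: "Q = density ?P (\<lambda>x. ennreal (w x))"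
    and phi: "(\<integral>\<^sup>+x. \<phi> (w x) \<partial>?P) \<le> ennreal \<delta>"
    using ambiguity_set_density[OF P Q] by blast
  have w': "w \<in> borel_measurable N" using w(1) by simp
  have "prob_space Q" using Q by (simp add: ambiguity_set_def)
  then have "emeasure Q (space Q) = 1" by (rule prob_space.emeasure_space_1)
  moreover have "emeasure Q (space Q) = (\<integral>\<^sup>+x. ennreal (w x) * indicator (space ?P) x \<partial>?P)"
    unfolding Qw space_density by (rule emeasure_density) (use w(1) in measurable)
  moreover have "\<dots> = (\<integral>\<^sup>+x. ennreal (w x) \<partial>?P)" by (rule nn_integral_cong) simp
  ultimately have "(\<integral>\<^sup>+x. ennreal (w x) \<partial>?P) = 1" by simp
  then have "(\<lambda>i. w (X i \<omega>)) \<in> weights \<phi> \<delta> n (coincidences X n \<omega>)"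
  proof -
    assume "(\<integral>\<^sup>+x. ennreal (w x) \<partial>?P) = 1"
    then have "(\<Sum>i=1..n. w (X i \<omega>)) = real n" using one[OF w' w(2)] by blast
    moreover have "(\<Sum>i=1..n. \<phi> (w (X i \<omega>))) / of_nat n \<le> ennreal \<delta>"
      using phi nn_integral_empirical[where X = X, OF n X s, of "\<lambda>x. \<phi> (w x)"] by simp
    ultimately show ?thesis using w(2) by (simp add: weights_def coincidences_def)
  qed
  moreover have "z = (\<Sum>i=1..n. w (X i \<omega>) * y (X i \<omega>)) / real n" unfolding z Qw by (rule D[OF w' w(2)])
  ultimately show "z \<in> (\<lambda>r. (\<Sum>i=1..n. r i * y (X i \<omega>)) / real n) ` weights \<phi> \<delta> n (coincidences X n \<omega>)"
    by (intro image_eqI[of _ _ "\<lambda>i. w (X i \<omega>)"])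
next
  let ?P = "empirical N X n \<omega>"
  have P: "prob_space ?P" by (rule prob_space_empirical[where X = X, OF n X])
  have sets [simp, measurable_cong]: "sets ?P = sets N" by (simp add: empirical_def)
  fix z assume "z \<in> (\<lambda>r. (\<Sum>i=1..n. r i * y (X i \<omega>)) / real n) ` weights \<phi> \<delta> n (coincidences X n \<omega>)"
  then obtain r where r: "r \<in> weights \<phi> \<delta> n (coincidences X n \<omega>)" and z: "z = (\<Sum>i=1..n. r i * y (X i \<omega>)) / real n" by blast
  let ?A = "(\<lambda>i. X i \<omega>) ` {1..n}"
  \<comment> \<open>Any index of a given sample point may be picked, because the weights agree on
    coinciding points.\<close>
  define idx where "idx = (\<lambda>p. SOME i. i \<in> {1..n} \<and> X i \<omega> = p)"
  have idx: "idx p \<in> {1..n}" "X (idx p) \<omega> = p" if "p \<in> ?A" for p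
  proof -
    have "\<exists>i. i \<in> {1..n} \<and> X i \<omega> = p" using that by blast
    from someI_ex[OF this] show "idx p \<in> {1..n}" "X (idx p) \<omega> = p" unfolding idx_def by blast+
  qed
  \<comment> \<open>The density is 0 away from the sample points, on a null set of the empirical
    measure.\<close>
  define w where "w = (\<lambda>x. \<Sum>p\<in>?A. r (idx p) * indicator {p} x)"
  have wX: "w (X i \<omega>) = r i" if i: "i \<in> {1..n}" for i
  proof -
    have "w (X i \<omega>) = (\<Sum>p\<in>?A. if p = X i \<omega> then r (idx p) else 0)" unfolding w_def by (intro sum.cong) auto
    also have "\<dots> = r (idx (X i \<omega>))" using i by simp
    also have "\<dots> = r i"
    proof -
      have "(idx (X i \<omega>), i) \<in> coincidences X n \<omega>" using idx[of "X i \<omega>"] i by (auto simp: coincidences_def)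
      then show ?thesis using r by (auto simp: weights_def)
    qed
    finally show ?thesis .
  qed
  have w0: "0 \<le> w x" for x
    unfolding w_def using idx r by (intro sum_nonneg mult_nonneg_nonneg) (auto simp: weights_def)
  have wm: "w \<in> borel_measurable N" unfolding w_def
    by (intro borel_measurable_sum borel_measurable_times borel_measurable_const borel_measurable_indicator s) (auto intro: X)
  have one: "(\<integral>\<^sup>+x. ennreal (w x) \<partial>?P) = 1"
  proof -
    have "(\<integral>\<^sup>+x. ennreal (w x) \<partial>?P) = (\<Sum>i=1..n. ennreal (w (X i \<omega>))) / of_nat n"
      by (rule nn_integral_empirical_measurable[where X = X, OF n X]) (use wm in auto)
    also have "\<dots> = ennreal ((\<Sum>i=1..n. w (X i \<omega>)) / real n)"
      using n w0 by (simp add: sum_ennreal divide_ennreal[symmetric] ennreal_of_nat_eq_real_of_nat sum_nonneg)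
    also have "(\<Sum>i=1..n. w (X i \<omega>)) = real n" using r by (simp add: wX weights_def)
    finally show ?thesis using n by simp
  qed
  have "(\<integral>\<^sup>+x. \<phi> (w x) \<partial>?P) \<le> ennreal \<delta>"
    using r nn_integral_empirical[where X = X, OF n X s, of "\<lambda>x. \<phi> (w x)"] by (simp add: wX weights_def)
  then have "density ?P (\<lambda>x. ennreal (w x)) \<in> ambiguity_set \<phi> \<delta> ?P"
    using wm w0 one by (intro density_in_ambiguity_set P) auto
  moreover have "(\<integral>x. y x \<partial>density ?P (\<lambda>x. ennreal (w x))) = z"
  proof -
    have "(\<integral>x. y x \<partial>density ?P (\<lambda>x. ennreal (w x))) = (\<integral>x. w x * y x \<partial>?P)"
      by (rule integral_real_density) (use wm w0 y in auto)
    also have "\<dots> = (\<Sum>i=1..n. w (X i \<omega>) * y (X i \<omega>)) / real n"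
      by (rule integral_empirical[where X = X, OF n X]) (use wm y in auto)
    finally show ?thesis by (simp add: z wX)
  qed
  ultimately show "z \<in> (\<lambda>Q. \<integral>x. y x \<partial>Q) ` ambiguity_set \<phi> \<delta> ?P" by force
qed

lemma weighted_mean_bound:
  assumes r: "r \<in> weights \<phi> \<delta> n E" and n: "n \<ge> 1" and y: "\<And>i. i \<in> {1..n} \<Longrightarrow> \<bar>y i\<bar> \<le> c"
  shows "\<bar>(\<Sum>i=1..n. r i * y i) / real n\<bar> \<le> c"
proof -
  have "\<bar>\<Sum>i=1..n. r i * y i\<bar> \<le> (\<Sum>i=1..n. r i * c)"
    using r y by (intro order_trans[OF sum_abs] sum_mono) (auto simp: weights_def abs_mult intro!: mult_left_mono)
  also have "\<dots> = real n * c" using r by (simp add: sum_distrib_right[symmetric] weights_def)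
  finally show ?thesis using n by (simp add: pos_divide_le_eq mult.commute)
qed

lemma weights_nonempty:
  assumes "\<phi> 1 = 0" shows "weights \<phi> \<delta> n E \<noteq> {}"
proof -
  have "(\<lambda>_. 1) \<in> weights \<phi> \<delta> n E" using assms by (auto simp: weights_def)
  then show ?thesis by blast
qed

lemma weighted_mean_bdd_above:
  assumes "n \<ge> 1"
  shows "bdd_above ((\<lambda>r. (\<Sum>i=1..n. r i * y i) / real n) ` weights \<phi> \<delta> n E)"
proof (rule bdd_aboveI2)
  fix r assume "r \<in> weights \<phi> \<delta> n E"
  then have "\<bar>(\<Sum>i=1..n. r i * y i) / real n\<bar> \<le> (\<Sum>i=1..n. \<bar>y i\<bar>)"
    using assms by (rule weighted_mean_bound) (auto intro: member_le_sum)
  then show "(\<Sum>i=1..n. r i * y i) / real n \<le> (\<Sum>i=1..n. \<bar>y i\<bar>)" by linarith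
qed

text \<open>Weights divided by \<open>n\<close> form a probability vector, so the maximum moves no
  farther than the arguments. This gives continuity of the robust objective in the parameter for
  each fixed sample.\<close>

lemma max_weighted_mean_lipschitz:
  assumes phi: "\<phi> 1 = 0" and n: "n \<ge> 1"
  shows "max_weighted_mean \<phi> \<delta> n E y \<le> max_weighted_mean \<phi> \<delta> n E z + (\<Sum>i=1..n. \<bar>y i - z i\<bar>)"
  unfolding max_weighted_mean_def[of _ _ _ _ y]
proof (rule cSUP_least[OF weights_nonempty[of \<phi>, OF phi]])
  fix r assume r: "r \<in> weights \<phi> \<delta> n E"
  have "\<bar>(\<Sum>i=1..n. r i * (y i - z i)) / real n\<bar> \<le> (\<Sum>i=1..n. \<bar>y i - z i\<bar>)"
    by (rule weighted_mean_bound[OF r n]) (rule member_le_sum, auto)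
  moreover have "(\<Sum>i=1..n. r i * y i) / real n = (\<Sum>i=1..n. r i * z i) / real n + (\<Sum>i=1..n. r i * (y i - z i)) / real n"
    by (simp add: add_divide_distrib[symmetric] sum.distrib[symmetric] algebra_simps)
  moreover have "(\<Sum>i=1..n. r i * z i) / real n \<le> max_weighted_mean \<phi> \<delta> n E z"
    unfolding max_weighted_mean_def by (rule cSUP_upper[OF r weighted_mean_bdd_above[OF n]])
  ultimately show "(\<Sum>i=1..n. r i * y i) / real n \<le> max_weighted_mean \<phi> \<delta> n E z + (\<Sum>i=1..n. \<bar>y i - z i\<bar>)" by linarith
qed

text \<open>Although the weights form an uncountable set, a supremum of continuous functions has
  open strict superlevel sets.\<close>

lemma max_weighted_mean_measurable:
  assumes phi: "\<phi> 1 = 0" and n: "n \<ge> 1"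
  shows "max_weighted_mean \<phi> \<delta> n E \<in> borel_measurable borel"
proof (rule borel_measurable_iff_greater[THEN iffD2], intro allI)
  fix a
  have eq: "{y \<in> space borel. a < max_weighted_mean \<phi> \<delta> n E y}
      = (\<Union>r\<in>weights \<phi> \<delta> n E. {y. a < (\<Sum>i=1..n. r i * y i) / real n})"
    unfolding max_weighted_mean_def less_cSUP_iff[OF weights_nonempty[of \<phi>, OF phi] weighted_mean_bdd_above[OF n]]
    by auto
  have op: "open {y. a < (\<Sum>i=1..n. r i * y i) / real n}" for r :: "nat \<Rightarrow> real"
    by (intro open_Collect_less continuous_intros continuous_on_product_coordinates) (use n in auto)
  show "{y \<in> space borel. a < max_weighted_mean \<phi> \<delta> n E y} \<in> sets borel"
    unfolding eq by (intro borel_open open_UN ballI op)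
qed

section \<open>Measurability along random samples and under infima over parameters\<close>

lemma continuous_sections:
  assumes "continuous_on (S \<times> \<Theta>) (\<lambda>(x, \<theta>). l x \<theta>)"
  shows "\<theta> \<in> \<Theta> \<Longrightarrow> continuous_on S (\<lambda>x. l x \<theta>)" "x \<in> S \<Longrightarrow> continuous_on \<Theta> (l x)"
proof -
  assume t: "\<theta> \<in> \<Theta>"
  have "continuous_on S (\<lambda>x. case (x, \<theta>) of (x, \<theta>) \<Rightarrow> l x \<theta>)"
    by (rule continuous_on_compose2[OF assms]) (auto intro!: continuous_intros simp: t)
  then show "continuous_on S (\<lambda>x. l x \<theta>)" by simp
next
  assume t: "x \<in> S"
  have "continuous_on \<Theta> (\<lambda>\<theta>. case (x, \<theta>) of (x, \<theta>) \<Rightarrow> l x \<theta>)"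
    by (rule continuous_on_compose2[OF assms]) (auto intro!: continuous_intros simp: t)
  then show "continuous_on \<Theta> (l x)" by simp
qed

text \<open>By continuity the infimum over the compact set equals the infimum over a countable dense
  subset; compactness supplies the lower bound that makes both meaningful.\<close>

lemma borel_measurable_INF_compact:
  fixes F :: "'t::{second_countable_topology,metric_space} \<Rightarrow> 'w \<Rightarrow> real"
  assumes K: "compact K" "K \<noteq> {}" and Fm: "\<And>\<theta>. \<theta> \<in> K \<Longrightarrow> F \<theta> \<in> borel_measurable M"
    and cont: "\<And>\<omega>. \<omega> \<in> space M \<Longrightarrow> continuous_on K (\<lambda>\<theta>. F \<theta> \<omega>)"
  shows "(\<lambda>\<omega>. INF \<theta>\<in>K. F \<theta> \<omega>) \<in> borel_measurable M"
proof -
  have bdd: "bdd_below ((\<lambda>\<theta>. F \<theta> \<omega>) ` K)" if w: "\<omega> \<in> space M" for \<omega>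
    using compact_continuous_image[OF cont[OF w] K(1)] by (simp add: bounded_imp_bdd_below compact_imp_bounded)
  obtain D where D: "countable D" "D \<subseteq> K" "K \<subseteq> closure D" using separable by blast
  have Dne: "D \<noteq> {}" using D K by auto
  have INF: "(INF \<theta>\<in>K. F \<theta> \<omega>) = (INF \<theta>\<in>D. F \<theta> \<omega>)" if w: "\<omega> \<in> space M" for \<omega>
  proof (rule antisym)
    show "(INF \<theta>\<in>K. F \<theta> \<omega>) \<le> (INF \<theta>\<in>D. F \<theta> \<omega>)" by (rule cINF_superset_mono[OF Dne bdd[OF w] D(2)]) simp
    have bD: "bdd_below ((\<lambda>\<theta>. F \<theta> \<omega>) ` D)" by (rule bdd_below_mono[OF bdd[OF w]]) (use D in blast)
    show "(INF \<theta>\<in>D. F \<theta> \<omega>) \<le> (INF \<theta>\<in>K. F \<theta> \<omega>)"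
    proof (rule cINF_greatest[OF K(2)])
      fix \<theta> assume t: "\<theta> \<in> K"
      then obtain s where s: "\<And>k. s k \<in> D" "s \<longlonglongrightarrow> \<theta>" using D(3) closure_sequential[of \<theta> D] by blast
      have "(\<lambda>k. F (s k) \<omega>) \<longlonglongrightarrow> F \<theta> \<omega>"
        using cont[OF w] s t D(2) unfolding continuous_on_sequentially comp_def by blast
      then show "(INF \<theta>\<in>D. F \<theta> \<omega>) \<le> F \<theta> \<omega>"
        by (rule LIMSEQ_le_const) (intro exI[of _ 0] allI impI cINF_lower[OF bD] s(1))
    qed
  qed
  have "(\<lambda>\<omega>. INF \<theta>\<in>D. F \<theta> \<omega>) \<in> borel_measurable M"
  proof (rule borel_measurable_cINF[OF D(1)])
    show "bdd_below ((\<lambda>\<theta>. F \<theta> \<omega>) ` D)" if "\<omega> \<in> space M" for \<omega>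
      by (rule bdd_below_mono[OF bdd[OF that]]) (use D in blast)
    show "F \<theta> \<in> borel_measurable M" if "\<theta> \<in> D" for \<theta> using that D(2) Fm by blast
  qed
  then show ?thesis by (rule measurable_cong[THEN iffD2, rotated]) (rule INF)
qed

text \<open>For a fixed pattern of coincidences the robust objective is a measurable function of the
  sample. Only finitely many patterns exist, each occurring on an event, so the pieces can be glued;
  the infimum is then covered by continuity in the parameter.\<close>

lemma robust_optval_measurable:
  fixes S :: "'x::{second_countable_topology,t2_space} set" and \<Theta> :: "'t::{second_countable_topology,metric_space} set"
  assumes X: "\<And>i. i \<ge> 1 \<Longrightarrow> X i \<in> measurable M (borel_on S)" and S: "S \<in> sets borel"
    and Theta: "compact \<Theta>" "\<Theta> \<noteq> {}" and l: "continuous_on (S \<times> \<Theta>) (\<lambda>(x, \<theta>). l x \<theta>)"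
    and phi: "\<phi> 1 = 0" and n: "n \<ge> 1"
  shows "(\<lambda>\<omega>. robust_optval \<phi> l \<Theta> (empirical (borel_on S) X n \<omega>) \<delta>) \<in> borel_measurable M"
proof -
  define F where "F = (\<lambda>\<theta> \<omega>. max_weighted_mean \<phi> \<delta> n (coincidences X n \<omega>) (\<lambda>i. l (X i \<omega>) \<theta>))"
  have XS: "X i \<omega> \<in> S" if "\<omega> \<in> space M" "i \<ge> 1" for i \<omega>
    using measurable_space[OF X[OF that(2)] that(1)] by (simp add: space_restrict_space)
  have lm: "(\<lambda>x. l x \<theta>) \<in> borel_measurable (borel_on S)" if "\<theta> \<in> \<Theta>" for \<theta>
    by (rule borel_measurable_continuous_on_restrict[OF continuous_sections(1)[OF l that]])
  have lc: "continuous_on \<Theta> (l x)" if "x \<in> S" for x by (rule continuous_sections(2)[OF l that])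
  have eq: "robust_objective \<phi> l (empirical (borel_on S) X n \<omega>) \<theta> \<delta> = F \<theta> \<omega>" if "\<theta> \<in> \<Theta>" "\<omega> \<in> space M" for \<theta> \<omega>
    unfolding robust_objective_def objective_def F_def
  proof (rule sup_ambiguity_set_empirical[OF n])
    show "X i \<omega> \<in> space (borel_on S)" if "i \<in> {1..n}" for i using XS \<open>\<omega> \<in> space M\<close> that by (simp add: space_restrict_space)
    show "{x} \<in> sets (borel_on S)" if "x \<in> space (borel_on S)" for x
      using that S by (auto simp: sets_restrict_space_iff space_restrict_space)
  qed (rule lm[OF that(1)])
  have cont: "(\<lambda>k. F (s k) \<omega>) \<longlonglongrightarrow> F \<theta> \<omega>"
    if w: "\<omega> \<in> space M" and s: "\<And>k. s k \<in> \<Theta>" "s \<longlonglongrightarrow> \<theta>" and t: "\<theta> \<in> \<Theta>" for s \<theta> \<omega>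
  proof (rule LIM_zero_cancel, rule Lim_null_comparison)
    let ?d = "\<lambda>k. \<Sum>i=1..n. \<bar>l (X i \<omega>) (s k) - l (X i \<omega>) \<theta>\<bar>"
    have "norm (F (s k) \<omega> - F \<theta> \<omega>) \<le> ?d k" for k
    proof -
      have "F (s k) \<omega> \<le> F \<theta> \<omega> + ?d k" unfolding F_def by (rule max_weighted_mean_lipschitz[of \<phi>, OF phi n])
      moreover have "F \<theta> \<omega> \<le> F (s k) \<omega> + ?d k"
        unfolding F_def by (subst abs_minus_commute) (rule max_weighted_mean_lipschitz[of \<phi>, OF phi n])
      ultimately show ?thesis by simp
    qed
    then show "\<forall>\<^sub>F k in sequentially. norm (F (s k) \<omega> - F \<theta> \<omega>) \<le> ?d k" by simp
    have "(\<lambda>k. l (X i \<omega>) (s k)) \<longlonglongrightarrow> l (X i \<omega>) \<theta>" if "i \<in> {1..n}" for i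
      using lc[OF XS[OF w, of i]] s t that unfolding continuous_on_sequentially comp_def by auto
    then have "?d \<longlonglongrightarrow> (\<Sum>i=1..n. \<bar>l (X i \<omega>) \<theta> - l (X i \<omega>) \<theta>\<bar>)" by (intro tendsto_intros) auto
    then show "?d \<longlonglongrightarrow> 0" by simp
  qed
  have cont': "continuous_on \<Theta> (\<lambda>\<theta>. F \<theta> \<omega>)" if w: "\<omega> \<in> space M" for \<omega>
    unfolding continuous_on_sequentially comp_def using cont[OF w] by blast
  have Xb: "X i \<in> borel_measurable M" if "i \<ge> 1" for i
    using X[OF that] by (simp add: measurable_restrict_space2_iff)
  have Fm: "F \<theta> \<in> borel_measurable M" if t: "\<theta> \<in> \<Theta>" for \<theta>
  proof -
    \<comment> \<open>The coordinate at index 0 is set to 0, because nothing is known about the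
      measurability of \<open>X 0\<close>.\<close>
    define y where "y = (\<lambda>\<omega> i. if i \<ge> 1 then l (X i \<omega>) \<theta> else 0)"
    have "y \<in> borel_measurable M"
    proof (rule measurable_coordinatewise_then_product)
      fix i show "(\<lambda>\<omega>. y \<omega> i) \<in> borel_measurable M"
        using measurable_compose[OF X[of i] lm[OF t]] by (cases "i \<ge> 1") (auto simp: y_def)
    qed
    then have m1: "(\<lambda>\<omega>. max_weighted_mean \<phi> \<delta> n E (y \<omega>)) \<in> borel_measurable M" for E
      by (rule measurable_compose[OF _ max_weighted_mean_measurable[of \<phi>, OF phi n]])
    have m2: "coincidences X n \<in> measurable M (count_space (Pow ({1..n} \<times> {1..n})))"
    proof (rule measurable_count_space_eq2[THEN iffD2, OF _ conjI])
      show "coincidences X n \<in> space M \<rightarrow> Pow ({1..n} \<times> {1..n})" by (auto simp: coincidences_def)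
      show "\<forall>E\<in>Pow ({1..n} \<times> {1..n}). coincidences X n -` {E} \<inter> space M \<in> sets M"
      proof
        fix E assume E: "E \<in> Pow ({1..n} \<times> {1..n})"
        have e: "{\<omega>\<in>space M. X i \<omega> = X j \<omega>} \<in> sets M" if "i \<ge> 1" "j \<ge> 1" for i j
        proof -
          \<comment> \<open>Coincidence of two observations is a preimage of the diagonal, which is
            closed in a Hausdorff space.\<close>
          have "closed {p :: 'x \<times> 'x. fst p = snd p}"
            by (intro closed_Collect_eq continuous_on_fst continuous_on_snd continuous_on_id)
          then have "(\<lambda>\<omega>. (X i \<omega>, X j \<omega>)) -` {p. fst p = snd p} \<inter> space M \<in> sets M"
            by (intro measurable_sets[OF borel_measurable_Pair[OF Xb[OF that(1)] Xb[OF that(2)]]]) (rule borel_closed)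
          moreover have "(\<lambda>\<omega>. (X i \<omega>, X j \<omega>)) -` {p. fst p = snd p} \<inter> space M = {\<omega>\<in>space M. X i \<omega> = X j \<omega>}" by auto
          ultimately show ?thesis by simp
        qed
        have "coincidences X n -` {E} \<inter> space M = {\<omega>\<in>space M. \<forall>p\<in>{1..n}\<times>{1..n}. (p \<in> E) = (X (fst p) \<omega> = X (snd p) \<omega>)}"
        proof -
          have "coincidences X n \<omega> = E \<longleftrightarrow> (\<forall>p\<in>{1..n}\<times>{1..n}. (p \<in> E) = (X (fst p) \<omega> = X (snd p) \<omega>))" for \<omega>
          proof -
            have C: "coincidences X n \<omega> = {p \<in> {1..n} \<times> {1..n}. X (fst p) \<omega> = X (snd p) \<omega>}"
              unfolding coincidences_def by (simp add: case_prod_unfold mem_Times_iff conj_assoc)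
            have "{p \<in> A. R p} = E \<longleftrightarrow> (\<forall>p\<in>A. (p \<in> E) = R p)" if "E \<subseteq> A" for A and R :: "nat \<times> nat \<Rightarrow> bool"
              using that by auto
            then show ?thesis unfolding C using E by simp
          qed
          then show ?thesis by blast
        qed
        also have "\<dots> \<in> sets M"
        proof (rule sets.sets_Collect_finite_All)
          fix p assume "p \<in> {1..n} \<times> {1..n}"
          then have "{\<omega>\<in>space M. X (fst p) \<omega> = X (snd p) \<omega>} \<in> sets M" by (intro e) (simp_all add: mem_Times_iff)
          then show "{\<omega>\<in>space M. (p \<in> E) = (X (fst p) \<omega> = X (snd p) \<omega>)} \<in> sets M"
            using sets.sets_Collect_neg by (cases "p \<in> E") simp_all
        qed (use n in auto)
        finally show "coincidences X n -` {E} \<inter> space M \<in> sets M" .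
      qed
    qed simp
    have "(\<lambda>\<omega>. max_weighted_mean \<phi> \<delta> n (coincidences X n \<omega>) (y \<omega>)) \<in> borel_measurable M"
      by (rule measurable_compose_countable'[OF m1 m2]) (simp add: countable_finite)
    moreover have "max_weighted_mean \<phi> \<delta> n (coincidences X n \<omega>) (y \<omega>) = F \<theta> \<omega>" for \<omega>
    proof -
      have "(\<Sum>i=1..n. r i * y \<omega> i) = (\<Sum>i=1..n. r i * l (X i \<omega>) \<theta>)" for r
        by (rule sum.cong) (simp_all add: y_def)
      then show ?thesis by (simp only: F_def max_weighted_mean_def)
    qed
    ultimately show ?thesis by simp
  qed
  have "(\<lambda>\<omega>. INF \<theta>\<in>\<Theta>. F \<theta> \<omega>) \<in> borel_measurable M"
    by (rule borel_measurable_INF_compact[OF Theta Fm cont'])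
  moreover have "robust_optval \<phi> l \<Theta> (empirical (borel_on S) X n \<omega>) \<delta> = (INF \<theta>\<in>\<Theta>. F \<theta> \<omega>)" if "\<omega> \<in> space M" for \<omega>
    unfolding robust_optval_def using eq[OF _ that] by (intro INF_cong) auto
  ultimately show ?thesis by (rule measurable_cong[THEN iffD2, rotated])
qed

section \<open>Infima of converging processes\<close>

text \<open>\<open>cts_step a b\<close> falls linearly from 1 to 0 between \<open>a\<close> and
  \<open>b\<close>. Being nonincreasing and Lipschitz with constant 1 / (b - a), it turns one-sided
  inequalities between random variables into inequalities between expectations.\<close>

lemma cts_step_props:
  assumes "a < b"
  shows "0 \<le> cts_step a b x" "cts_step a b x \<le> 1" "x \<le> y \<Longrightarrow> cts_step a b y \<le> cts_step a b x"
    "0 \<le> e \<Longrightarrow> cts_step a b x \<le> cts_step a b (x + e) + e / (b - a)"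
    "continuous_on UNIV (cts_step a b)"
proof -
  have eq: "cts_step a b x = max 0 (min 1 ((b - x) / (b - a)))" for x
    using assms by (auto simp: cts_step_def min_def max_def field_simps)
  show "0 \<le> cts_step a b x" "cts_step a b x \<le> 1" by (auto simp: eq)
  show "x \<le> y \<Longrightarrow> cts_step a b y \<le> cts_step a b x"
    unfolding eq using assms by (intro max.mono min.mono divide_right_mono) auto
  have "(b - x) / (b - a) = (b - (x + e)) / (b - a) + e / (b - a)" by (simp add: add_divide_distrib[symmetric])
  moreover assume "0 \<le> e"
  then have "0 \<le> e / (b - a)" using assms by simp
  ultimately show "cts_step a b x \<le> cts_step a b (x + e) + e / (b - a)" unfolding eq by linarith
next
  show "continuous_on UNIV (cts_step a b)"
    by (rule uniformly_continuous_imp_continuous[OF cts_step_uniformly_continuous[OF assms]])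
qed

lemma cts_step_measurable [measurable]: "a < b \<Longrightarrow> cts_step a b \<in> borel_measurable borel"
  by (rule borel_measurable_continuous_onI[OF cts_step_props(5)])

text \<open>Off \<open>E\<close>, monotonicity and the Lipschitz bound give the error e / (b - a);
  on \<open>E\<close> the values lie in [0, 1] and cost at most its probability.\<close>

lemma cts_step_expectation_le:
  assumes M: "prob_space M" and m: "A \<in> borel_measurable M" "B \<in> borel_measurable M" and ab: "a < b"
    and E: "E \<in> sets M" "measure M E \<le> e" "\<And>\<omega>. \<omega> \<in> space M - E \<Longrightarrow> A \<omega> \<le> B \<omega> + e" and e: "0 \<le> e"
  shows "(\<integral>\<omega>. cts_step a b (B \<omega>) \<partial>M) \<le> (\<integral>\<omega>. cts_step a b (A \<omega>) \<partial>M) + (1 / (b - a) + 1) * e"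
proof -
  interpret prob_space M by fact
  note [measurable] = m E(1) cts_step_measurable[OF ab]
  have i: "integrable M (\<lambda>\<omega>. cts_step a b (W \<omega>))" if "W \<in> borel_measurable M" for W
    by (rule integrable_const_bound[of _ 1]) (use that cts_step_props[OF ab] in auto)
  have iE: "integrable M (indicator E :: _ \<Rightarrow> real)" using E(1) by (simp add: less_top[symmetric])
  have "(\<integral>\<omega>. cts_step a b (B \<omega>) \<partial>M) \<le> (\<integral>\<omega>. cts_step a b (A \<omega>) + e / (b - a) + indicator E \<omega> \<partial>M)"
  proof (rule integral_mono)
    fix \<omega> assume w: "\<omega> \<in> space M"
    show "cts_step a b (B \<omega>) \<le> cts_step a b (A \<omega>) + e / (b - a) + indicator E \<omega>"
    proof (cases "\<omega> \<in> E")
      case True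
      have "0 \<le> e / (b - a)" using e ab by simp
      then show ?thesis using True cts_step_props(1,2)[OF ab, of "A \<omega>"] cts_step_props(2)[OF ab, of "B \<omega>"] by simp
    next
      case False
      then have "A \<omega> \<le> B \<omega> + e" using E(3) w by simp
      from cts_step_props(3)[OF ab this] cts_step_props(4)[OF ab e, of "B \<omega>"] show ?thesis using False by simp
    qed
  qed (use i m iE in auto)
  also have "\<dots> = (\<integral>\<omega>. cts_step a b (A \<omega>) \<partial>M) + e / (b - a) + prob E"
    using i[OF m(1)] iE E(1) by (simp add: prob_space)
  finally show ?thesis using E(2) by (simp add: distrib_right)
qed

text \<open>Convergence in law follows from convergence of the expectations of
  \<open>cts_step a b\<close>, and these functions are monotone. Hence a lower approximation
  \<open>L\<close> whose limit is not far below \<open>Y\<close>, and an upper one \<open>U\<close>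
  whose limit is not far above it, suffice, with a separate pair for every \<open>e\<close>.\<close>

lemma converges_in_distribution_sandwich:
  assumes M: "prob_space M" and N: "prob_space N" and Z: "\<And>n. n \<ge> 1 \<Longrightarrow> Z n \<in> borel_measurable M"
    and Y: "Y \<in> borel_measurable N"
    and lower: "\<And>e. e > 0 \<Longrightarrow> \<exists>L L'. (\<forall>n. L n \<in> borel_measurable M) \<and> L' \<in> borel_measurable N \<and>
        (\<forall>a b. a < b \<longrightarrow> (\<lambda>n. \<integral>\<omega>. cts_step a b (L n \<omega>) \<partial>M) \<longlonglongrightarrow> (\<integral>\<omega>. cts_step a b (L' \<omega>) \<partial>N)) \<and>
        (\<forall>\<^sub>F n in sequentially. \<exists>E\<in>sets M. measure M E \<le> e \<and> (\<forall>\<omega>\<in>space M - E. L n \<omega> \<le> Z n \<omega> + e)) \<and>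
        (\<exists>E\<in>sets N. measure N E \<le> e \<and> (\<forall>\<omega>\<in>space N - E. Y \<omega> \<le> L' \<omega> + e))"
    and upper: "\<And>e. e > 0 \<Longrightarrow> \<exists>U U'. (\<forall>n. U n \<in> borel_measurable M) \<and> U' \<in> borel_measurable N \<and>
        (\<forall>a b. a < b \<longrightarrow> (\<lambda>n. \<integral>\<omega>. cts_step a b (U n \<omega>) \<partial>M) \<longlonglongrightarrow> (\<integral>\<omega>. cts_step a b (U' \<omega>) \<partial>N)) \<and>
        (\<forall>\<^sub>F n in sequentially. \<exists>E\<in>sets M. measure M E \<le> e \<and> (\<forall>\<omega>\<in>space M - E. Z n \<omega> \<le> U n \<omega> + e)) \<and>
        (\<exists>E\<in>sets N. measure N E \<le> e \<and> (\<forall>\<omega>\<in>space N - E. U' \<omega> \<le> Y \<omega> + e))"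
  shows "converges_in_distribution M Z N Y"
proof -
  interpret M: prob_space M by fact
  interpret N: prob_space N by fact
  \<comment> \<open>Measurability is only given from index 1 on; the modified sequence has a
    distribution at every index.\<close>
  define Z' where "Z' = (\<lambda>n. if n \<ge> 1 then Z n else (\<lambda>_. 0))"
  have Z'm: "Z' n \<in> borel_measurable M" for n using Z by (simp add: Z'_def)
  have conv: "(\<lambda>n. \<integral>\<omega>. cts_step a b (Z' n \<omega>) \<partial>M) \<longlonglongrightarrow> (\<integral>\<omega>. cts_step a b (Y \<omega>) \<partial>N)" if ab: "a < b" for a b
  proof (rule LIMSEQ_I)
    fix r :: real assume r: "r > 0"
    define c where "c = 1 / (b - a) + 1"
    have c: "c > 0" using ab by (simp add: c_def add_pos_pos)
    \<comment> \<open>Each side of the sandwich consists of two comparisons costing c e = r / 4 and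
      one limit costing r / 4, together less than \<open>r\<close>.\<close>
    define e where "e = r / (4 * c)"
    have e: "e > 0" using r c by (simp add: e_def)
    have ce: "c * e = r / 4" using c by (simp add: e_def)
    obtain L L' where L: "\<And>n. L n \<in> borel_measurable M" "L' \<in> borel_measurable N"
      "(\<lambda>n. \<integral>\<omega>. cts_step a b (L n \<omega>) \<partial>M) \<longlonglongrightarrow> (\<integral>\<omega>. cts_step a b (L' \<omega>) \<partial>N)"
      "\<forall>\<^sub>F n in sequentially. \<exists>E\<in>sets M. measure M E \<le> e \<and> (\<forall>\<omega>\<in>space M - E. L n \<omega> \<le> Z n \<omega> + e)"
      "\<exists>E\<in>sets N. measure N E \<le> e \<and> (\<forall>\<omega>\<in>space N - E. Y \<omega> \<le> L' \<omega> + e)"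
      using lower[OF e] ab by blast
    obtain U U' where U: "\<And>n. U n \<in> borel_measurable M" "U' \<in> borel_measurable N"
      "(\<lambda>n. \<integral>\<omega>. cts_step a b (U n \<omega>) \<partial>M) \<longlonglongrightarrow> (\<integral>\<omega>. cts_step a b (U' \<omega>) \<partial>N)"
      "\<forall>\<^sub>F n in sequentially. \<exists>E\<in>sets M. measure M E \<le> e \<and> (\<forall>\<omega>\<in>space M - E. Z n \<omega> \<le> U n \<omega> + e)"
      "\<exists>E\<in>sets N. measure N E \<le> e \<and> (\<forall>\<omega>\<in>space N - E. U' \<omega> \<le> Y \<omega> + e)"
      using upper[OF e] ab by blast
    have "(\<integral>\<omega>. cts_step a b (L' \<omega>) \<partial>N) \<le> (\<integral>\<omega>. cts_step a b (Y \<omega>) \<partial>N) + c * e"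
      using L(5) cts_step_expectation_le[OF N Y L(2) ab _ _ _ less_imp_le[OF e]] unfolding c_def by blast
    moreover have "(\<integral>\<omega>. cts_step a b (Y \<omega>) \<partial>N) \<le> (\<integral>\<omega>. cts_step a b (U' \<omega>) \<partial>N) + c * e"
      using U(5) cts_step_expectation_le[OF N U(2) Y ab _ _ _ less_imp_le[OF e]] unfolding c_def by blast
    ultimately have N': "(\<integral>\<omega>. cts_step a b (L' \<omega>) \<partial>N) \<le> (\<integral>\<omega>. cts_step a b (Y \<omega>) \<partial>N) + r / 4"
      "(\<integral>\<omega>. cts_step a b (Y \<omega>) \<partial>N) \<le> (\<integral>\<omega>. cts_step a b (U' \<omega>) \<partial>N) + r / 4"
      by (simp_all add: ce)
    have r4: "r / 4 > 0" using r by simp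
    have "\<forall>\<^sub>F n in sequentially. norm ((\<integral>\<omega>. cts_step a b (Z' n \<omega>) \<partial>M) - (\<integral>\<omega>. cts_step a b (Y \<omega>) \<partial>N)) < r"
      using tendstoD[OF L(3) r4] tendstoD[OF U(3) r4] L(4) U(4) eventually_ge_at_top[of 1]
    proof eventually_elim
      case (elim n)
      have Zn: "Z n \<in> borel_measurable M" "Z' n = Z n" using Z elim(5) by (auto simp: Z'_def)
      have "(\<integral>\<omega>. cts_step a b (Z n \<omega>) \<partial>M) \<le> (\<integral>\<omega>. cts_step a b (L n \<omega>) \<partial>M) + c * e"
        using elim(3) cts_step_expectation_le[OF M L(1) Zn(1) ab _ _ _ less_imp_le[OF e]] unfolding c_def by blast
      moreover have "(\<integral>\<omega>. cts_step a b (U n \<omega>) \<partial>M) \<le> (\<integral>\<omega>. cts_step a b (Z n \<omega>) \<partial>M) + c * e"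
        using elim(4) cts_step_expectation_le[OF M Zn(1) U(1) ab _ _ _ less_imp_le[OF e]] unfolding c_def by blast
      ultimately show ?case using N' elim(1,2) unfolding Zn(2) ce dist_real_def real_norm_def by linarith
    qed
    then show "\<exists>no. \<forall>n\<ge>no. norm ((\<integral>\<omega>. cts_step a b (Z' n \<omega>) \<partial>M) - (\<integral>\<omega>. cts_step a b (Y \<omega>) \<partial>N)) < r"
      by (simp add: eventually_sequentially)
  qed
  have rd: "real_distribution (distr M borel (Z' n))" "real_distribution (distr N borel Y)" for n
    using M.real_distribution_distr[OF Z'm] N.real_distribution_distr[OF Y] by auto
  have "weak_conv_m (\<lambda>n. distr M borel (Z' n)) (distr N borel Y)"
    by (rule integral_cts_step_conv_imp_weak_conv[OF rd])
       (use conv in \<open>simp add: integral_distr[OF Z'm] integral_distr[OF Y] cts_step_measurable\<close>)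
  then have "weak_conv_m (\<lambda>n. distr M borel (Z n)) (distr N borel Y)"
    unfolding weak_conv_m_def weak_conv_def
  proof (intro allI impI)
    fix x assume "\<forall>x. isCont (cdf (distr N borel Y)) x \<longrightarrow> (\<lambda>n. cdf (distr M borel (Z' n)) x) \<longlonglongrightarrow> cdf (distr N borel Y) x"
      and "isCont (cdf (distr N borel Y)) x"
    then have "(\<lambda>n. cdf (distr M borel (Z' n)) x) \<longlonglongrightarrow> cdf (distr N borel Y) x" by blast
    then show "(\<lambda>n. cdf (distr M borel (Z n)) x) \<longlonglongrightarrow> cdf (distr N borel Y) x"
      by (rule Lim_transform_eventually) (auto intro!: eventually_mono[OF eventually_ge_at_top[of 1]] simp: Z'_def)
  qed
  moreover have "\<forall>\<^sub>F n in sequentially. Z n \<in> borel_measurable M"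
    using eventually_ge_at_top[of 1] by (rule eventually_mono) (rule Z)
  ultimately show ?thesis using Y by (simp add: converges_in_distribution_def)
qed

text \<open>Paths are uniformly continuous on the compact set, so the events of an oscillation above
  \<eta> at scale 1 / (j + 1) decrease to the empty set and their probabilities to 0. They are
  formed over a countable dense set to be measurable; continuity extends the bound to all
  parameters.\<close>

lemma stochastic_modulus:
  fixes H :: "'t::{second_countable_topology,real_normed_vector} \<Rightarrow> 'v \<Rightarrow> real"
  assumes G: "prob_space G" and K: "compact K" and Hm: "\<And>\<theta>. \<theta> \<in> K \<Longrightarrow> H \<theta> \<in> borel_measurable G"
    and cont: "\<And>\<omega>. \<omega> \<in> space G \<Longrightarrow> continuous_on K (\<lambda>\<theta>. H \<theta> \<omega>)" and \<eta>: "\<eta> > 0"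
  obtains d E where "d > 0" "E \<in> sets G" "measure G E \<le> \<eta>"
    "\<And>\<omega> \<theta> \<theta>'. \<lbrakk>\<omega> \<in> space G - E; \<theta> \<in> K; \<theta>' \<in> K; norm (\<theta> - \<theta>') < d\<rbrakk> \<Longrightarrow> \<bar>H \<theta> \<omega> - H \<theta>' \<omega>\<bar> \<le> \<eta>"
proof -
  interpret prob_space G by fact
  obtain D where D: "countable D" "D \<subseteq> K" "K \<subseteq> closure D" using separable by blast
  define B where "B = (\<lambda>j::nat. {\<omega>\<in>space G. \<exists>p\<in>D \<times> D. norm (fst p - snd p) < 1 / Suc j \<and> \<bar>H (fst p) \<omega> - H (snd p) \<omega>\<bar> > \<eta>})"
  have Bm: "B j \<in> events" for j
  proof -
    have B1: "{\<omega>\<in>space G. norm (fst p - snd p) < 1 / Suc j \<and> \<bar>H (fst p) \<omega> - H (snd p) \<omega>\<bar> > \<eta>} \<in> events" if "p \<in> D \<times> D" for p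
    proof -
      have [measurable]: "H (fst p) \<in> borel_measurable G" "H (snd p) \<in> borel_measurable G" using that D(2) Hm by auto
      show ?thesis by measurable
    qed
    have "(\<Union>p\<in>D \<times> D. {\<omega>\<in>space G. norm (fst p - snd p) < 1 / Suc j \<and> \<bar>H (fst p) \<omega> - H (snd p) \<omega>\<bar> > \<eta>}) \<in> events"
      by (rule sets.countable_UN''[OF countable_SIGMA[OF D(1) D(1)]]) (rule B1)
    also have "(\<Union>p\<in>D \<times> D. {\<omega>\<in>space G. norm (fst p - snd p) < 1 / Suc j \<and> \<bar>H (fst p) \<omega> - H (snd p) \<omega>\<bar> > \<eta>}) = B j"
      unfolding B_def by blast
    finally show ?thesis .
  qed
  have dec: "decseq B"
  proof (rule decseq_SucI, unfold B_def, safe)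
    fix j \<omega> a b assume "a \<in> D" "b \<in> D" "norm (fst (a, b) - snd (a, b)) < 1 / Suc (Suc j)" "\<eta> < \<bar>H (fst (a, b)) \<omega> - H (snd (a, b)) \<omega>\<bar>"
    moreover have "1 / real (Suc (Suc j)) \<le> 1 / real (Suc j)" by (simp add: frac_le)
    ultimately show "\<exists>p\<in>D \<times> D. norm (fst p - snd p) < 1 / real (Suc j) \<and> \<eta> < \<bar>H (fst p) \<omega> - H (snd p) \<omega>\<bar>"
      by (intro bexI[of _ "(a, b)"]) auto
  qed
  have "(\<Inter>j. B j) = {}"
  proof (rule ccontr)
    assume "(\<Inter>j. B j) \<noteq> {}"
    then obtain \<omega> where w: "\<And>j. \<omega> \<in> B j" by blast
    then have ws: "\<omega> \<in> space G" by (auto simp: B_def)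
    have "uniformly_continuous_on K (\<lambda>\<theta>. H \<theta> \<omega>)" by (rule compact_uniformly_continuous[OF cont[OF ws] K])
    then obtain d where d: "d > 0" "\<And>x x'. x \<in> K \<Longrightarrow> x' \<in> K \<Longrightarrow> dist x' x < d \<Longrightarrow> dist (H x' \<omega>) (H x \<omega>) < \<eta>"
      unfolding uniformly_continuous_on_def using \<eta> by metis
    obtain j where "inverse (real (Suc j)) < d" using reals_Archimedean[OF d(1)] by blast
    then have j: "1 / real (Suc j) < d" by (simp add: inverse_eq_divide)
    obtain p where "p \<in> D \<times> D" "norm (fst p - snd p) < 1 / Suc j" "\<bar>H (fst p) \<omega> - H (snd p) \<omega>\<bar> > \<eta>"
      using w[of j] unfolding B_def by blast
    moreover have "dist (H (fst p) \<omega>) (H (snd p) \<omega>) < \<eta>"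
      using calculation j D(2) by (intro d(2)) (auto simp: dist_norm)
    ultimately show False by (simp add: dist_real_def)
  qed
  then have "(\<lambda>j. prob (B j)) \<longlonglongrightarrow> 0"
    using finite_Lim_measure_decseq[of B] Bm dec by (simp add: image_subset_iff)
  then have "\<forall>\<^sub>F j in sequentially. prob (B j) < \<eta>" using \<eta> by (rule order_tendstoD(2))
  then obtain j where j: "prob (B j) < \<eta>" by (auto simp: eventually_sequentially)
  show ?thesis
  proof (rule that[of "1 / Suc j" "B j"])
    fix \<omega> \<theta> \<theta>' assume w: "\<omega> \<in> space G - B j" and t: "\<theta> \<in> K" "\<theta>' \<in> K" "norm (\<theta> - \<theta>') < 1 / Suc j"
    obtain s where s: "\<And>k. s k \<in> D" "s \<longlonglongrightarrow> \<theta>" using D(3) t(1) closure_sequential[of \<theta> D] by blast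
    obtain s' where s': "\<And>k. s' k \<in> D" "s' \<longlonglongrightarrow> \<theta>'" using D(3) t(2) closure_sequential[of \<theta>' D] by blast
    have c: "(\<lambda>k. H (s k) \<omega>) \<longlonglongrightarrow> H \<theta> \<omega>" "(\<lambda>k. H (s' k) \<omega>) \<longlonglongrightarrow> H \<theta>' \<omega>"
      using cont[of \<omega>] w s s' t(1,2) D(2) unfolding continuous_on_sequentially comp_def by blast+
    then have lim: "(\<lambda>k. \<bar>H (s k) \<omega> - H (s' k) \<omega>\<bar>) \<longlonglongrightarrow> \<bar>H \<theta> \<omega> - H \<theta>' \<omega>\<bar>" by (intro tendsto_intros)
    have "(\<lambda>k. norm (s k - s' k)) \<longlonglongrightarrow> norm (\<theta> - \<theta>')" using s(2) s'(2) by (intro tendsto_intros)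
    then have "\<forall>\<^sub>F k in sequentially. norm (s k - s' k) < 1 / Suc j" using t(3) by (rule order_tendstoD(2))
    then have "\<forall>\<^sub>F k in sequentially. \<bar>H (s k) \<omega> - H (s' k) \<omega>\<bar> \<le> \<eta>"
    proof (rule eventually_mono)
      fix k assume "norm (s k - s' k) < 1 / Suc j"
      then show "\<bar>H (s k) \<omega> - H (s' k) \<omega>\<bar> \<le> \<eta>"
        using w s(1)[of k] s'(1)[of k] unfolding B_def by (force simp: not_less)
    qed
    then show "\<bar>H \<theta> \<omega> - H \<theta>' \<omega>\<bar> \<le> \<eta>" by (rule tendsto_upperbound[OF lim]) simp
  qed (use Bm j in auto)
qed

section \<open>Minimizers of the limiting objective\<close>

definition argmins :: "'t set \<Rightarrow> ('t \<Rightarrow> real) \<Rightarrow> 't set" where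
  "argmins \<Theta> f = {\<theta>\<in>\<Theta>. \<forall>\<theta>'\<in>\<Theta>. f \<theta> \<le> f \<theta>'}"

lemma argmins_compact:
  fixes \<Theta> :: "'t::real_normed_vector set"
  assumes "compact \<Theta>" "\<Theta> \<noteq> {}" "continuous_on \<Theta> f"
  shows "compact (argmins \<Theta> f)" "argmins \<Theta> f \<noteq> {}" "argmins \<Theta> f \<subseteq> \<Theta>"
    "\<theta> \<in> argmins \<Theta> f \<Longrightarrow> f \<theta> = (INF \<theta>\<in>\<Theta>. f \<theta>)"
proof -
  obtain t0 where t0: "t0 \<in> \<Theta>" "\<forall>\<theta>\<in>\<Theta>. f t0 \<le> f \<theta>" using continuous_attains_inf[OF assms] by blast
  then show "argmins \<Theta> f \<noteq> {}" by (auto simp: argmins_def)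
  have "argmins \<Theta> f = \<Theta> \<inter> f -` {..f t0}" using t0 by (force simp: argmins_def)
  moreover have "closed (\<Theta> \<inter> f -` {..f t0})"
    by (rule continuous_closed_preimage[OF assms(3) compact_imp_closed[OF assms(1)] closed_atMost])
  ultimately show "compact (argmins \<Theta> f)" using assms(1) by (metis Int_absorb1 Int_lower1 closed_Int_compact inf.commute)
  show "argmins \<Theta> f \<subseteq> \<Theta>" by (auto simp: argmins_def)
  show "\<theta> \<in> argmins \<Theta> f \<Longrightarrow> f \<theta> = (INF \<theta>\<in>\<Theta>. f \<theta>)"
    by (intro antisym cINF_greatest cINF_lower assms bdd_belowI2) (auto simp: argmins_def)
qed

text \<open>The points of \<Theta> at distance at least \<open>d\<close> from all minimizers form a
  compact set, on which \<open>f\<close> attains a least value above its minimum over \<Theta>. If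
  this set is empty, any positive \<gamma> will do.\<close>

lemma argmins_separated:
  fixes \<Theta> :: "'t::real_normed_vector set"
  assumes "compact \<Theta>" "\<Theta> \<noteq> {}" "continuous_on \<Theta> f" "d > 0"
  obtains \<gamma> where "\<gamma> > 0" "\<And>\<theta>. \<theta> \<in> \<Theta> \<Longrightarrow> (\<forall>\<theta>'\<in>argmins \<Theta> f. norm (\<theta> - \<theta>') \<ge> d) \<Longrightarrow> f \<theta> \<ge> (INF \<theta>\<in>\<Theta>. f \<theta>) + \<gamma>"
proof -
  let ?A = "argmins \<Theta> f"
  note A = argmins_compact[OF assms(1-3)]
  define R where "R = \<Theta> - (\<Union>\<theta>'\<in>?A. ball \<theta>' d)"
  have R: "compact R" unfolding R_def by (intro compact_diff assms(1) open_UN ballI open_ball)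
  show ?thesis
  proof (cases "R = {}")
    case True
    show ?thesis
    proof (rule that[of 1])
      fix \<theta> assume "\<theta> \<in> \<Theta>" "\<forall>\<theta>'\<in>?A. norm (\<theta> - \<theta>') \<ge> d"
      then have "\<theta> \<in> R" by (auto simp: R_def dist_norm norm_minus_commute not_less)
      then show "f \<theta> \<ge> (INF \<theta>\<in>\<Theta>. f \<theta>) + 1" using True by blast
    qed simp
  next
    case False
    have "continuous_on R f" using assms(3) by (rule continuous_on_subset) (auto simp: R_def)
    then obtain r where r: "r \<in> R" "\<forall>\<theta>\<in>R. f r \<le> f \<theta>" using continuous_attains_inf[OF R False] by blast
    obtain t0 where t0: "t0 \<in> ?A" using A(2) by blast
    have "r \<notin> ?A" using r(1) assms(4) by (auto simp: R_def)
    then obtain \<theta>' where "\<theta>' \<in> \<Theta>" "f \<theta>' < f r" using r(1) by (auto simp: argmins_def R_def not_le)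
    then have "f t0 < f r" using t0 by (force simp: argmins_def)
    then have g: "f r - (INF \<theta>\<in>\<Theta>. f \<theta>) > 0" using A(4)[OF t0] by simp
    show ?thesis
    proof (rule that[OF g])
      fix \<theta> assume "\<theta> \<in> \<Theta>" "\<forall>\<theta>'\<in>?A. norm (\<theta> - \<theta>') \<ge> d"
      then have "\<theta> \<in> R" by (auto simp: R_def dist_norm norm_minus_commute not_less)
      then show "f \<theta> \<ge> (INF \<theta>\<in>\<Theta>. f \<theta>) + (f r - (INF \<theta>\<in>\<Theta>. f \<theta>))" using r(2) by simp
    qed
  qed
qed

text \<open>Away from the minimizers of \<open>f\<close> the drift \<open>s n * (f \<theta> - min f)\<close> dominates; near them it is
  nonnegative and \<open>H n\<close> is close to its values at finitely many points.\<close>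

lemma inf_process_conv:
  fixes \<Theta> :: "'t::{second_countable_topology,real_normed_vector} set"
    and F H :: "nat \<Rightarrow> 't \<Rightarrow> 'w \<Rightarrow> real" and H' :: "'t \<Rightarrow> 'v \<Rightarrow> real" and f k :: "'t \<Rightarrow> real"
  assumes M: "prob_space M" and G: "prob_space G" and Theta: "compact \<Theta>" "\<Theta> \<noteq> {}"
    and f: "continuous_on \<Theta> f" and k: "continuous_on \<Theta> k"
    and s: "filterlim s at_top sequentially"
    and V: "\<And>n. n \<ge> 1 \<Longrightarrow> (\<lambda>\<omega>. INF \<theta>\<in>\<Theta>. F n \<theta> \<omega>) \<in> borel_measurable M"
    and H: "\<And>n \<theta>. \<theta> \<in> \<Theta> \<Longrightarrow> H n \<theta> \<in> borel_measurable M"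
    and H': "\<And>\<theta>. \<theta> \<in> \<Theta> \<Longrightarrow> H' \<theta> \<in> borel_measurable G"
      "\<And>\<omega>. \<omega> \<in> space G \<Longrightarrow> continuous_on \<Theta> (\<lambda>\<theta>. H' \<theta> \<omega>)"
    and approx: "\<And>\<eta>. \<eta> > 0 \<Longrightarrow> \<forall>\<^sub>F n in sequentially. \<exists>E\<in>sets M. measure M E \<le> \<eta> \<and>
        (\<forall>\<omega>\<in>space M - E. \<forall>\<theta>\<in>\<Theta>. \<bar>s n * (F n \<theta> \<omega> - f \<theta>) - (H n \<theta> \<omega> + k \<theta>)\<bar> \<le> \<eta>)"
    and net: "\<And>\<eta>. \<eta> > 0 \<Longrightarrow> \<exists>\<pi>. (\<forall>\<theta>\<in>\<Theta>. \<pi> \<theta> \<in> \<Theta> \<and> norm (\<pi> \<theta> - \<theta>) \<le> \<eta>) \<and> finite (\<pi> ` \<Theta>) \<and>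
        (\<forall>\<^sub>F n in sequentially. \<exists>E\<in>sets M. measure M E \<le> \<eta> \<and>
          (\<forall>\<omega>\<in>space M - E. \<forall>\<theta>\<in>\<Theta>. \<bar>H n \<theta> \<omega> - H n (\<pi> \<theta>) \<omega>\<bar> \<le> \<eta>))"
    and tight: "\<And>\<eta>. \<eta> > 0 \<Longrightarrow> \<exists>K. \<forall>\<^sub>F n in sequentially. \<exists>E\<in>sets M. measure M E \<le> \<eta> \<and>
          (\<forall>\<omega>\<in>space M - E. \<forall>\<theta>\<in>\<Theta>. \<bar>H n \<theta> \<omega>\<bar> \<le> K)"
    and fidi: "\<And>T a b. finite T \<Longrightarrow> T \<noteq> {} \<Longrightarrow> T \<subseteq> \<Theta> \<Longrightarrow> a < b \<Longrightarrow>
        (\<lambda>n. \<integral>\<omega>. cts_step a b (Min ((\<lambda>\<theta>. H n \<theta> \<omega> + k \<theta>) ` T)) \<partial>M)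
          \<longlonglongrightarrow> (\<integral>\<omega>. cts_step a b (Min ((\<lambda>\<theta>. H' \<theta> \<omega> + k \<theta>) ` T)) \<partial>G)"
  shows "converges_in_distribution M (\<lambda>n \<omega>. s n * ((INF \<theta>\<in>\<Theta>. F n \<theta> \<omega>) - (INF \<theta>\<in>\<Theta>. f \<theta>)))
      G (\<lambda>\<omega>. INF \<theta>\<in>argmins \<Theta> f. H' \<theta> \<omega> + k \<theta>)"
proof -
  let ?A = "argmins \<Theta> f" and ?v = "INF \<theta>\<in>\<Theta>. f \<theta>"
  note A = argmins_compact[OF Theta f]
  define Y where "Y = (\<lambda>\<omega>. INF \<theta>\<in>?A. H' \<theta> \<omega> + k \<theta>)"
  have cA: "continuous_on ?A (\<lambda>\<theta>. H' \<theta> \<omega> + k \<theta>)" if "\<omega> \<in> space G" for \<omega>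
    using H'(2)[OF that] k A(3) by (intro continuous_on_add) (auto intro: continuous_on_subset)
  have Ym: "Y \<in> borel_measurable G"
    unfolding Y_def by (rule borel_measurable_INF_compact[OF A(1,2) _ cA]) (use H'(1) A(3) in auto)
  have Yatt: "\<exists>\<theta>\<in>?A. Y \<omega> = H' \<theta> \<omega> + k \<theta>" if w: "\<omega> \<in> space G" for \<omega>
  proof -
    obtain t where t: "t \<in> ?A" "\<forall>\<theta>\<in>?A. H' t \<omega> + k t \<le> H' \<theta> \<omega> + k \<theta>"
      using continuous_attains_inf[OF A(1,2) cA[OF w]] by blast
    then have "Y \<omega> = H' t \<omega> + k t" unfolding Y_def
      by (intro antisym cINF_lower cINF_greatest A(2) bdd_belowI2) auto
    then show ?thesis using t by blast
  qed
  have Yle: "Y \<omega> \<le> H' \<theta> \<omega> + k \<theta>" if w: "\<omega> \<in> space G" and t: "\<theta> \<in> ?A" for \<omega> \<theta>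
  proof -
    have "bdd_below ((\<lambda>\<theta>. H' \<theta> \<omega> + k \<theta>) ` ?A)"
      using compact_continuous_image[OF cA[OF w] A(1)] by (simp add: bounded_imp_bdd_below compact_imp_bounded)
    then show ?thesis unfolding Y_def by (rule cINF_lower) (rule t)
  qed
  have Minm: "(\<lambda>\<omega>. Min ((\<lambda>\<theta>. W \<theta> \<omega> + k \<theta>) ` T)) \<in> borel_measurable Q"
    if "finite T" "T \<noteq> {}" "\<And>\<theta>. \<theta> \<in> T \<Longrightarrow> W \<theta> \<in> borel_measurable Q" for T W and Q :: "'c measure"
    using that by (intro borel_measurable_Min) auto
  obtain kb where kb: "\<And>\<theta>. \<theta> \<in> \<Theta> \<Longrightarrow> \<bar>k \<theta>\<bar> \<le> kb"
    using compact_imp_bounded[OF compact_continuous_image[OF k Theta(1)]] by (auto simp: bounded_iff)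
  let ?good = "\<lambda>n \<eta> \<pi> K \<theta> \<omega>. \<bar>s n * (F n \<theta> \<omega> - f \<theta>) - (H n \<theta> \<omega> + k \<theta>)\<bar> \<le> \<eta> \<and>
      \<bar>(H n \<theta> \<omega> + k \<theta>) - (H n (\<pi> \<theta>) \<omega> + k (\<pi> \<theta>))\<bar> \<le> 2 * \<eta> \<and> \<bar>H n \<theta> \<omega>\<bar> \<le> K"
  \<comment> \<open>One package of constants and good events, used for the lower and for the upper
    approximation. The distance 2 d appears because a net point within \<open>d\<close> of a
    parameter that is closer than \<open>d\<close> to a minimizer is closer than 2 d to that
    minimizer.\<close>
  have common: "\<exists>d \<pi> E0 K \<gamma>. d > 0 \<and> E0 \<in> sets G \<and> measure G E0 \<le> \<eta> \<and>
      (\<forall>\<omega>\<in>space G - E0. \<forall>\<theta>\<in>\<Theta>. \<forall>\<theta>'\<in>\<Theta>. norm (\<theta> - \<theta>') < 2 * d \<longrightarrow> \<bar>(H' \<theta> \<omega> + k \<theta>) - (H' \<theta>' \<omega> + k \<theta>')\<bar> \<le> 2 * \<eta>) \<and>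
      (\<forall>\<theta>\<in>\<Theta>. \<pi> \<theta> \<in> \<Theta> \<and> norm (\<pi> \<theta> - \<theta>) \<le> d) \<and> finite (\<pi> ` \<Theta>) \<and> \<gamma> > 0 \<and>
      (\<forall>\<theta>\<in>\<Theta>. (\<forall>\<theta>'\<in>?A. norm (\<theta> - \<theta>') \<ge> d) \<longrightarrow> f \<theta> \<ge> ?v + \<gamma>) \<and>
      (\<forall>\<^sub>F n in sequentially. s n > 0 \<and> s n * \<gamma> \<ge> 2 * K + 2 * kb + \<eta> \<and> (\<exists>E\<in>sets M. measure M E \<le> 3 * \<eta> \<and> (\<forall>\<omega>\<in>space M - E. \<forall>\<theta>\<in>\<Theta>.
         ?good n \<eta> \<pi> K \<theta> \<omega>)))"
    if \<eta>: "\<eta> > 0" for \<eta>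
  proof -
    obtain d1 E0 where d1: "d1 > 0" "E0 \<in> sets G" "measure G E0 \<le> \<eta>"
      "\<And>\<omega> \<theta> \<theta>'. \<lbrakk>\<omega> \<in> space G - E0; \<theta> \<in> \<Theta>; \<theta>' \<in> \<Theta>; norm (\<theta> - \<theta>') < d1\<rbrakk> \<Longrightarrow> \<bar>H' \<theta> \<omega> - H' \<theta>' \<omega>\<bar> \<le> \<eta>"
      using stochastic_modulus[OF G Theta(1) H' \<eta>] by blast
    have "uniformly_continuous_on \<Theta> k" by (rule compact_uniformly_continuous[OF k Theta(1)])
    then obtain d2 where d2: "d2 > 0" "\<And>x x'. x \<in> \<Theta> \<Longrightarrow> x' \<in> \<Theta> \<Longrightarrow> norm (x' - x) < d2 \<Longrightarrow> \<bar>k x' - k x\<bar> < \<eta>"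
      unfolding uniformly_continuous_on_def dist_norm using \<eta> by (metis real_norm_def)
    define d where "d = min d1 d2 / 2"
    have d: "d > 0" "2 * d \<le> d1" "2 * d \<le> d2" using d1(1) d2(1) by (auto simp: d_def)
    \<comment> \<open>The net must be fine in distance (\<open>d\<close>) as well as in the
      oscillation of \<open>H\<close> (\<eta>), hence the minimum.\<close>
    define \<eta>' where "\<eta>' = min d \<eta>"
    have \<eta>': "\<eta>' > 0" "\<eta>' \<le> d" "\<eta>' \<le> \<eta>" using d \<eta> by (auto simp: \<eta>'_def)
    obtain \<pi> where p: "\<forall>\<theta>\<in>\<Theta>. \<pi> \<theta> \<in> \<Theta> \<and> norm (\<pi> \<theta> - \<theta>) \<le> \<eta>'" "finite (\<pi> ` \<Theta>)"
      "\<forall>\<^sub>F n in sequentially. \<exists>E\<in>sets M. measure M E \<le> \<eta>' \<and>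
          (\<forall>\<omega>\<in>space M - E. \<forall>\<theta>\<in>\<Theta>. \<bar>H n \<theta> \<omega> - H n (\<pi> \<theta>) \<omega>\<bar> \<le> \<eta>')"
      using net[OF \<eta>'(1)] by blast
    obtain K where K: "\<forall>\<^sub>F n in sequentially. \<exists>E\<in>sets M. measure M E \<le> \<eta> \<and>
          (\<forall>\<omega>\<in>space M - E. \<forall>\<theta>\<in>\<Theta>. \<bar>H n \<theta> \<omega>\<bar> \<le> K)" using tight[OF \<eta>] by blast
    obtain \<gamma> where g: "\<gamma> > 0" "\<And>\<theta>. \<theta> \<in> \<Theta> \<Longrightarrow> (\<forall>\<theta>'\<in>?A. norm (\<theta> - \<theta>') \<ge> d) \<Longrightarrow> f \<theta> \<ge> ?v + \<gamma>"
      using argmins_separated[OF Theta f d(1)] by blast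
    \<comment> \<open>From here on the drift s n \<gamma> is at least what \<open>H\<close> and
      \<open>k\<close> can contribute at two parameters, K + kb each, plus the approximation error
      \<eta>.\<close>
    have sev: "\<forall>\<^sub>F n in sequentially. s n \<ge> max 1 ((2 * K + 2 * kb + \<eta>) / \<gamma>)"
      using s unfolding filterlim_at_top by blast
    have kd: "\<bar>k \<theta> - k \<theta>'\<bar> \<le> \<eta>" if "\<theta> \<in> \<Theta>" "\<theta>' \<in> \<Theta>" "norm (\<theta> - \<theta>') < 2 * d" for \<theta> \<theta>'
      using d2(2)[of \<theta>' \<theta>] that d(3) by simp
    have ev: "\<forall>\<^sub>F n in sequentially. s n > 0 \<and> s n * \<gamma> \<ge> 2 * K + 2 * kb + \<eta> \<and> (\<exists>E\<in>sets M. measure M E \<le> 3 * \<eta> \<and> (\<forall>\<omega>\<in>space M - E. \<forall>\<theta>\<in>\<Theta>.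
         ?good n \<eta> \<pi> K \<theta> \<omega>))"
      using approx[OF \<eta>] p(3) K sev
    proof eventually_elim
      case (elim n)
      obtain E1 where E1: "E1 \<in> sets M" "measure M E1 \<le> \<eta>"
        "\<forall>\<omega>\<in>space M - E1. \<forall>\<theta>\<in>\<Theta>. \<bar>s n * (F n \<theta> \<omega> - f \<theta>) - (H n \<theta> \<omega> + k \<theta>)\<bar> \<le> \<eta>" using elim(1) by blast
      obtain E2 where E2: "E2 \<in> sets M" "measure M E2 \<le> \<eta>'"
        "\<forall>\<omega>\<in>space M - E2. \<forall>\<theta>\<in>\<Theta>. \<bar>H n \<theta> \<omega> - H n (\<pi> \<theta>) \<omega>\<bar> \<le> \<eta>'" using elim(2) by blast
      obtain E3 where E3: "E3 \<in> sets M" "measure M E3 \<le> \<eta>"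
        "\<forall>\<omega>\<in>space M - E3. \<forall>\<theta>\<in>\<Theta>. \<bar>H n \<theta> \<omega>\<bar> \<le> K" using elim(3) by blast
      have "s n \<ge> 1" using elim(4) by simp
      have "(2 * K + 2 * kb + \<eta>) / \<gamma> \<le> s n" using elim(4) by simp
      then have "2 * K + 2 * kb + \<eta> \<le> s n * \<gamma>" using g(1) by (simp add: pos_divide_le_eq)
      moreover have "measure M (E1 \<union> E2 \<union> E3) \<le> 3 * \<eta>"
        using measure_Un_le[of "E1 \<union> E2" M E3] measure_Un_le[of E1 M E2] E1 E2 E3 \<eta>' by auto
      moreover have "\<bar>(H n \<theta> \<omega> + k \<theta>) - (H n (\<pi> \<theta>) \<omega> + k (\<pi> \<theta>))\<bar> \<le> 2 * \<eta>"
        if "\<omega> \<in> space M - (E1 \<union> E2 \<union> E3)" "\<theta> \<in> \<Theta>" for \<omega> \<theta>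
      proof -
        have "\<bar>H n \<theta> \<omega> - H n (\<pi> \<theta>) \<omega>\<bar> \<le> \<eta>'" using E2(3) that by blast
        moreover have "norm (\<theta> - \<pi> \<theta>) \<le> \<eta>'" using p(1) that(2) by (simp add: norm_minus_commute)
        then have "norm (\<theta> - \<pi> \<theta>) < 2 * d" using \<eta>'(2) d(1) by linarith
        then have "\<bar>k \<theta> - k (\<pi> \<theta>)\<bar> \<le> \<eta>" using kd that(2) p(1) by blast
        ultimately show ?thesis using \<eta>' by linarith
      qed
      ultimately show ?case using \<open>s n \<ge> 1\<close> E1 E2 E3 by (intro conjI bexI[of _ "E1 \<union> E2 \<union> E3"]) auto
    qed
    have mod: "\<forall>\<omega>\<in>space G - E0. \<forall>\<theta>\<in>\<Theta>. \<forall>\<theta>'\<in>\<Theta>. norm (\<theta> - \<theta>') < 2 * d \<longrightarrow> \<bar>(H' \<theta> \<omega> + k \<theta>) - (H' \<theta>' \<omega> + k \<theta>')\<bar> \<le> 2 * \<eta>"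
    proof (intro ballI impI)
      fix \<omega> \<theta> \<theta>' assume t: "\<omega> \<in> space G - E0" "\<theta> \<in> \<Theta>" "\<theta>' \<in> \<Theta>" "norm (\<theta> - \<theta>') < 2 * d"
      have "norm (\<theta> - \<theta>') < d1" using t(4) d(2) by linarith
      then show "\<bar>(H' \<theta> \<omega> + k \<theta>) - (H' \<theta>' \<omega> + k \<theta>')\<bar> \<le> 2 * \<eta>"
        using d1(4)[OF t(1-3)] kd[OF t(2-4)] by linarith
    qed
    have p': "\<forall>\<theta>\<in>\<Theta>. \<pi> \<theta> \<in> \<Theta> \<and> norm (\<pi> \<theta> - \<theta>) \<le> d"
    proof (intro ballI conjI)
      fix \<theta> assume "\<theta> \<in> \<Theta>"
      with p(1) have "\<pi> \<theta> \<in> \<Theta>" "norm (\<pi> \<theta> - \<theta>) \<le> \<eta>'" by auto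
      then show "\<pi> \<theta> \<in> \<Theta>" "norm (\<pi> \<theta> - \<theta>) \<le> d" using \<eta>'(2) by linarith+
    qed
    have g': "\<forall>\<theta>\<in>\<Theta>. (\<forall>\<theta>'\<in>?A. norm (\<theta> - \<theta>') \<ge> d) \<longrightarrow> f \<theta> \<ge> ?v + \<gamma>" using g(2) by blast
    show ?thesis
      by (rule exI[of _ d], rule exI[of _ \<pi>], rule exI[of _ E0], rule exI[of _ K], rule exI[of _ \<gamma>])
         (intro conjI d(1) d1(2,3) mod p' p(2) g(1) g' ev)
  qed
  have "converges_in_distribution M (\<lambda>n \<omega>. s n * ((INF \<theta>\<in>\<Theta>. F n \<theta> \<omega>) - ?v)) G Y"
  proof (rule converges_in_distribution_sandwich[OF M G _ Ym])
    show "(\<lambda>\<omega>. s n * ((INF \<theta>\<in>\<Theta>. F n \<theta> \<omega>) - ?v)) \<in> borel_measurable M" if "n \<ge> 1" for n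
      using V[OF that] by auto
  next
    fix e :: real assume e: "e > 0"
    \<comment> \<open>The bad event has probability at most 3 \<eta>, and the errors \<eta> and 2
      \<eta> of the two approximations add up to the same amount; both must stay below
      \<open>e\<close>.\<close>
    define \<eta> where "\<eta> = e / 4"
    have \<eta>: "\<eta> > 0" "3 * \<eta> \<le> e" using e by (auto simp: \<eta>_def)
    obtain d \<pi> E0 K \<gamma> where S: "d > 0" "E0 \<in> sets G" "measure G E0 \<le> \<eta>"
      "\<forall>\<omega>\<in>space G - E0. \<forall>\<theta>\<in>\<Theta>. \<forall>\<theta>'\<in>\<Theta>. norm (\<theta> - \<theta>') < 2 * d \<longrightarrow> \<bar>(H' \<theta> \<omega> + k \<theta>) - (H' \<theta>' \<omega> + k \<theta>')\<bar> \<le> 2 * \<eta>"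
      "\<forall>\<theta>\<in>\<Theta>. \<pi> \<theta> \<in> \<Theta> \<and> norm (\<pi> \<theta> - \<theta>) \<le> d" "finite (\<pi> ` \<Theta>)" "\<gamma> > 0"
      "\<forall>\<theta>\<in>\<Theta>. (\<forall>\<theta>'\<in>?A. norm (\<theta> - \<theta>') \<ge> d) \<longrightarrow> f \<theta> \<ge> ?v + \<gamma>"
      "\<forall>\<^sub>F n in sequentially. s n > 0 \<and> s n * \<gamma> \<ge> 2 * K + 2 * kb + \<eta> \<and> (\<exists>E\<in>sets M. measure M E \<le> 3 * \<eta> \<and> (\<forall>\<omega>\<in>space M - E. \<forall>\<theta>\<in>\<Theta>.
         ?good n \<eta> \<pi> K \<theta> \<omega>))"
      using common[OF \<eta>(1)] by (elim exE conjE) (rule that; assumption)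
    \<comment> \<open>For the lower bound every parameter counts, so a whole neighbourhood of the
      minimizers has to be represented by net points.\<close>
    define B where "B = {\<theta>\<in>\<Theta>. \<exists>\<theta>'\<in>?A. norm (\<theta> - \<theta>') < d}"
    define T where "T = \<pi> ` B"
    have AB: "?A \<subseteq> B" using A(3) S(1) unfolding B_def by force
    have T: "finite T" "T \<noteq> {}" "T \<subseteq> \<Theta>"
      using finite_subset[OF _ S(6), of T] A(2) AB S(5) by (auto simp: T_def B_def)
    define L where "L = (\<lambda>n \<omega>. Min ((\<lambda>\<theta>. H n \<theta> \<omega> + k \<theta>) ` T))"
    define L' where "L' = (\<lambda>\<omega>. Min ((\<lambda>\<theta>. H' \<theta> \<omega> + k \<theta>) ` T))"
    have low: "\<forall>\<^sub>F n in sequentially. \<exists>E\<in>sets M. measure M E \<le> e \<and> (\<forall>\<omega>\<in>space M - E. L n \<omega> \<le> s n * ((INF \<theta>\<in>\<Theta>. F n \<theta> \<omega>) - ?v) + e)"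
      using S(9)
    proof (rule eventually_mono)
      fix n assume n: "s n > 0 \<and> s n * \<gamma> \<ge> 2 * K + 2 * kb + \<eta> \<and> (\<exists>E\<in>sets M. measure M E \<le> 3 * \<eta> \<and> (\<forall>\<omega>\<in>space M - E. \<forall>\<theta>\<in>\<Theta>.
         ?good n \<eta> \<pi> K \<theta> \<omega>))"
      then obtain E where E: "E \<in> sets M" "measure M E \<le> 3 * \<eta>" and
        a: "\<And>\<omega> \<theta>. \<omega> \<in> space M - E \<Longrightarrow> \<theta> \<in> \<Theta> \<Longrightarrow> ?good n \<eta> \<pi> K \<theta> \<omega>" by blast
      have s0: "s n > 0" and sg: "s n * \<gamma> \<ge> 2 * K + 2 * kb + \<eta>" using n by auto
      have "L n \<omega> \<le> s n * ((INF \<theta>\<in>\<Theta>. F n \<theta> \<omega>) - ?v) + e" if w: "\<omega> \<in> space M - E" for \<omega>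
      proof -
        have "?v + (L n \<omega> - e) / s n \<le> F n \<theta> \<omega>" if t: "\<theta> \<in> \<Theta>" for \<theta>
        proof -
          \<comment> \<open>Near a minimizer \<open>L\<close> is compared with the net point of
            \<theta>, and the drift is dropped as nonnegative. Far away \<theta> has no counterpart
            in \<open>T\<close>, but the drift beats the bounds K + kb on both values
            involved.\<close>
          have key: "L n \<omega> - e \<le> s n * (F n \<theta> \<omega> - f \<theta>) + s n * (f \<theta> - ?v)"
          proof (cases "\<theta> \<in> B")
            case True
            then have "\<pi> \<theta> \<in> T" by (simp add: T_def)
            then have "L n \<omega> \<le> H n (\<pi> \<theta>) \<omega> + k (\<pi> \<theta>)" unfolding L_def using T(1) by (intro Min_le) auto
            moreover have "?v \<le> f \<theta>"
              using A(2,4) t unfolding argmins_def by fastforce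
            then have "0 \<le> s n * (f \<theta> - ?v)" using s0 by simp
            ultimately show ?thesis using a[OF w t] \<eta>(2) by linarith
          next
            case False
            then have "f \<theta> \<ge> ?v + \<gamma>" using S(8) t unfolding B_def by (auto simp: not_less)
            then have "s n * \<gamma> \<le> s n * (f \<theta> - ?v)" using s0 by (intro mult_left_mono) auto
            moreover obtain t0 where t0: "t0 \<in> T" using T(2) by blast
            then have "L n \<omega> \<le> H n t0 \<omega> + k t0" unfolding L_def using T(1) by (intro Min_le) auto
            moreover have "t0 \<in> \<Theta>" using t0 T(3) by blast
            then have "\<bar>H n t0 \<omega>\<bar> \<le> K" "\<bar>k t0\<bar> \<le> kb" using a[OF w] kb by auto
            ultimately show ?thesis using a[OF w t] kb[OF t] sg e by linarith
          qed
          have "s n * (F n \<theta> \<omega> - f \<theta>) + s n * (f \<theta> - ?v) = s n * (F n \<theta> \<omega> - ?v)" by (simp add: algebra_simps)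
          then have "(L n \<omega> - e) / s n \<le> F n \<theta> \<omega> - ?v" using key s0 by (simp add: pos_divide_le_eq mult.commute)
          then show ?thesis by linarith
        qed
        then have "?v + (L n \<omega> - e) / s n \<le> (INF \<theta>\<in>\<Theta>. F n \<theta> \<omega>)" by (intro cINF_greatest Theta(2))
        then have "(L n \<omega> - e) / s n \<le> (INF \<theta>\<in>\<Theta>. F n \<theta> \<omega>) - ?v" by linarith
        then show ?thesis using s0 by (simp add: pos_divide_le_eq mult.commute)
      qed
      then show "\<exists>E\<in>sets M. measure M E \<le> e \<and> (\<forall>\<omega>\<in>space M - E. L n \<omega> \<le> s n * ((INF \<theta>\<in>\<Theta>. F n \<theta> \<omega>) - ?v) + e)"
        using E \<eta>(2) by (intro bexI[of _ E]) auto
    qed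
    have low': "\<exists>E\<in>sets G. measure G E \<le> e \<and> (\<forall>\<omega>\<in>space G - E. Y \<omega> \<le> L' \<omega> + e)"
    proof (intro bexI[of _ E0] conjI ballI S(2))
      show "measure G E0 \<le> e" using S(3) \<eta> by linarith
      fix \<omega> assume w: "\<omega> \<in> space G - E0"
      have "Y \<omega> - e \<le> H' t \<omega> + k t" if t: "t \<in> T" for t
      proof -
        obtain \<theta> \<theta>' where th: "t = \<pi> \<theta>" "\<theta> \<in> \<Theta>" "\<theta>' \<in> ?A" "norm (\<theta> - \<theta>') < d" using t by (auto simp: T_def B_def)
        have "norm (t - \<theta>') \<le> norm (\<pi> \<theta> - \<theta>) + norm (\<theta> - \<theta>')"
          using norm_triangle_ineq[of "\<pi> \<theta> - \<theta>" "\<theta> - \<theta>'"] th(1) by simp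
        moreover have "norm (\<pi> \<theta> - \<theta>) \<le> d" using S(5) th(2) by blast
        ultimately have "norm (t - \<theta>') < 2 * d" using th(4) by linarith
        then have "\<bar>(H' t \<omega> + k t) - (H' \<theta>' \<omega> + k \<theta>')\<bar> \<le> 2 * \<eta>" using S(4) w T(3) t th(3) A(3) by blast
        moreover have "Y \<omega> \<le> H' \<theta>' \<omega> + k \<theta>'" using Yle th(3) w by blast
        ultimately show ?thesis using \<eta> by linarith
      qed
      then have "Y \<omega> - e \<le> L' \<omega>" unfolding L'_def using T by (subst Min_ge_iff) auto
      then show "Y \<omega> \<le> L' \<omega> + e" by linarith
    qed
    show "\<exists>L L'. (\<forall>n. L n \<in> borel_measurable M) \<and> L' \<in> borel_measurable G \<and>
        (\<forall>a b. a < b \<longrightarrow> (\<lambda>n. \<integral>\<omega>. cts_step a b (L n \<omega>) \<partial>M) \<longlonglongrightarrow> (\<integral>\<omega>. cts_step a b (L' \<omega>) \<partial>G)) \<and>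
        (\<forall>\<^sub>F n in sequentially. \<exists>E\<in>sets M. measure M E \<le> e \<and> (\<forall>\<omega>\<in>space M - E. L n \<omega> \<le> s n * ((INF \<theta>\<in>\<Theta>. F n \<theta> \<omega>) - ?v) + e)) \<and>
        (\<exists>E\<in>sets G. measure G E \<le> e \<and> (\<forall>\<omega>\<in>space G - E. Y \<omega> \<le> L' \<omega> + e))"
    proof (intro exI[of _ L] exI[of _ L'] conjI allI impI low low')
      show "L n \<in> borel_measurable M" for n unfolding L_def by (rule Minm[OF T(1,2)]) (use H T(3) in blast)
      show "L' \<in> borel_measurable G" unfolding L'_def by (rule Minm[OF T(1,2)]) (use H'(1) T(3) in blast)
      show "(\<lambda>n. \<integral>\<omega>. cts_step a b (L n \<omega>) \<partial>M) \<longlonglongrightarrow> (\<integral>\<omega>. cts_step a b (L' \<omega>) \<partial>G)" if "a < b" for a b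
        unfolding L_def L'_def by (rule fidi[OF T that])
    qed
  next
    fix e :: real assume e: "e > 0"
    define \<eta> where "\<eta> = e / 4"
    have \<eta>: "\<eta> > 0" "3 * \<eta> \<le> e" using e by (auto simp: \<eta>_def)
    obtain d \<pi> E0 K \<gamma> where S: "d > 0" "E0 \<in> sets G" "measure G E0 \<le> \<eta>"
      "\<forall>\<omega>\<in>space G - E0. \<forall>\<theta>\<in>\<Theta>. \<forall>\<theta>'\<in>\<Theta>. norm (\<theta> - \<theta>') < 2 * d \<longrightarrow> \<bar>(H' \<theta> \<omega> + k \<theta>) - (H' \<theta>' \<omega> + k \<theta>')\<bar> \<le> 2 * \<eta>"
      "\<forall>\<theta>\<in>\<Theta>. \<pi> \<theta> \<in> \<Theta> \<and> norm (\<pi> \<theta> - \<theta>) \<le> d" "finite (\<pi> ` \<Theta>)" "\<gamma> > 0"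
      "\<forall>\<^sub>F n in sequentially. s n > 0 \<and> s n * \<gamma> \<ge> 2 * K + 2 * kb + \<eta> \<and> (\<exists>E\<in>sets M. measure M E \<le> 3 * \<eta> \<and> (\<forall>\<omega>\<in>space M - E. \<forall>\<theta>\<in>\<Theta>.
         ?good n \<eta> \<pi> K \<theta> \<omega>))"
      using common[OF \<eta>(1)] by (elim exE conjE) (rule that; assumption)
    \<comment> \<open>For the upper bound the infimum may be restricted to minimizers of
      \<open>f\<close>, where the drift vanishes, so net points of minimizers are enough.\<close>
    define T where "T = \<pi> ` ?A"
    have T: "finite T" "T \<noteq> {}" "T \<subseteq> \<Theta>"
      using finite_subset[OF _ S(6), of T] A(2,3) S(5) by (auto simp: T_def)
    define U where "U = (\<lambda>n \<omega>. Min ((\<lambda>\<theta>. H n \<theta> \<omega> + k \<theta>) ` T))"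
    define U' where "U' = (\<lambda>\<omega>. Min ((\<lambda>\<theta>. H' \<theta> \<omega> + k \<theta>) ` T))"
    have up: "\<forall>\<^sub>F n in sequentially. \<exists>E\<in>sets M. measure M E \<le> e \<and> (\<forall>\<omega>\<in>space M - E. s n * ((INF \<theta>\<in>\<Theta>. F n \<theta> \<omega>) - ?v) \<le> U n \<omega> + e)"
      using S(8)
    proof (rule eventually_mono)
      fix n assume n: "s n > 0 \<and> s n * \<gamma> \<ge> 2 * K + 2 * kb + \<eta> \<and> (\<exists>E\<in>sets M. measure M E \<le> 3 * \<eta> \<and> (\<forall>\<omega>\<in>space M - E. \<forall>\<theta>\<in>\<Theta>.
         ?good n \<eta> \<pi> K \<theta> \<omega>))"
      then obtain E where E: "E \<in> sets M" "measure M E \<le> 3 * \<eta>" and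
        a: "\<And>\<omega> \<theta>. \<omega> \<in> space M - E \<Longrightarrow> \<theta> \<in> \<Theta> \<Longrightarrow> ?good n \<eta> \<pi> K \<theta> \<omega>" by blast
      have s0: "s n > 0" using n by auto
      obtain fb where fb: "\<And>\<theta>. \<theta> \<in> \<Theta> \<Longrightarrow> \<bar>f \<theta>\<bar> \<le> fb"
        using compact_imp_bounded[OF compact_continuous_image[OF f Theta(1)]] by (auto simp: bounded_iff)
      have "s n * ((INF \<theta>\<in>\<Theta>. F n \<theta> \<omega>) - ?v) \<le> U n \<omega> + e" if w: "\<omega> \<in> space M - E" for \<omega>
      proof -
        \<comment> \<open>A real-valued infimum is known to lie below its members only if these are
          bounded below, which holds on the good event.\<close>
        have bdd: "bdd_below ((\<lambda>\<theta>. F n \<theta> \<omega>) ` \<Theta>)"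
        proof (rule bdd_belowI2)
          fix \<theta> assume t: "\<theta> \<in> \<Theta>"
          have "- (K + kb + \<eta>) \<le> s n * (F n \<theta> \<omega> - f \<theta>)" using a[OF w t] kb[OF t] by linarith
          then have "- (K + kb + \<eta>) / s n \<le> F n \<theta> \<omega> - f \<theta>" using s0 by (simp add: pos_divide_le_eq mult.commute)
          then show "- (K + kb + \<eta>) / s n - fb \<le> F n \<theta> \<omega>" using fb[OF t] by linarith
        qed
        have "U n \<omega> \<in> (\<lambda>\<theta>. H n \<theta> \<omega> + k \<theta>) ` T" unfolding U_def using T by (intro Min_in) auto
        then obtain \<theta> where t: "\<theta> \<in> ?A" "U n \<omega> = H n (\<pi> \<theta>) \<omega> + k (\<pi> \<theta>)" by (auto simp: T_def)
        have t': "\<theta> \<in> \<Theta>" using t A(3) by blast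
        have "(INF \<theta>\<in>\<Theta>. F n \<theta> \<omega>) \<le> F n \<theta> \<omega>" by (rule cINF_lower[OF bdd t'])
        then have "s n * ((INF \<theta>\<in>\<Theta>. F n \<theta> \<omega>) - ?v) \<le> s n * (F n \<theta> \<omega> - f \<theta>)"
          using s0 A(4)[OF t(1)] by (intro mult_left_mono) auto
        then show ?thesis using a[OF w t'] t(2) \<eta>(2) by linarith
      qed
      then show "\<exists>E\<in>sets M. measure M E \<le> e \<and> (\<forall>\<omega>\<in>space M - E. s n * ((INF \<theta>\<in>\<Theta>. F n \<theta> \<omega>) - ?v) \<le> U n \<omega> + e)"
        using E \<eta>(2) by (intro bexI[of _ E]) auto
    qed
    have up': "\<exists>E\<in>sets G. measure G E \<le> e \<and> (\<forall>\<omega>\<in>space G - E. U' \<omega> \<le> Y \<omega> + e)"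
    proof (intro bexI[of _ E0] conjI ballI S(2))
      show "measure G E0 \<le> e" using S(3) \<eta> by linarith
      fix \<omega> assume w: "\<omega> \<in> space G - E0"
      then obtain \<theta> where t: "\<theta> \<in> ?A" "Y \<omega> = H' \<theta> \<omega> + k \<theta>" using Yatt by blast
      have t': "\<theta> \<in> \<Theta>" "\<pi> \<theta> \<in> \<Theta>" using t A(3) S(5) by auto
      have "norm (\<pi> \<theta> - \<theta>) < 2 * d" using S(1,5) t'(1) by force
      then have "\<bar>(H' (\<pi> \<theta>) \<omega> + k (\<pi> \<theta>)) - (H' \<theta> \<omega> + k \<theta>)\<bar> \<le> 2 * \<eta>" using S(4) w t' by blast
      moreover have "U' \<omega> \<le> H' (\<pi> \<theta>) \<omega> + k (\<pi> \<theta>)"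
        unfolding U'_def using T(1) t(1) by (intro Min_le) (auto simp: T_def)
      ultimately show "U' \<omega> \<le> Y \<omega> + e" using t(2) \<eta> by linarith
    qed
    show "\<exists>U U'. (\<forall>n. U n \<in> borel_measurable M) \<and> U' \<in> borel_measurable G \<and>
        (\<forall>a b. a < b \<longrightarrow> (\<lambda>n. \<integral>\<omega>. cts_step a b (U n \<omega>) \<partial>M) \<longlonglongrightarrow> (\<integral>\<omega>. cts_step a b (U' \<omega>) \<partial>G)) \<and>
        (\<forall>\<^sub>F n in sequentially. \<exists>E\<in>sets M. measure M E \<le> e \<and> (\<forall>\<omega>\<in>space M - E. s n * ((INF \<theta>\<in>\<Theta>. F n \<theta> \<omega>) - ?v) \<le> U n \<omega> + e)) \<and>
        (\<exists>E\<in>sets G. measure G E \<le> e \<and> (\<forall>\<omega>\<in>space G - E. U' \<omega> \<le> Y \<omega> + e))"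
    proof (intro exI[of _ U] exI[of _ U'] conjI allI impI up up')
      show "U n \<in> borel_measurable M" for n unfolding U_def by (rule Minm[OF T(1,2)]) (use H T(3) in blast)
      show "U' \<in> borel_measurable G" unfolding U'_def by (rule Minm[OF T(1,2)]) (use H'(1) T(3) in blast)
      show "(\<lambda>n. \<integral>\<omega>. cts_step a b (U n \<omega>) \<partial>M) \<longlonglongrightarrow> (\<integral>\<omega>. cts_step a b (U' \<omega>) \<partial>G)" if "a < b" for a b
        unfolding U_def U'_def by (rule fidi[OF T that])
    qed
  qed
  then show ?thesis unfolding Y_def .
qed

section \<open>The three scaling regimes\<close>

lemma optset_eq_argmins: "optset P l \<Theta> = argmins \<Theta> (objective P l)"
  by (auto simp: optset_def argmins_def is_arg_min_def not_less)

text \<open>The square root is Hoelder continuous of order 1/2. The variance may vanish away from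
  the minimizers, so no Lipschitz bound is available.\<close>

lemma abs_sqrt_diff_le:
  assumes "0 \<le> a" "0 \<le> b" shows "\<bar>sqrt a - sqrt b\<bar> \<le> sqrt \<bar>a - b\<bar>"
proof -
  have "sqrt x \<le> sqrt y + sqrt \<bar>x - y\<bar>" if "0 \<le> x" "0 \<le> y" for x y
  proof -
    have "sqrt x \<le> sqrt (y + \<bar>x - y\<bar>)" by (intro real_sqrt_le_mono) linarith
    also have "\<dots> \<le> sqrt y + sqrt \<bar>x - y\<bar>" using that by (intro sqrt_add_le_add_sqrt) auto
    finally show ?thesis .
  qed
  from this[OF assms] this[OF assms(2,1)] show ?thesis by (simp add: abs_le_iff abs_minus_commute)
qed

lemma continuous_on_of_norm_bound:
  fixes f :: "'t::real_normed_vector \<Rightarrow> real"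
  assumes "0 \<le> L" "\<And>x y. x \<in> S \<Longrightarrow> y \<in> S \<Longrightarrow> \<bar>f x - f y\<bar> \<le> L * norm (x - y)"
  shows "continuous_on S f"
proof -
  have "L-lipschitz_on S f" using assms by (auto simp: lipschitz_on_def dist_norm)
  then show ?thesis by (rule lipschitz_on_continuous_on)
qed

context iid_sample
begin

text \<open>The empirical variance involves second moments. Through the squares these are governed
  by an empirical process of the same kind, so the same tightness applies.\<close>

lemma lipschitz_family_square:
  assumes "lipschitz_family f \<Theta> C \<psi>" "0 \<le> C"
  shows "lipschitz_family (\<lambda>x \<theta>. (f x \<theta>)\<^sup>2) \<Theta> (C\<^sup>2) (\<lambda>x. 2 * C * \<psi> x)"
proof -
  note f = lipschitz_familyD[OF assms(1)]
  have "\<bar>(f x \<theta>)\<^sup>2 - (f x \<theta>')\<^sup>2\<bar> \<le> 2 * C * \<psi> x * norm (\<theta> - \<theta>')" if "x \<in> space N" "\<theta> \<in> \<Theta>" "\<theta>' \<in> \<Theta>" for x \<theta> \<theta>'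
  proof -
    have "\<bar>(f x \<theta>)\<^sup>2 - (f x \<theta>')\<^sup>2\<bar> = \<bar>f x \<theta> + f x \<theta>'\<bar> * \<bar>f x \<theta> - f x \<theta>'\<bar>"
      by (simp add: power2_eq_square square_diff_square_factored abs_mult)
    also have "\<dots> \<le> (2 * C) * (\<psi> x * norm (\<theta> - \<theta>'))"
      using f(2)[of x \<theta>] f(2)[of x \<theta>'] f(4)[of x \<theta> \<theta>'] that assms(2) by (intro mult_mono) auto
    finally show ?thesis by simp
  qed
  moreover have "\<bar>(f x \<theta>)\<^sup>2\<bar> \<le> C\<^sup>2" if "x \<in> space N" "\<theta> \<in> \<Theta>" for x \<theta>
    using f(2)[OF that] square_le_of_abs_le by simp
  ultimately show ?thesis
    unfolding lipschitz_family_def using f assms(2) by (simp add: power_mult_distrib)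
qed

lemma emp_process_mean:
  assumes "n \<ge> 1"
  shows "(\<Sum>i=1..n. f (X i \<omega>) \<theta>) / real n = (\<integral>x. f x \<theta> \<partial>P) + emp_process f n \<theta> \<omega> / sqrt n"
proof -
  have "emp_process f n \<theta> \<omega> / sqrt n = ((\<Sum>i=1..n. f (X i \<omega>) \<theta>) - real n * (\<integral>x. f x \<theta> \<partial>P)) / real n"
    unfolding emp_process_def by (simp add: sum_subtractf)
  then show ?thesis using assms by (simp add: diff_divide_distrib)
qed

text \<open>Variance is second moment minus squared mean, and both empirical moments deviate from
  the true ones by a process divided by sqrt n. The square root halves the order, and the deviation
  still tends to 0.\<close>

lemma empirical_sd_diff:
  assumes f: "lipschitz_family f \<Theta> C \<psi>" and n: "n \<ge> 1" and \<theta>: "\<theta> \<in> \<Theta>" and \<omega>: "\<omega> \<in> space M"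
    and K: "\<bar>emp_process f n \<theta> \<omega>\<bar> \<le> K1" "\<bar>emp_process (\<lambda>x \<theta>. (f x \<theta>)\<^sup>2) n \<theta> \<omega>\<bar> \<le> K2"
  defines "A \<equiv> (\<Sum>i=1..n. f (X i \<omega>) \<theta>) / real n"
  shows "\<bar>sqrt ((\<Sum>i=1..n. (f (X i \<omega>) \<theta> - A)\<^sup>2) / real n) - sqrt (prob_space.variance P (\<lambda>x. f x \<theta>))\<bar>
    \<le> sqrt ((K2 + 2 * C * K1) / sqrt n)"
proof -
  interpret P: prob_space P by (rule prob_space_P)
  note f' = lipschitz_familyD[OF f]
  have C: "0 \<le> C" using f'(10) \<theta> .
  note f2 = lipschitz_familyD[OF lipschitz_family_square[OF f C]]
  define m where "m = (\<integral>x. f x \<theta> \<partial>P)"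
  define m2 where "m2 = (\<integral>x. (f x \<theta>)\<^sup>2 \<partial>P)"
  define g where "g = emp_process f n \<theta> \<omega>"
  define g2 where "g2 = emp_process (\<lambda>x \<theta>. (f x \<theta>)\<^sup>2) n \<theta> \<omega>"
  have A: "A = m + g / sqrt n" unfolding A_def m_def g_def by (rule emp_process_mean[OF n])
  have Q: "(\<Sum>i=1..n. (f (X i \<omega>) \<theta>)\<^sup>2) / real n = m2 + g2 / sqrt n"
    unfolding m2_def g2_def by (rule emp_process_mean[OF n])
  have "(\<Sum>i=1..n. (f (X i \<omega>) \<theta> - A)\<^sup>2) = (\<Sum>i=1..n. (f (X i \<omega>) \<theta>)\<^sup>2) - 2 * A * (\<Sum>i=1..n. f (X i \<omega>) \<theta>) + real n * A\<^sup>2"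
    by (simp add: power2_diff sum.distrib sum_subtractf sum_distrib_left mult_ac)
  also have "(\<Sum>i=1..n. f (X i \<omega>) \<theta>) = real n * A" using n by (simp add: A_def)
  finally have "(\<Sum>i=1..n. (f (X i \<omega>) \<theta> - A)\<^sup>2) / real n = (\<Sum>i=1..n. (f (X i \<omega>) \<theta>)\<^sup>2) / real n - A\<^sup>2"
    using n by (simp add: diff_divide_distrib add_divide_distrib power2_eq_square)
  then have v1: "(\<Sum>i=1..n. (f (X i \<omega>) \<theta> - A)\<^sup>2) / real n = m2 + g2 / sqrt n - A\<^sup>2" using Q by simp
  have v2: "P.variance (\<lambda>x. f x \<theta>) = m2 - m\<^sup>2"
    using P.variance_eq[OF f'(8)[OF \<theta>] f2(8)[OF \<theta>]] by (simp add: m_def m2_def)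
  have "\<bar>A\<bar> \<le> C"
  proof -
    have "\<bar>\<Sum>i=1..n. f (X i \<omega>) \<theta>\<bar> \<le> (\<Sum>i=1..n. C)"
      using f'(2) X_space[OF _ \<omega>] \<theta> by (intro order_trans[OF sum_abs] sum_mono) auto
    then show ?thesis using n by (simp add: A_def pos_divide_le_eq mult.commute)
  qed
  moreover have "\<bar>m\<bar> \<le> C" unfolding m_def by (rule f'(12)[OF \<theta>])
  ultimately have Am: "\<bar>A + m\<bar> \<le> 2 * C" by linarith
  have "\<bar>A\<^sup>2 - m\<^sup>2\<bar> = \<bar>A + m\<bar> * \<bar>A - m\<bar>" by (simp add: power2_eq_square square_diff_square_factored abs_mult)
  also have "\<dots> \<le> (2 * C) * (K1 / sqrt n)"
    using Am K(1) C by (intro mult_mono) (auto simp: A g_def divide_right_mono)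
  finally have "\<bar>A\<^sup>2 - m\<^sup>2\<bar> \<le> 2 * C * K1 / sqrt n" by simp
  moreover have "\<bar>g2 / sqrt n\<bar> \<le> K2 / sqrt n" using K(2) by (simp add: g2_def divide_right_mono)
  moreover have "(m2 + g2 / sqrt n - A\<^sup>2) - (m2 - m\<^sup>2) = g2 / sqrt n - (A\<^sup>2 - m\<^sup>2)" by simp
  ultimately have "\<bar>(m2 + g2 / sqrt n - A\<^sup>2) - (m2 - m\<^sup>2)\<bar> \<le> K2 / sqrt n + 2 * C * K1 / sqrt n" by linarith
  then have d: "\<bar>(m2 + g2 / sqrt n - A\<^sup>2) - (m2 - m\<^sup>2)\<bar> \<le> (K2 + 2 * C * K1) / sqrt n" by (simp add: add_divide_distrib)
  have "\<bar>sqrt (m2 + g2 / sqrt n - A\<^sup>2) - sqrt (m2 - m\<^sup>2)\<bar> \<le> sqrt \<bar>(m2 + g2 / sqrt n - A\<^sup>2) - (m2 - m\<^sup>2)\<bar>"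
    by (intro abs_sqrt_diff_le) (auto simp: v1[symmetric] v2[symmetric] P.variance_positive intro!: sum_nonneg divide_nonneg_nonneg)
  also have "\<dots> \<le> sqrt ((K2 + 2 * C * K1) / sqrt n)" using d by (rule real_sqrt_le_mono)
  finally show ?thesis unfolding v1 v2 .
qed

end

text \<open>The common part of the three cases: \<open>s\<close> is the normalizing sequence, \<open>b\<close> the limit of
  \<open>s n * sqrt (\<delta> n)\<close>, and \<open>H\<close> the limit of the rescaled empirical process. The family \<open>l'\<close> is a
  version of \<open>l\<close> for which boundedness and Lipschitz continuity hold everywhere.\<close>

lemma robust_optval_conv:
  fixes S :: "(real ^ 'd) set" and \<Theta> :: "(real ^ 'm) set" and H :: "real ^ 'm \<Rightarrow> 'v \<Rightarrow> real"
  assumes iid: "iid_sample M (borel_on S) P X" and S: "closed S" and Theta: "compact \<Theta>" "\<Theta> \<noteq> {}"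
    and l: "continuous_on (S \<times> \<Theta>) (\<lambda>(x, \<theta>). l x \<theta>)"
    and l': "iid_sample.lipschitz_family (borel_on S) P l' \<Theta> C \<psi>" "AE x in P. \<forall>\<theta>\<in>\<Theta>. l x \<theta> = l' x \<theta>"
    and phi: "convex_lsc_divergence \<phi>" and C2: "C2_near \<phi> 1"
    and kappa: "\<kappa> = 2 / second_deriv \<phi> 1" "\<kappa> > 0"
    and delta: "\<And>n. n \<ge> 1 \<Longrightarrow> \<delta> n > 0" "\<delta> \<longlonglongrightarrow> 0"
    and s: "filterlim s at_top sequentially" "\<forall>\<^sub>F n in sequentially. s n / sqrt (real n) \<le> 1"
      "(\<lambda>n. s n * sqrt (\<delta> n)) \<longlonglongrightarrow> b"
    and G: "prob_space G" and H: "\<And>\<theta>. \<theta> \<in> \<Theta> \<Longrightarrow> H \<theta> \<in> borel_measurable G"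
      "\<And>\<omega>. \<omega> \<in> space G \<Longrightarrow> continuous_on \<Theta> (\<lambda>\<theta>. H \<theta> \<omega>)"
    and fidi: "\<And>T x y c. finite T \<Longrightarrow> T \<noteq> {} \<Longrightarrow> T \<subseteq> \<Theta> \<Longrightarrow> x < y \<Longrightarrow>
        (\<lambda>n. \<integral>\<omega>. cts_step x y (Min ((\<lambda>\<theta>. s n / sqrt (real n) * iid_sample.emp_process P X l' n \<theta> \<omega> + c \<theta>) ` T)) \<partial>M)
          \<longlonglongrightarrow> (\<integral>\<omega>. cts_step x y (Min ((\<lambda>\<theta>. H \<theta> \<omega> + c \<theta>) ` T)) \<partial>G)"
  shows "converges_in_distribution M
      (\<lambda>n \<omega>. s n * (robust_optval \<phi> l \<Theta> (empirical (borel_on S) X n \<omega>) (\<delta> n) - optval P l \<Theta>))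
      G (\<lambda>\<omega>. INF \<theta>\<in>optset P l \<Theta>. H \<theta> \<omega> + sqrt \<kappa> * b * loss_sd P l \<theta>)"
proof -
  interpret iid_sample M "borel_on S" P X by fact
  interpret P: prob_space P by (rule prob_space_P)
  note f' = lipschitz_familyD[OF l'(1)]
  have C: "0 \<le> C" using f'(10) Theta(2) by blast
  let ?l2 = "\<lambda>x \<theta>. (l' x \<theta>)\<^sup>2"
  have l2: "lipschitz_family ?l2 \<Theta> (C\<^sup>2) (\<lambda>x. 2 * C * \<psi> x)" by (rule lipschitz_family_square[OF l'(1) C])
  note f2 = lipschitz_familyD[OF l2]
  have lm: "(\<lambda>x. l x \<theta>) \<in> borel_measurable (borel_on S)" if "\<theta> \<in> \<Theta>" for \<theta>
    by (rule borel_measurable_continuous_on_restrict[OF continuous_sections(1)[OF l that]])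
  have f: "objective P l \<theta> = (\<integral>x. l' x \<theta> \<partial>P)" if "\<theta> \<in> \<Theta>" for \<theta>
    unfolding objective_def
    by (rule integral_cong_AE) (use lm f'(1) that l'(2) in \<open>auto elim!: eventually_mono\<close>)
  have var: "loss_var P l \<theta> = P.variance (\<lambda>x. l' x \<theta>)" if t: "\<theta> \<in> \<Theta>" for \<theta>
  proof -
    have e: "(\<integral>x. l x \<theta> \<partial>P) = (\<integral>x. l' x \<theta> \<partial>P)" using f[OF t] by (simp add: objective_def)
    have m: "(\<lambda>x. l x \<theta>) \<in> borel_measurable P" "(\<lambda>x. l' x \<theta>) \<in> borel_measurable P" using lm[OF t] f'(1)[OF t] by simp_all
    show ?thesis unfolding loss_var_def e
    proof (rule integral_cong_AE)
      show "AE x in P. (l x \<theta> - (\<integral>x. l' x \<theta> \<partial>P))\<^sup>2 = (l' x \<theta> - (\<integral>x. l' x \<theta> \<partial>P))\<^sup>2"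
        using l'(2) by (rule eventually_mono) (use t in simp)
    qed (use m in auto)
  qed
  have sd0: "0 \<le> loss_sd P l \<theta>" "loss_sd P l \<theta> \<le> C" if t: "\<theta> \<in> \<Theta>" for \<theta>
  proof -
    have m: "(\<lambda>x. l' x \<theta>) \<in> borel_measurable P" using f'(1)[OF t] by simp
    have b: "AE x in P. \<bar>l' x \<theta>\<bar> \<le> C" by (rule AE_I2) (use f'(2) t in simp)
    show "0 \<le> loss_sd P l \<theta>" unfolding loss_sd_def var[OF t] by (simp add: P.variance_positive)
    show "loss_sd P l \<theta> \<le> C" unfolding loss_sd_def var[OF t] by (rule sd_bounded(2)[OF prob_space_P m b])
  qed
  have cf: "continuous_on \<Theta> (objective P l)"
    by (rule continuous_on_of_norm_bound[OF f'(9)]) (use f'(11) f in simp)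
  have csd: "continuous_on \<Theta> (loss_sd P l)"
  proof -
    have "loss_sd P l \<theta> = sqrt ((\<integral>x. (l' x \<theta>)\<^sup>2 \<partial>P) - (objective P l \<theta>)\<^sup>2)" if t: "\<theta> \<in> \<Theta>" for \<theta>
      unfolding loss_sd_def var[OF t] f[OF t] by (subst P.variance_eq[OF f'(8)[OF t] f2(8)[OF t]]) simp
    moreover have "continuous_on \<Theta> (\<lambda>\<theta>. \<integral>x. (l' x \<theta>)\<^sup>2 \<partial>P)"
      by (rule continuous_on_of_norm_bound[OF f2(9)]) (rule f2(11))
    then have "continuous_on \<Theta> (\<lambda>\<theta>. sqrt ((\<integral>x. (l' x \<theta>)\<^sup>2 \<partial>P) - (objective P l \<theta>)\<^sup>2))"
      using cf by (intro continuous_intros)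
    ultimately show ?thesis by (simp cong: continuous_on_cong)
  qed
  have "AE \<omega> in M. \<forall>i\<ge>1. \<forall>\<theta>\<in>\<Theta>. l (X i \<omega>) \<theta> = l' (X i \<omega>) \<theta>" by (rule AE_X[OF l'(2)])
  \<comment> \<open>Outside this null event \<open>l\<close> and \<open>l'\<close> agree along the
    whole sample, at all parameters simultaneously.\<close>
  then obtain N1 where N1: "N1 \<in> events" "prob N1 = 0"
    "\<And>\<omega> i \<theta>. \<omega> \<in> space M - N1 \<Longrightarrow> i \<ge> 1 \<Longrightarrow> \<theta> \<in> \<Theta> \<Longrightarrow> l (X i \<omega>) \<theta> = l' (X i \<omega>) \<theta>"
  proof (rule AE_E)
    fix N1 assume N: "{\<omega>\<in>space M. \<not> (\<forall>i\<ge>1. \<forall>\<theta>\<in>\<Theta>. l (X i \<omega>) \<theta> = l' (X i \<omega>) \<theta>)} \<subseteq> N1" "emeasure M N1 = 0" "N1 \<in> events"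
    then have "prob N1 = 0" by (simp add: measure_def)
    then show thesis using N by (intro that[of N1]) blast+
  qed
  have sing: "{x} \<in> sets (borel_on S)" if "x \<in> space (borel_on S)" for x
    using that S by (auto simp: sets_restrict_space_iff space_restrict_space)
  let ?F = "\<lambda>n \<theta> \<omega>. robust_objective \<phi> l (empirical (borel_on S) X n \<omega>) \<theta> (\<delta> n)"
  \<comment> \<open>Since s n / sqrt n is eventually at most 1, chaining and tightness of the
    empirical process carry over to its rescaling.\<close>
  let ?H = "\<lambda>n \<theta> \<omega>. s n / sqrt (real n) * emp_process l' n \<theta> \<omega>"
  let ?k = "\<lambda>\<theta>. sqrt \<kappa> * b * loss_sd P l \<theta>"
  have spos: "\<forall>\<^sub>F n in sequentially. s n > 0"
    using s(1) unfolding filterlim_at_top_dense by blast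
  have "converges_in_distribution M (\<lambda>n \<omega>. s n * ((INF \<theta>\<in>\<Theta>. ?F n \<theta> \<omega>) - (INF \<theta>\<in>\<Theta>. objective P l \<theta>)))
      G (\<lambda>\<omega>. INF \<theta>\<in>argmins \<Theta> (objective P l). H \<theta> \<omega> + ?k \<theta>)"
  proof (rule inf_process_conv[where H = ?H, OF prob_space_axioms G Theta cf _ s(1)])
    show "continuous_on \<Theta> ?k" using csd by (intro continuous_intros)
    show "(\<lambda>\<omega>. INF \<theta>\<in>\<Theta>. ?F n \<theta> \<omega>) \<in> borel_measurable M" if "n \<ge> 1" for n
      using robust_optval_measurable[where \<phi> = \<phi> and \<delta> = "\<delta> n", OF X_measurable borel_closed[OF S] Theta l _ that] phi
      by (simp add: robust_optval_def convex_lsc_divergence_def)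
    show "?H n \<theta> \<in> borel_measurable M" if "\<theta> \<in> \<Theta>" for n \<theta>
      using emp_process_measurable[where f = l', OF f'(1)[OF that]] by (intro borel_measurable_times) auto
  next
    fix \<eta> :: real assume \<eta>: "\<eta> > 0"
    define c where "c = \<bar>b\<bar> + 1"
    have c: "c > 0" "b \<le> c" by (simp_all add: c_def)
    \<comment> \<open>Relative accuracy of the expansion: multiplied by the limit \<open>b\<close>
      of s n sqrt (\<delta> n) it must stay below \<eta>. The bound |b| + 1 avoids a division by
      zero when b = 0.\<close>
    define e where "e = \<eta> / 2 / c"
    have e: "e > 0" using \<eta> c by (simp add: e_def)
    have be: "b * e < \<eta>"
    proof -
      have "b * e \<le> c * e" using e c by (intro mult_right_mono) auto
      also have "\<dots> = \<eta> / 2" using c by (simp add: e_def)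
      finally show ?thesis using \<eta> by linarith
    qed
    obtain d where d: "d > 0" and exp: "\<And>\<delta> P (y :: real ^ 'd \<Rightarrow> real). \<lbrakk>0 < \<delta>; \<delta> \<le> d; prob_space P; y \<in> borel_measurable P; AE x in P. \<bar>y x\<bar> \<le> C\<rbrakk> \<Longrightarrow>
       \<bar>(SUP Q\<in>ambiguity_set \<phi> \<delta> P. \<integral>x. y x \<partial>Q)
         - ((\<integral>x. y x \<partial>P) + sqrt \<kappa> * sqrt \<delta> * sqrt (prob_space.variance P y))\<bar> \<le> e * sqrt \<delta>"
      using robust_expansion[OF phi C2 kappa e, where C = C and 'a = "real ^ 'd"] by blast
    have \<eta>2: "\<eta> / 2 > 0" using \<eta> by simp
    obtain K1 where K1: "K1 > 0" "\<And>n. 1 \<le> n \<Longrightarrow> \<exists>A\<in>events. prob A \<le> \<eta> / 2 \<and>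
       (\<forall>\<omega>\<in>space M - A. \<forall>\<theta>\<in>\<Theta>. \<bar>emp_process l' n \<theta> \<omega>\<bar> \<le> K1)"
      using emp_process_tight[OF compact_imp_bounded[OF Theta(1)] l'(1) \<eta>2] by blast
    obtain K2 where K2: "K2 > 0" "\<And>n. 1 \<le> n \<Longrightarrow> \<exists>A\<in>events. prob A \<le> \<eta> / 2 \<and>
       (\<forall>\<omega>\<in>space M - A. \<forall>\<theta>\<in>\<Theta>. \<bar>emp_process ?l2 n \<theta> \<omega>\<bar> \<le> K2)"
      using emp_process_tight[OF compact_imp_bounded[OF Theta(1)] l2 \<eta>2] by blast
    \<comment> \<open>The total error: accuracy of the expansion, empirical versus true standard
      deviation, and s n sqrt (\<delta> n) versus its limit. Only the first summand survives in the
      limit, as b e.\<close>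
    define R where "R = (\<lambda>n. (s n * sqrt (\<delta> n)) * e + sqrt \<kappa> * (s n * sqrt (\<delta> n)) * sqrt ((K2 + 2 * C * K1) / sqrt n)
        + sqrt \<kappa> * \<bar>s n * sqrt (\<delta> n) - b\<bar> * C)"
    have "(\<lambda>n. (K2 + 2 * C * K1) / sqrt (real n)) \<longlonglongrightarrow> 0"
      by (intro tendsto_divide_0[OF tendsto_const] filterlim_at_top_imp_at_infinity
          filterlim_compose[OF sqrt_at_top filterlim_real_sequentially])
    then have "R \<longlonglongrightarrow> b * e + sqrt \<kappa> * b * sqrt 0 + sqrt \<kappa> * \<bar>b - b\<bar> * C"
      unfolding R_def using s(3) by (intro tendsto_intros)
    then have Rlim: "R \<longlonglongrightarrow> b * e" by simp
    show "\<forall>\<^sub>F n in sequentially. \<exists>E\<in>events. prob E \<le> \<eta> \<and>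
        (\<forall>\<omega>\<in>space M - E. \<forall>\<theta>\<in>\<Theta>. \<bar>s n * (?F n \<theta> \<omega> - objective P l \<theta>) - (?H n \<theta> \<omega> + ?k \<theta>)\<bar> \<le> \<eta>)"
      using order_tendstoD(2)[OF Rlim be] order_tendstoD(2)[OF delta(2) d] spos eventually_ge_at_top[of 1]
    proof eventually_elim
      case (elim n)
      have n: "n \<ge> 1" by (rule elim(4))
      obtain A1 where A1: "A1 \<in> events" "prob A1 \<le> \<eta> / 2"
        "\<forall>\<omega>\<in>space M - A1. \<forall>\<theta>\<in>\<Theta>. \<bar>emp_process l' n \<theta> \<omega>\<bar> \<le> K1" using K1(2)[OF n] by blast
      obtain A2 where A2: "A2 \<in> events" "prob A2 \<le> \<eta> / 2"
        "\<forall>\<omega>\<in>space M - A2. \<forall>\<theta>\<in>\<Theta>. \<bar>emp_process ?l2 n \<theta> \<omega>\<bar> \<le> K2" using K2(2)[OF n] by blast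
      show ?case
      proof (intro bexI[of _ "N1 \<union> (A1 \<union> A2)"] conjI ballI)
        show "prob (N1 \<union> (A1 \<union> A2)) \<le> \<eta>"
          using measure_Un_le[OF N1(1) sets.Un[OF A1(1) A2(1)]] measure_Un_le[OF A1(1) A2(1)] A1(2) A2(2) N1(2) by linarith
        show "N1 \<union> (A1 \<union> A2) \<in> events" using N1(1) A1(1) A2(1) by auto
        fix \<omega> \<theta> assume w: "\<omega> \<in> space M - (N1 \<union> (A1 \<union> A2))" and t: "\<theta> \<in> \<Theta>"
        let ?P = "empirical (borel_on S) X n \<omega>"
        have ws: "\<omega> \<in> space M" using w by blast
        have Xs: "X i \<omega> \<in> space (borel_on S)" if "i \<in> {1..n}" for i using X_space[OF _ ws] that by auto
        have lX: "l (X i \<omega>) \<theta> = l' (X i \<omega>) \<theta>" if "i \<in> {1..n}" for i using N1(3)[of \<omega> i \<theta>] w t that by auto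
        define A where "A = (\<Sum>i=1..n. l' (X i \<omega>) \<theta>) / real n"
        define D where "D = sqrt ((\<Sum>i=1..n. (l' (X i \<omega>) \<theta> - A)\<^sup>2) / real n)"
        have setsP: "sets ?P = sets (borel_on S)" by (simp add: empirical_def)
        have mean: "(\<integral>x. l x \<theta> \<partial>?P) = A"
          using integral_empirical[where X = X, OF n Xs lm[OF t]] lX by (simp add: A_def)
        have v: "prob_space.variance ?P (\<lambda>x. l x \<theta>) = (\<Sum>i=1..n. (l' (X i \<omega>) \<theta> - A)\<^sup>2) / real n"
        proof -
          have "(\<lambda>x. (l x \<theta> - A)\<^sup>2) \<in> borel_measurable (borel_on S)" using lm[OF t] by auto
          from integral_empirical[where X = X, OF n Xs this] lX show ?thesis unfolding mean by simp
        qed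
        have "\<bar>?F n \<theta> \<omega> - (A + sqrt \<kappa> * sqrt (\<delta> n) * D)\<bar> \<le> e * sqrt (\<delta> n)"
          unfolding robust_objective_def objective_def D_def v[symmetric] unfolding mean[symmetric]
        proof (rule exp)
          show "prob_space ?P" by (rule prob_space_empirical[where X = X, OF n Xs])
          show "(\<lambda>x. l x \<theta>) \<in> borel_measurable ?P" using lm[OF t] measurable_cong_sets[OF setsP refl] by blast
          show "AE x in ?P. \<bar>l x \<theta>\<bar> \<le> C"
          proof (rule AE_empirical[where X = X, OF n Xs])
            show "\<bar>l (X i \<omega>) \<theta>\<bar> \<le> C" if "i \<in> {1..n}" for i using lX[OF that] f'(2)[OF Xs[OF that] t] by simp
            show "{X i \<omega>} \<in> sets (borel_on S)" if "i \<in> {1..n}" for i by (rule sing[OF Xs[OF that]])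
          qed
        qed (use delta(1)[OF n] elim(2) in auto)
        then have 1: "s n * \<bar>?F n \<theta> \<omega> - (A + sqrt \<kappa> * sqrt (\<delta> n) * D)\<bar> \<le> s n * (e * sqrt (\<delta> n))"
          using elim(3) by (intro mult_left_mono) auto
        have "\<bar>D - sqrt (P.variance (\<lambda>x. l' x \<theta>))\<bar> \<le> sqrt ((K2 + 2 * C * K1) / sqrt n)"
          unfolding D_def A_def using A1(3) A2(3) w t by (intro empirical_sd_diff[OF l'(1) n t ws]) auto
        then have 2: "(sqrt \<kappa> * (s n * sqrt (\<delta> n))) * \<bar>D - loss_sd P l \<theta>\<bar>
            \<le> (sqrt \<kappa> * (s n * sqrt (\<delta> n))) * sqrt ((K2 + 2 * C * K1) / sqrt n)"
          using elim(3) delta(1)[OF n] kappa(2) by (intro mult_left_mono) (auto simp: loss_sd_def var[OF t])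
        have 3: "(sqrt \<kappa> * \<bar>s n * sqrt (\<delta> n) - b\<bar>) * loss_sd P l \<theta> \<le> (sqrt \<kappa> * \<bar>s n * sqrt (\<delta> n) - b\<bar>) * C"
          using sd0[OF t] kappa(2) by (intro mult_left_mono) auto
        have A: "A = objective P l \<theta> + emp_process l' n \<theta> \<omega> / sqrt n"
          unfolding A_def f[OF t] by (rule emp_process_mean[OF n])
        \<comment> \<open>Split so that each summand is one of the three errors collected in
          \<open>R n\<close>.\<close>
        have "s n * (?F n \<theta> \<omega> - objective P l \<theta>) - (?H n \<theta> \<omega> + ?k \<theta>)
            = s n * (?F n \<theta> \<omega> - (A + sqrt \<kappa> * sqrt (\<delta> n) * D)) + (sqrt \<kappa> * (s n * sqrt (\<delta> n))) * (D - loss_sd P l \<theta>)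
              + (sqrt \<kappa> * (s n * sqrt (\<delta> n) - b)) * loss_sd P l \<theta>"
          unfolding A by (simp add: algebra_simps)
        also have "\<bar>\<dots>\<bar> \<le> \<bar>s n * (?F n \<theta> \<omega> - (A + sqrt \<kappa> * sqrt (\<delta> n) * D))\<bar> + \<bar>(sqrt \<kappa> * (s n * sqrt (\<delta> n))) * (D - loss_sd P l \<theta>)\<bar>
              + \<bar>(sqrt \<kappa> * (s n * sqrt (\<delta> n) - b)) * loss_sd P l \<theta>\<bar>" by linarith
        also have "\<dots> = s n * \<bar>?F n \<theta> \<omega> - (A + sqrt \<kappa> * sqrt (\<delta> n) * D)\<bar> + (sqrt \<kappa> * (s n * sqrt (\<delta> n))) * \<bar>D - loss_sd P l \<theta>\<bar>
              + (sqrt \<kappa> * \<bar>s n * sqrt (\<delta> n) - b\<bar>) * loss_sd P l \<theta>"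
          using elim(3) delta(1)[OF n] kappa(2) sd0(1)[OF t] by (simp add: abs_mult)
        also have "\<dots> \<le> R n" using 1 2 3 by (simp add: R_def mult_ac)
        finally show "\<bar>s n * (?F n \<theta> \<omega> - objective P l \<theta>) - (?H n \<theta> \<omega> + ?k \<theta>)\<bar> \<le> \<eta>" using elim(1) by linarith
      qed
    qed
  next
    fix \<eta> :: real assume \<eta>: "\<eta> > 0"
    obtain \<pi> where p: "\<And>\<theta>. \<theta> \<in> \<Theta> \<Longrightarrow> \<pi> \<theta> \<in> \<Theta>" "\<And>\<theta>. \<theta> \<in> \<Theta> \<Longrightarrow> norm (\<pi> \<theta> - \<theta>) \<le> \<eta>" "finite (\<pi> ` \<Theta>)"
      "\<And>n. 1 \<le> n \<Longrightarrow> \<exists>A\<in>events. prob A \<le> \<eta> \<and>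
       (\<forall>\<omega>\<in>space M - A. \<forall>\<theta>\<in>\<Theta>. \<bar>emp_process l' n \<theta> \<omega> - emp_process l' n (\<pi> \<theta>) \<omega>\<bar> \<le> \<eta>)"
      by (rule emp_process_chaining[OF compact_imp_bounded[OF Theta(1)] l'(1) \<eta>]) (rule that; assumption)
    have "\<forall>\<^sub>F n in sequentially. \<exists>E\<in>events. prob E \<le> \<eta> \<and> (\<forall>\<omega>\<in>space M - E. \<forall>\<theta>\<in>\<Theta>. \<bar>?H n \<theta> \<omega> - ?H n (\<pi> \<theta>) \<omega>\<bar> \<le> \<eta>)"
      using spos s(2) eventually_ge_at_top[of 1]
    proof eventually_elim
      case (elim n)
      obtain E where E: "E \<in> events" "prob E \<le> \<eta>"
        "\<forall>\<omega>\<in>space M - E. \<forall>\<theta>\<in>\<Theta>. \<bar>emp_process l' n \<theta> \<omega> - emp_process l' n (\<pi> \<theta>) \<omega>\<bar> \<le> \<eta>" using p(4)[OF elim(3)] by blast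
      have "\<bar>?H n \<theta> \<omega> - ?H n (\<pi> \<theta>) \<omega>\<bar> \<le> \<eta>" if "\<omega> \<in> space M - E" "\<theta> \<in> \<Theta>" for \<omega> \<theta>
      proof -
        have "\<bar>?H n \<theta> \<omega> - ?H n (\<pi> \<theta>) \<omega>\<bar> = s n / sqrt (real n) * \<bar>emp_process l' n \<theta> \<omega> - emp_process l' n (\<pi> \<theta>) \<omega>\<bar>"
          unfolding right_diff_distrib[symmetric] abs_mult using elim(1) by simp
        also have "\<dots> \<le> 1 * \<eta>" using E(3) that elim(1,2) \<eta> by (intro mult_mono) auto
        finally show ?thesis by simp
      qed
      then show ?case using E by blast
    qed
    then show "\<exists>\<pi>. (\<forall>\<theta>\<in>\<Theta>. \<pi> \<theta> \<in> \<Theta> \<and> norm (\<pi> \<theta> - \<theta>) \<le> \<eta>) \<and> finite (\<pi> ` \<Theta>) \<and>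
        (\<forall>\<^sub>F n in sequentially. \<exists>E\<in>events. prob E \<le> \<eta> \<and> (\<forall>\<omega>\<in>space M - E. \<forall>\<theta>\<in>\<Theta>. \<bar>?H n \<theta> \<omega> - ?H n (\<pi> \<theta>) \<omega>\<bar> \<le> \<eta>))"
      using p(1-3) by (intro exI[of _ \<pi>]) simp
  next
    fix \<eta> :: real assume \<eta>: "\<eta> > 0"
    obtain K where K: "K > 0" "\<And>n. 1 \<le> n \<Longrightarrow> \<exists>A\<in>events. prob A \<le> \<eta> \<and>
       (\<forall>\<omega>\<in>space M - A. \<forall>\<theta>\<in>\<Theta>. \<bar>emp_process l' n \<theta> \<omega>\<bar> \<le> K)"
      using emp_process_tight[OF compact_imp_bounded[OF Theta(1)] l'(1) \<eta>] by blast
    have "\<forall>\<^sub>F n in sequentially. \<exists>E\<in>events. prob E \<le> \<eta> \<and> (\<forall>\<omega>\<in>space M - E. \<forall>\<theta>\<in>\<Theta>. \<bar>?H n \<theta> \<omega>\<bar> \<le> K)"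
      using spos s(2) eventually_ge_at_top[of 1]
    proof eventually_elim
      case (elim n)
      obtain E where E: "E \<in> events" "prob E \<le> \<eta>" "\<forall>\<omega>\<in>space M - E. \<forall>\<theta>\<in>\<Theta>. \<bar>emp_process l' n \<theta> \<omega>\<bar> \<le> K"
        using K(2)[OF elim(3)] by blast
      have "\<bar>?H n \<theta> \<omega>\<bar> \<le> K" if "\<omega> \<in> space M - E" "\<theta> \<in> \<Theta>" for \<omega> \<theta>
      proof -
        have "\<bar>?H n \<theta> \<omega>\<bar> = s n / sqrt (real n) * \<bar>emp_process l' n \<theta> \<omega>\<bar>" using elim(1) by (simp add: abs_mult)
        also have "\<dots> \<le> 1 * K" using E(3) that elim(1,2) K(1) by (intro mult_mono) auto
        finally show ?thesis by simp
      qed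
      then show ?case using E by blast
    qed
    then show "\<exists>K. \<forall>\<^sub>F n in sequentially. \<exists>E\<in>events. prob E \<le> \<eta> \<and> (\<forall>\<omega>\<in>space M - E. \<forall>\<theta>\<in>\<Theta>. \<bar>?H n \<theta> \<omega>\<bar> \<le> K)" by blast
  qed (use H fidi in auto)
  then show ?thesis by (simp add: robust_optval_def optval_def optset_eq_argmins)
qed

section \<open>Limits of minima over finitely many parameters\<close>

lemma continuous_on_Min_image:
  fixes c :: "'i \<Rightarrow> real"
  assumes "finite I" "I \<noteq> {}"
  shows "continuous_on UNIV (\<lambda>y :: 'i \<Rightarrow> real. Min ((\<lambda>i. y i + c i) ` I))"
  using assms
proof (induction I rule: finite_ne_induct)
  case (singleton i)
  show ?case by (auto intro!: continuous_intros continuous_on_product_coordinates)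
next
  case (insert i I)
  have "continuous_on UNIV (\<lambda>y :: 'i \<Rightarrow> real. min (y i + c i) (Min ((\<lambda>i. y i + c i) ` I)))"
    by (intro continuous_on_min insert.IH continuous_intros continuous_on_product_coordinates)
  then show ?case using insert.hyps by simp
qed

lemma Min_image_perturb:
  fixes u v :: "'i \<Rightarrow> real"
  assumes "finite T" "T \<noteq> {}" "\<And>t. t \<in> T \<Longrightarrow> u t \<le> v t + e"
  shows "Min (u ` T) \<le> Min (v ` T) + e"
proof -
  have "Min (v ` T) \<in> v ` T" using assms by (intro Min_in) auto
  then obtain t where t: "t \<in> T" "Min (v ` T) = v t" by auto
  have "Min (u ` T) \<le> u t" using assms(1) t by (intro Min_le) auto
  then show ?thesis using assms(3)[OF t(1)] t(2) by linarith
qed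

lemma INF_cmult_left:
  fixes f :: "'t \<Rightarrow> real"
  assumes "A \<noteq> {}" "\<And>x. x \<in> A \<Longrightarrow> 0 \<le> f x" "0 < c"
  shows "(INF x\<in>A. c * f x) = c * (INF x\<in>A. f x)"
proof (rule antisym)
  have b: "bdd_below (f ` A)" "bdd_below ((\<lambda>x. c * f x) ` A)"
    using assms by (auto intro!: bdd_belowI2[where m = 0])
  have "(INF x\<in>A. c * f x) / c \<le> (INF x\<in>A. f x)"
  proof (rule cINF_greatest[OF assms(1)])
    fix x assume "x \<in> A"
    then have "(INF x\<in>A. c * f x) \<le> c * f x" by (rule cINF_lower[OF b(2)])
    then show "(INF x\<in>A. c * f x) / c \<le> f x" using assms(3) by (simp add: pos_divide_le_eq mult.commute)
  qed
  then show "(INF x\<in>A. c * f x) \<le> c * (INF x\<in>A. f x)" using assms(3) by (simp add: pos_divide_le_eq mult.commute)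
  show "c * (INF x\<in>A. f x) \<le> (INF x\<in>A. c * f x)"
    using assms by (intro cINF_greatest mult_left_mono cINF_lower b) auto
qed

context iid_sample
begin

text \<open>\<open>cts_step\<close> of a finite minimum is a bounded continuous function of the
  values. The parameters are numbered by natural numbers to obtain a countable index type.\<close>

lemma emp_process_Min_conv:
  fixes f :: "'x \<Rightarrow> 't::topological_space \<Rightarrow> real"
  assumes f: "\<And>\<theta>. \<theta> \<in> \<Theta> \<Longrightarrow> (\<lambda>x. f x \<theta>) \<in> borel_measurable N"
      "\<And>\<theta> x. \<theta> \<in> \<Theta> \<Longrightarrow> x \<in> space N \<Longrightarrow> \<bar>f x \<theta>\<bar> \<le> C"
    and G: "mean_zero_gaussian_field G \<Theta> g (\<lambda>\<theta> \<theta>'. covar P (\<lambda>x. f x \<theta>) (\<lambda>x. f x \<theta>'))"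
    and T: "finite T" "T \<noteq> {}" "T \<subseteq> \<Theta>" and ab: "a < b"
  shows "(\<lambda>n. \<integral>\<omega>. cts_step a b (Min ((\<lambda>\<theta>. emp_process f n \<theta> \<omega> + k \<theta>) ` T)) \<partial>M)
    \<longlonglongrightarrow> (\<integral>\<omega>. cts_step a b (Min ((\<lambda>\<theta>. g \<theta> \<omega> + k \<theta>) ` T)) \<partial>G)"
proof -
  obtain t :: "nat \<Rightarrow> 't" where t: "bij_betw t {0..<card T} T" using ex_bij_betw_nat_finite[OF T(1)] by blast
  let ?I = "{0..<card T}"
  have tI: "t ` ?I = T" "inj_on t ?I" using t by (auto simp: bij_betw_def)
  have I: "finite ?I" "?I \<noteq> {}" using T by auto
  let ?h = "\<lambda>y. cts_step a b (Min ((\<lambda>i. y i + k (t i)) ` ?I))"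
  have h: "continuous_on UNIV ?h"
    by (rule continuous_on_compose2[OF cts_step_props(5)[OF ab] continuous_on_Min_image[OF I]]) simp
  have hb: "\<bar>?h y\<bar> \<le> 1" for y using cts_step_props(1,2)[OF ab] by (simp add: abs_le_iff order_trans[OF _ cts_step_props(1)[OF ab]])
  have eq: "?h (\<lambda>i. if i \<in> ?I then u (t i) else 0) = cts_step a b (Min ((\<lambda>\<theta>. u \<theta> + k \<theta>) ` T))" for u
  proof -
    have "(\<lambda>i. (if i \<in> ?I then u (t i) else 0) + k (t i)) ` ?I = (\<lambda>\<theta>. u \<theta> + k \<theta>) ` (t ` ?I)"
      unfolding image_image by (rule image_cong) auto
    then show ?thesis by (simp only: tI(1))
  qed
  have "t ` ?I \<subseteq> \<Theta>" using tI T by simp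
  from emp_process_joint_conv[where h = ?h and f = f and \<Theta> = \<Theta> and C = C, OF f(1) f(2) G I(1) tI(2) this h hb]
  show ?thesis unfolding eq[of "\<lambda>\<theta>. emp_process f n \<theta> \<omega>" for n \<omega>] eq[of "\<lambda>\<theta>. g \<theta> \<omega>" for \<omega>] by blast
qed

text \<open>Tightness and a factor tending to 0 make the process uniformly small with high
  probability, so only the deterministic part \<open>k\<close> remains. The constant limit is
  written as an integral over \<open>M\<close> to match the case of a limit process equal to
  0.\<close>

lemma vanishing_process_Min_conv:
  fixes \<Theta> :: "(real ^ 'm) set"
  assumes bdd: "bounded \<Theta>" and f: "lipschitz_family f \<Theta> C \<psi>"
    and c: "c \<longlonglongrightarrow> 0"
    and T: "finite T" "T \<noteq> {}" "T \<subseteq> \<Theta>" and ab: "a < b"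
  shows "(\<lambda>n. \<integral>\<omega>. cts_step a b (Min ((\<lambda>\<theta>. c n * emp_process f n \<theta> \<omega> + k \<theta>) ` T)) \<partial>M)
    \<longlonglongrightarrow> (\<integral>\<omega>. cts_step a b (Min (k ` T)) \<partial>M)"
proof (rule LIMSEQ_I)
  fix r :: real assume r: "r > 0"
  define q where "q = 1 / (b - a) + 1"
  have q: "q > 0" using ab by (simp add: q_def add_pos_pos)
  define \<eta> where "\<eta> = r / 2 / q"
  have \<eta>: "\<eta> > 0" "q * \<eta> = r / 2" using r q by (simp_all add: \<eta>_def)
  obtain K where K: "K > 0" "\<And>n. 1 \<le> n \<Longrightarrow> \<exists>A\<in>events. prob A \<le> \<eta> \<and>
       (\<forall>\<omega>\<in>space M - A. \<forall>\<theta>\<in>\<Theta>. \<bar>emp_process f n \<theta> \<omega>\<bar> \<le> K)"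
    using emp_process_tight[OF bdd f \<eta>(1)] by blast
  have "(\<lambda>n. \<bar>c n\<bar> * K) \<longlonglongrightarrow> \<bar>0\<bar> * K" using c by (intro tendsto_intros)
  then have ev: "\<forall>\<^sub>F n in sequentially. \<bar>c n\<bar> * K < \<eta>" using \<eta>(1) by (intro order_tendstoD(2)) auto
  let ?U = "\<lambda>n \<omega>. Min ((\<lambda>\<theta>. c n * emp_process f n \<theta> \<omega> + k \<theta>) ` T)"
  have Um: "?U n \<in> borel_measurable M" for n
  proof (rule borel_measurable_Min[OF T(1)])
    fix \<theta> assume "\<theta> \<in> T"
    then have "emp_process f n \<theta> \<in> borel_measurable M" using T(3) lipschitz_familyD(1)[OF f] by (intro emp_process_measurable) auto
    then show "(\<lambda>\<omega>. c n * emp_process f n \<theta> \<omega> + k \<theta>) \<in> borel_measurable M" by measurable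
  qed
  have "\<forall>\<^sub>F n in sequentially. norm ((\<integral>\<omega>. cts_step a b (?U n \<omega>) \<partial>M) - (\<integral>\<omega>. cts_step a b (Min (k ` T)) \<partial>M)) < r"
    using ev eventually_ge_at_top[of 1]
  proof eventually_elim
    case (elim n)
    obtain E where E: "E \<in> events" "prob E \<le> \<eta>" "\<forall>\<omega>\<in>space M - E. \<forall>\<theta>\<in>\<Theta>. \<bar>emp_process f n \<theta> \<omega>\<bar> \<le> K" using K(2)[OF elim(2)] by blast
    have small: "\<bar>c n * emp_process f n \<theta> \<omega>\<bar> \<le> \<eta>" if "\<omega> \<in> space M - E" "\<theta> \<in> T" for \<omega> \<theta>
    proof -
      have "\<bar>c n * emp_process f n \<theta> \<omega>\<bar> \<le> \<bar>c n\<bar> * K"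
        unfolding abs_mult using E(3) that T(3) by (intro mult_left_mono) auto
      then show ?thesis using elim(1) by linarith
    qed
    have le1: "?U n \<omega> \<le> Min (k ` T) + \<eta>" and le2: "Min (k ` T) \<le> ?U n \<omega> + \<eta>" if "\<omega> \<in> space M - E" for \<omega>
      using small[OF that] by (intro Min_image_perturb[OF T(1,2)]; force simp: abs_le_iff)+
    have "(\<integral>\<omega>. cts_step a b (Min (k ` T)) \<partial>M) \<le> (\<integral>\<omega>. cts_step a b (?U n \<omega>) \<partial>M) + q * \<eta>"
      unfolding q_def using \<eta> by (intro cts_step_expectation_le[OF prob_space_axioms Um _ ab E(1,2) le1]) auto
    moreover have "(\<integral>\<omega>. cts_step a b (?U n \<omega>) \<partial>M) \<le> (\<integral>\<omega>. cts_step a b (Min (k ` T)) \<partial>M) + q * \<eta>"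
      unfolding q_def using \<eta> by (intro cts_step_expectation_le[OF prob_space_axioms _ Um ab E(1,2) le2]) auto
    ultimately show ?case using \<eta>(2) r unfolding real_norm_def by linarith
  qed
  then show "\<exists>no. \<forall>n\<ge>no. norm ((\<integral>\<omega>. cts_step a b (?U n \<omega>) \<partial>M) - (\<integral>\<omega>. cts_step a b (Min (k ` T)) \<partial>M)) < r"
    by (simp add: eventually_sequentially)
qed

end

theorem theorem4p1:
  fixes S :: "(real ^ 'd) set"
    and \<Theta> :: "(real ^ 'm) set"
    and l :: "real ^ 'd \<Rightarrow> real ^ 'm \<Rightarrow> real"
    and P :: "(real ^ 'd) measure"
    and M :: "'w measure"
    and X :: "nat \<Rightarrow> 'w \<Rightarrow> real ^ 'd"
    and \<phi> :: "real \<Rightarrow> ennreal"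
    and \<kappa> :: real
    and \<delta> :: "nat \<Rightarrow> real"
    and G :: "'v measure"
    and g :: "real ^ 'm \<Rightarrow> 'v \<Rightarrow> real"
  assumes S: "S \<noteq> {}" "closed S"
    and P: "P \<in> Prob S"
    and M: "prob_space M"
    and indep: "prob_space.indep_vars M (\<lambda>_. borel_on S) X {1..}"
    and ident: "\<And>i. i \<ge> 1 \<Longrightarrow> distr M (borel_on S) (X i) = P"
    and Theta: "compact \<Theta>"
    and l: "continuous_on (S \<times> \<Theta>) (\<lambda>(x, \<theta>). l x \<theta>)"
    and phi: "convex_lsc_divergence \<phi>"
    and delta: "antimono_on {1..} \<delta>" "\<And>n. n \<ge> 1 \<Longrightarrow> \<delta> n > 0" "\<delta> \<longlonglongrightarrow> 0"
    and ess_bounded: "\<exists>C. AE x in P. (SUP \<theta>\<in>\<Theta>. \<bar>l x \<theta>\<bar>) \<le> C"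
    and second_moment: "\<exists>\<theta>\<in>\<Theta>. integrable P (\<lambda>x. (l x \<theta>)\<^sup>2)"
    and Lipschitz: "\<exists>\<psi>\<in>borel_measurable (borel_on S). (\<forall>x\<in>S. \<psi> x \<ge> 0) \<and>
          integrable P (\<lambda>x. (\<psi> x)\<^sup>2) \<and>
          (AE x in P. \<forall>\<theta>\<in>\<Theta>. \<forall>\<theta>'\<in>\<Theta>. \<bar>l x \<theta> - l x \<theta>'\<bar> \<le> \<psi> x * norm (\<theta> - \<theta>'))"
    and phi_C2: "C2_near \<phi> 1"
    and kappa: "\<kappa> = 2 / second_deriv \<phi> 1" "\<kappa> > 0"
    and var_pos: "\<And>\<theta>. \<theta> \<in> optset P l \<Theta> \<Longrightarrow> loss_var P l \<theta> > 0"
  shows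
    "(mean_zero_gaussian_field G \<Theta> g (\<lambda>\<theta> \<theta>'. covar P (\<lambda>x. l x \<theta>) (\<lambda>x. l x \<theta>')) \<longrightarrow>
       (\<delta> \<in> o(\<lambda>n. 1 / real n) \<longrightarrow>
          converges_in_distribution
            M (\<lambda>n \<omega>. sqrt (real n) *
                 (robust_optval \<phi> l \<Theta> (empirical (borel_on S) X n \<omega>) (\<delta> n) - optval P l \<Theta>))
            G (\<lambda>\<omega>. INF \<theta>\<in>optset P l \<Theta>. g \<theta> \<omega>)) \<and>
       (\<forall>\<beta>>0. (\<forall>n\<ge>1. \<delta> n = \<beta> / real n) \<longrightarrow>
          converges_in_distribution
            M (\<lambda>n \<omega>. sqrt (real n) *
                 (robust_optval \<phi> l \<Theta> (empirical (borel_on S) X n \<omega>) (\<delta> n) - optval P l \<Theta>))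
            G (\<lambda>\<omega>. INF \<theta>\<in>optset P l \<Theta>. g \<theta> \<omega> + sqrt \<kappa> * sqrt \<beta> * loss_sd P l \<theta>)))
     \<and>
     ((\<lambda>n. 1 / real n) \<in> o(\<delta>) \<longrightarrow>
        converges_in_distribution
          M (\<lambda>n \<omega>. \<delta> n powr (- 1 / 2) *
               (robust_optval \<phi> l \<Theta> (empirical (borel_on S) X n \<omega>) (\<delta> n) - optval P l \<Theta>))
          M (\<lambda>_. sqrt \<kappa> * (INF \<theta>\<in>optset P l \<Theta>. loss_sd P l \<theta>)))"
proof -
  interpret iid_sample M "borel_on S" P X
    using M indep ident by (simp add: iid_sample_def iid_sample_axioms_def)
  interpret P: prob_space P by (rule prob_space_P)
  have ne: "\<Theta> \<noteq> {}" using second_moment by blast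
  obtain C0 where C0: "AE x in P. (SUP \<theta>\<in>\<Theta>. \<bar>l x \<theta>\<bar>) \<le> C0" using ess_bounded by blast
  obtain \<psi> where psi: "\<psi> \<in> borel_measurable (borel_on S)" "\<forall>x\<in>S. \<psi> x \<ge> 0" "integrable P (\<lambda>x. (\<psi> x)\<^sup>2)"
    "AE x in P. \<forall>\<theta>\<in>\<Theta>. \<forall>\<theta>'\<in>\<Theta>. \<bar>l x \<theta> - l x \<theta>'\<bar> \<le> \<psi> x * norm (\<theta> - \<theta>')" using Lipschitz by blast
  define C where "C = \<bar>C0\<bar>"
  have sp: "space (borel_on S) = S" by (simp add: space_restrict_space)
  \<comment> \<open>A bound on the real-valued supremum controls the members only if these are
    bounded above, which continuity on the compact set \<Theta> guarantees.\<close>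
  have bdd: "AE x in P. \<forall>\<theta>\<in>\<Theta>. \<bar>l x \<theta>\<bar> \<le> C"
  proof (rule AE_mp[OF C0], rule AE_I2, intro impI ballI)
    fix x \<theta> assume x: "x \<in> space P" "(SUP \<theta>\<in>\<Theta>. \<bar>l x \<theta>\<bar>) \<le> C0" and t: "\<theta> \<in> \<Theta>"
    have "x \<in> S" using x(1) sp by simp
    then have "continuous_on \<Theta> (\<lambda>\<theta>. \<bar>l x \<theta>\<bar>)" using continuous_sections(2)[OF l] by (intro continuous_intros) auto
    then have "bdd_above ((\<lambda>\<theta>. \<bar>l x \<theta>\<bar>) ` \<Theta>)"
      by (intro bounded_imp_bdd_above compact_imp_bounded compact_continuous_image Theta)
    then have "\<bar>l x \<theta>\<bar> \<le> (SUP \<theta>\<in>\<Theta>. \<bar>l x \<theta>\<bar>)" by (rule cSUP_upper[OF t])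
    then show "\<bar>l x \<theta>\<bar> \<le> C" using x(2) by (simp add: C_def)
  qed
  have "AE x in P. (\<forall>\<theta>\<in>\<Theta>. \<bar>l x \<theta>\<bar> \<le> C) \<and> (\<forall>\<theta>\<in>\<Theta>. \<forall>\<theta>'\<in>\<Theta>. \<bar>l x \<theta> - l x \<theta>'\<bar> \<le> \<psi> x * norm (\<theta> - \<theta>'))"
    using bdd psi(4) by eventually_elim blast
  then obtain Z where Z: "{x \<in> space P. \<not> ((\<forall>\<theta>\<in>\<Theta>. \<bar>l x \<theta>\<bar> \<le> C) \<and> (\<forall>\<theta>\<in>\<Theta>. \<forall>\<theta>'\<in>\<Theta>. \<bar>l x \<theta> - l x \<theta>'\<bar> \<le> \<psi> x * norm (\<theta> - \<theta>')))} \<subseteq> Z"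
    "emeasure P Z = 0" "Z \<in> sets P" by (rule AE_E)
  have Zm: "Z \<in> sets (borel_on S)" using Z(3) by simp
  \<comment> \<open>On a measurable null set containing all exceptional points the loss is replaced
    by 0, which satisfies every bound because \<open>C\<close> and \<psi> are nonnegative.
    Measurability in \<open>x\<close> is kept.\<close>
  define l' where "l' = (\<lambda>x \<theta>. if x \<in> Z then 0 else l x \<theta>)"
  have fam: "lipschitz_family l' \<Theta> C \<psi>"
    unfolding lipschitz_family_def
  proof (intro conjI ballI psi(1,3))
    fix \<theta> assume t: "\<theta> \<in> \<Theta>"
    have "(\<lambda>x. l x \<theta>) \<in> borel_measurable (borel_on S)"
      by (rule borel_measurable_continuous_on_restrict[OF continuous_sections(1)[OF l t]])
    then show "(\<lambda>x. l' x \<theta>) \<in> borel_measurable (borel_on S)"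
      unfolding l'_def using Zm by (intro measurable_If_set) auto
  next
    fix x \<theta> assume x: "x \<in> space (borel_on S)" and t: "\<theta> \<in> \<Theta>"
    show "\<bar>l' x \<theta>\<bar> \<le> C" using Z(1) x t by (auto simp: l'_def C_def)
  next
    fix x assume x: "x \<in> space (borel_on S)"
    show p: "0 \<le> \<psi> x" using psi(2) x sp by simp
    fix \<theta> \<theta>' assume t: "\<theta> \<in> \<Theta>" "\<theta>' \<in> \<Theta>"
    show "\<bar>l' x \<theta> - l' x \<theta>'\<bar> \<le> \<psi> x * norm (\<theta> - \<theta>')"
    proof (cases "x \<in> Z")
      case False
      then show ?thesis using Z(1) x t by (auto simp: l'_def)
    qed (simp add: l'_def p)
  qed
  have eq: "AE x in P. \<forall>\<theta>\<in>\<Theta>. l x \<theta> = l' x \<theta>"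
    using AE_not_in[of Z P] Z(2,3) by (auto simp: null_sets_def l'_def)
  note f' = lipschitz_familyD[OF fam]
  have sqrt_inf: "filterlim (\<lambda>n. sqrt (real n)) at_top sequentially"
    by (rule filterlim_compose[OF sqrt_at_top filterlim_real_sequentially])
  \<comment> \<open>For n = 0 both sides are 0 by the convention for division by 0.\<close>
  have scale: "sqrt (real n) / sqrt (real n) * emp_process l' n \<theta> \<omega> = emp_process l' n \<theta> \<omega>" for n \<theta> \<omega>
    by (cases "n = 0") (simp_all add: emp_process_def)
  \<comment> \<open>The first two regimes differ only in the limit \<open>b\<close> of sqrt n sqrt
    (\<delta> n), which is 0 in one and sqrt \<beta> in the other.\<close>
  have gauss: "converges_in_distribution M
      (\<lambda>n \<omega>. sqrt (real n) * (robust_optval \<phi> l \<Theta> (empirical (borel_on S) X n \<omega>) (\<delta> n) - optval P l \<Theta>))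
      G (\<lambda>\<omega>. INF \<theta>\<in>optset P l \<Theta>. g \<theta> \<omega> + sqrt \<kappa> * b * loss_sd P l \<theta>)"
    if F: "mean_zero_gaussian_field G \<Theta> g (\<lambda>\<theta> \<theta>'. covar P (\<lambda>x. l x \<theta>) (\<lambda>x. l x \<theta>'))"
      and b: "(\<lambda>n. sqrt (real n) * sqrt (\<delta> n)) \<longlonglongrightarrow> b" for b
  proof (rule robust_optval_conv[OF iid_sample_axioms S(2) Theta ne l fam eq phi phi_C2 kappa delta(2,3) sqrt_inf _ b])
    show "prob_space G" using F by (simp add: mean_zero_gaussian_field_def)
    show "g \<theta> \<in> borel_measurable G" if "\<theta> \<in> \<Theta>" for \<theta>
    proof -
      have "\<forall>F c. finite F \<and> F \<subseteq> \<Theta> \<longrightarrow> gaussian_rv G (\<lambda>\<omega>. \<Sum>t\<in>F. c t * g t \<omega>)"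
        using F by (simp add: mean_zero_gaussian_field_def)
      from this[rule_format, of "{\<theta>}" "\<lambda>_. 1"] show ?thesis using that by (simp add: gaussian_rv_def)
    qed
    show "continuous_on \<Theta> (\<lambda>\<theta>. g \<theta> \<omega>)" if "\<omega> \<in> space G" for \<omega>
      using F that by (simp add: mean_zero_gaussian_field_def)
    \<comment> \<open>Means and covariances do not see the change on a null set, so \<open>g\<close>
      has the covariance that belongs to \<open>l'\<close>.\<close>
    have int: "(\<integral>x. h (l x \<theta>) (l x \<theta>') \<partial>P) = (\<integral>x. h (l' x \<theta>) (l' x \<theta>') \<partial>P)"
      if "\<theta> \<in> \<Theta>" "\<theta>' \<in> \<Theta>" "\<And>u v. u \<in> borel_measurable P \<Longrightarrow> v \<in> borel_measurable P \<Longrightarrow> (\<lambda>x. h (u x) (v x)) \<in> borel_measurable P"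
      for \<theta> \<theta>' and h :: "real \<Rightarrow> real \<Rightarrow> real"
    proof (rule integral_cong_AE)
      have m: "(\<lambda>x. l x \<theta>) \<in> borel_measurable P" if "\<theta> \<in> \<Theta>" for \<theta>
        using borel_measurable_continuous_on_restrict[OF continuous_sections(1)[OF l that]] by simp
      have m': "(\<lambda>x. l' x \<theta>) \<in> borel_measurable P" if "\<theta> \<in> \<Theta>" for \<theta> using f'(1)[OF that] by simp
      show "(\<lambda>x. h (l x \<theta>) (l x \<theta>')) \<in> borel_measurable P" "(\<lambda>x. h (l' x \<theta>) (l' x \<theta>')) \<in> borel_measurable P"
        by (intro that(3) m m' that(1,2))+
      show "AE x in P. h (l x \<theta>) (l x \<theta>') = h (l' x \<theta>) (l' x \<theta>')" using eq by (rule eventually_mono) (use that in simp)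
    qed
    have "covar P (\<lambda>x. l x \<theta>) (\<lambda>x. l x \<theta>') = covar P (\<lambda>x. l' x \<theta>) (\<lambda>x. l' x \<theta>')" if "\<theta> \<in> \<Theta>" "\<theta>' \<in> \<Theta>" for \<theta> \<theta>'
      unfolding covar_def using int[OF that(1,1), of "\<lambda>u v. u"] int[OF that(2,2), of "\<lambda>u v. u"]
      by (simp add: int[OF that, of "\<lambda>u v. (u - c) * (v - d)" for c d])
    then have F': "mean_zero_gaussian_field G \<Theta> g (\<lambda>\<theta> \<theta>'. covar P (\<lambda>x. l' x \<theta>) (\<lambda>x. l' x \<theta>'))"
      using F by (simp add: mean_zero_gaussian_field_def)
    show "(\<lambda>n. \<integral>\<omega>. cts_step x y (Min ((\<lambda>\<theta>. sqrt (real n) / sqrt (real n) * emp_process l' n \<theta> \<omega> + c \<theta>) ` T)) \<partial>M)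
          \<longlonglongrightarrow> (\<integral>\<omega>. cts_step x y (Min ((\<lambda>\<theta>. g \<theta> \<omega> + c \<theta>) ` T)) \<partial>G)"
      if "finite T" "T \<noteq> {}" "T \<subseteq> \<Theta>" "x < y" for T x y c
      unfolding scale using f'(1,2) by (intro emp_process_Min_conv[OF _ _ F' that]) auto
  qed auto
  show ?thesis
  proof (intro conjI impI allI)
    assume F: "mean_zero_gaussian_field G \<Theta> g (\<lambda>\<theta> \<theta>'. covar P (\<lambda>x. l x \<theta>) (\<lambda>x. l x \<theta>'))"
      and o: "\<delta> \<in> o(\<lambda>n. 1 / real n)"
    have "(\<lambda>n. \<delta> n / (1 / real n)) \<longlonglongrightarrow> 0" by (rule smalloD_tendsto[OF o])
    then have "(\<lambda>n. sqrt (\<delta> n / (1 / real n))) \<longlonglongrightarrow> sqrt 0" by (intro tendsto_intros)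
    then have "(\<lambda>n. sqrt (real n) * sqrt (\<delta> n)) \<longlonglongrightarrow> 0" by (simp add: real_sqrt_mult mult.commute)
    from gauss[OF F this] show "converges_in_distribution
            M (\<lambda>n \<omega>. sqrt (real n) * (robust_optval \<phi> l \<Theta> (empirical (borel_on S) X n \<omega>) (\<delta> n) - optval P l \<Theta>))
            G (\<lambda>\<omega>. INF \<theta>\<in>optset P l \<Theta>. g \<theta> \<omega>)" by simp
  next
    fix \<beta> :: real
    assume F: "mean_zero_gaussian_field G \<Theta> g (\<lambda>\<theta> \<theta>'. covar P (\<lambda>x. l x \<theta>) (\<lambda>x. l x \<theta>'))"
      and \<beta>: "0 < \<beta>" "\<forall>n\<ge>1. \<delta> n = \<beta> / real n"
    have "sqrt \<beta> = sqrt (real n) * sqrt (\<delta> n)" if "n \<ge> 1" for n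
      using \<beta>(2) that by (simp add: real_sqrt_divide)
    then have "\<forall>\<^sub>F n in sequentially. sqrt \<beta> = sqrt (real n) * sqrt (\<delta> n)"
      by (intro eventually_mono[OF eventually_ge_at_top[of 1]])
    then have "(\<lambda>n. sqrt (real n) * sqrt (\<delta> n)) \<longlonglongrightarrow> sqrt \<beta>"
      by (rule Lim_transform_eventually[OF tendsto_const])
    from gauss[OF F this] show "converges_in_distribution
            M (\<lambda>n \<omega>. sqrt (real n) * (robust_optval \<phi> l \<Theta> (empirical (borel_on S) X n \<omega>) (\<delta> n) - optval P l \<Theta>))
            G (\<lambda>\<omega>. INF \<theta>\<in>optset P l \<Theta>. g \<theta> \<omega> + sqrt \<kappa> * sqrt \<beta> * loss_sd P l \<theta>)" .
  next
    assume o: "(\<lambda>n. 1 / real n) \<in> o(\<delta>)"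
    define s where "s = (\<lambda>n. \<delta> n powr (- 1 / 2))"
    \<comment> \<open>The power -1/2 is the reciprocal square root at positive arguments, so
      \<open>s\<close> is identified from index 1 on.\<close>
    have s: "s n = 1 / sqrt (\<delta> n)" if "n \<ge> 1" for n
      using delta(2)[OF that] by (simp add: s_def powr_minus powr_half_sqrt inverse_eq_divide)
    have ge1: "\<forall>\<^sub>F n in sequentially. n \<ge> (1::nat)" by (rule eventually_ge_at_top)
    have sb: "(\<lambda>n. s n * sqrt (\<delta> n)) \<longlonglongrightarrow> 1"
      by (rule Lim_transform_eventually[OF tendsto_const], rule eventually_mono[OF ge1]) (use s delta(2) in force)
    \<comment> \<open>The factor of the empirical process vanishes: fluctuations of order n^(-1/2)
      are negligible at the scale sqrt (\<delta> n).\<close>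
    have "(\<lambda>n. sqrt (1 / real n / \<delta> n)) \<longlonglongrightarrow> sqrt 0" by (intro tendsto_real_sqrt smalloD_tendsto[OF o])
    then have sn: "(\<lambda>n. s n / sqrt (real n)) \<longlonglongrightarrow> 0"
      by (rule_tac Lim_transform_eventually) (auto intro!: eventually_mono[OF ge1] simp: s real_sqrt_divide real_sqrt_mult mult.commute)
    have "filterlim (\<lambda>n. sqrt (\<delta> n)) (at_right 0) sequentially"
      unfolding filterlim_at
    proof
      show "\<forall>\<^sub>F n in sequentially. sqrt (\<delta> n) \<in> {0<..} \<and> sqrt (\<delta> n) \<noteq> 0"
        using ge1 by (rule eventually_mono) (use delta(2) in force)
      show "(\<lambda>n. sqrt (\<delta> n)) \<longlonglongrightarrow> 0" using tendsto_real_sqrt[OF delta(3)] by simp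
    qed
    then have "filterlim (\<lambda>n. inverse (sqrt (\<delta> n))) at_top sequentially"
      by (rule filterlim_compose[OF filterlim_inverse_at_top_right])
    then have sinf: "filterlim s at_top sequentially"
      by (rule filterlim_cong[OF refl refl, THEN iffD1, rotated]) (auto intro!: eventually_mono[OF ge1] simp: s inverse_eq_divide)
    \<comment> \<open>The limit process is 0 and b = 1. As nothing random remains, \<open>M\<close>
      itself serves as the space of the limit.\<close>
    have "converges_in_distribution M
      (\<lambda>n \<omega>. s n * (robust_optval \<phi> l \<Theta> (empirical (borel_on S) X n \<omega>) (\<delta> n) - optval P l \<Theta>))
      M (\<lambda>\<omega>. INF \<theta>\<in>optset P l \<Theta>. 0 + sqrt \<kappa> * 1 * loss_sd P l \<theta>)"
    proof (rule robust_optval_conv[OF iid_sample_axioms S(2) Theta ne l fam eq phi phi_C2 kappa delta(2,3) sinf _ sb M])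
      show "\<forall>\<^sub>F n in sequentially. s n / sqrt (real n) \<le> 1"
        using order_tendstoD(2)[OF sn, of 1] by (auto elim: eventually_mono)
      show "(\<lambda>n. \<integral>\<omega>. cts_step x y (Min ((\<lambda>\<theta>. s n / sqrt (real n) * emp_process l' n \<theta> \<omega> + c \<theta>) ` T)) \<partial>M)
          \<longlonglongrightarrow> (\<integral>\<omega>. cts_step x y (Min ((\<lambda>\<theta>. 0 + c \<theta>) ` T)) \<partial>M)"
        if "finite T" "T \<noteq> {}" "T \<subseteq> \<Theta>" "x < y" for T x y c
        using vanishing_process_Min_conv[OF compact_imp_bounded[OF Theta] fam sn that, of c] by simp
    qed auto
    \<comment> \<open>Taking the factor out of the infimum requires that minimizers exist, which
      follows from continuity of the objective on the compact set \<Theta>.\<close>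
    moreover have "(INF \<theta>\<in>optset P l \<Theta>. 0 + sqrt \<kappa> * 1 * loss_sd P l \<theta>) = sqrt \<kappa> * (INF \<theta>\<in>optset P l \<Theta>. loss_sd P l \<theta>)"
    proof -
      have f: "objective P l \<theta> = (\<integral>x. l' x \<theta> \<partial>P)" if "\<theta> \<in> \<Theta>" for \<theta>
        unfolding objective_def
      proof (rule integral_cong_AE)
        show "(\<lambda>x. l x \<theta>) \<in> borel_measurable P"
          using borel_measurable_continuous_on_restrict[OF continuous_sections(1)[OF l that]] by simp
        show "(\<lambda>x. l' x \<theta>) \<in> borel_measurable P" using f'(1)[OF that] by simp
        show "AE x in P. l x \<theta> = l' x \<theta>" using eq by (rule eventually_mono) (use that in simp)
      qed
      have "continuous_on \<Theta> (objective P l)"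
        by (rule continuous_on_of_norm_bound[OF f'(9)]) (use f'(11) f in simp)
      then have "optset P l \<Theta> \<noteq> {}" unfolding optset_eq_argmins by (rule argmins_compact(2)[OF Theta ne])
      then show ?thesis
        using kappa(2) by (simp add: INF_cmult_left loss_sd_def loss_var_def P.variance_positive)
    qed
    ultimately show "converges_in_distribution
          M (\<lambda>n \<omega>. \<delta> n powr (- 1 / 2) * (robust_optval \<phi> l \<Theta> (empirical (borel_on S) X n \<omega>) (\<delta> n) - optval P l \<Theta>))
          M (\<lambda>_. sqrt \<kappa> * (INF \<theta>\<in>optset P l \<Theta>. loss_sd P l \<theta>))"
      by (simp add: s_def)
  qed
qed

end
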